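(* Let $k_1,k_2$ be positive integers and $k=k_1+k_2$. Let $E_{p,q}$ denote the $k\times k$ matrix units. Let $R^{*}_{[k_1,k_2]}=(R^{*}_{[k_1,k_2]})_0+(R^{*}_{[k_1,k_2]})_1$ be the conformal superalgebra (with $\partial$, $Y^+(\cdot,z)$ as in the context) with even and odd parts $$(R^{*}_{[k_1,k_2]})_0=\mathrm{span}\{(E_{p_1,q_1})_{[0,0]}(m,n)+(E_{q_1,p_1})_{[0,0]}(n,m),\ (E_{k_1+p_2,k_1+q_2})_{[1,1]}(m,n)-(E_{k_1+q_2,k_1+p_2})_{[1,1]}(n,m)$$ $$\mid 1\le p_1,q_1\le k_1,\ 1\le p_2,q_2\le k_2,\ m,n\in\mathbb{N}\},$$ $$(R^{*}_{[k_1,k_2]})_1=\mathrm{span}\{(E_{p_1,k_1+p_2})_{[0,1]}(m,n)+(E_{k_1+p_2,p_1})_{[1,0]}(n,m)\mid 1\le p_1\le k_1,\ 1\le p_2\le k_2,\ m,n\in\mathbb{N}\}.$$ Then the conformal superalgebra $R^{*}_{[k_1,k_2]}$ is simple. Moreover, writing $u_{[i,j]}=u_{[i,j]}(0,0)$, it is generated by its subspace of weight $3/2$, $$(R^{*}_{[k_1,k_2]})^{(3/2)}=\mathrm{span}\{(E_{p_1,k_1+p_2})_{[0,1]}+(E_{k_1+p_2,p_1})_{[1,0]}\mid 1\le p_1\le k_1,\ 1\le p_2\le k_2\},$$ if $k>2$, and by the set $$\{(E_{1,2})_{[0,1]}+(E_{2,1})_{[1,0]},\ (E_{2,2})_{[1,1]}(0,1)-(E_{2,2})_{[1,1]}(1,0)\}$$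 if $k=2$.
   Context: Conventions. $\mathbb{F}$ is an arbitrary field of characteristic $0$; $\mathbb{N}=\{0,1,2,\dots\}$; $\binom{a}{n}=a(a-1)\cdots(a-n+1)/n!$ for $a\in\mathbb{Z}$, $n\in\mathbb{N}$; elements of $\mathbb{Z}_2$ are written $0,1$. $\mathrm{Res}_x$ takes the coefficient of $x^{-1}$. All binomials such as $(z-x)^{-1}$ are expanded in nonnegative powers of the second variable. $LM(V_1,V_2)$ is the space of linear maps $V_1\to V_2$. Conformal superalgebra. A conformal superalgebra $(R,\partial,Y^+(\cdot,z))$ is a $\mathbb{Z}_2$-graded $\mathbb{F}[\partial]$-module $R=R_0\oplus R_1$ with a $\mathbb{Z}_2$-graded linear map $Y^+(\cdot,z):R\to LM(R,R[z^{-1}]z^{-1})$ such that, for $u\in R_i$, $v\in R_j$: $Y^+(\partial u,z)=\frac{d}{dz}Y^+(u,z)$; $Y^+(u,z)v=(-1)^{ij}\mathrm{Res}_x\frac{e^{x\partial}Y^+(v,-x)u}{z-x}$; $Y^+(u,z_1)Y^+(v,z_2)-(-1)^{ij}Y^+(v,z_2)Y^+(u,z_1)=\mathrm{Res}_x\frac{Y^+(Y^+(u,z_1-x)v,x)}{z_2-x}$. Write $Y^+(u,z)=\sum_{n\ge 0}u_nz^{-n-1}$. An ideal is a subspace $\mathcal{I}\subset R$ with $\partial(\mathcal{I})\subset\mathcal{I}$ and $Y^+(u,z)\mathcal{I}\subset\mathcal{I}[z^{-1}]$ for all $u\in R$. $R$ is simple if its only ideals are $\{0\}$ and $R$. A (sub-)superalgebra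 $R'$ is generated by a subset $S$ if $R'=\mathrm{span}\{u^1_{m_1}\cdots u^p_{m_p}v\mid u^1,\dots,u^p,v\in S,\ p,m_1,\dots,m_p\in\mathbb{N}\}$ (for $p=0$ the expression is $v$). Construction. Let $\mathcal{A}=M_{k\times k}(\mathbb{F})$, $k=k_1+k_2$, with the $\mathbb{Z}_2$-grading $\mathcal{A}=\mathcal{A}_0\oplus\mathcal{A}_1$ in which $\mathcal{A}_0$ consists of the block-diagonal matrices (diagonal blocks of sizes $k_1\times k_1$ and $k_2\times k_2$) and $\mathcal{A}_1$ of the block-off-diagonal ones. Let $R(\mathcal{A})=\bigoplus_{i,j\in\mathbb{Z}_2}\mathcal{A}_{i+j}\otimes\mathbb{F}[t_1,t_2]$, and denote by $u_{[i,j]}(m,n)$ the element $u\otimes t_1^mt_2^n$ of the $(i,j)$-summand ($u\in\mathcal{A}_{i+j}$, $m,n\in\mathbb{N}$); it has parity $i+j$. Define $$\partial u_{[i,j]}(m,n)=(m+1)u_{[i,j]}(m+1,n)+(n+1)u_{[i,j]}(m,n+1),$$ $$Y^+(u_{[i_1,i_2]}(m_1,m_2),z)v_{[j_1,j_2]}(n_1,n_2)=\delta_{i_2,j_1}(n_1\delta_{i_2,0}+1)\binom{-n_1-1-\delta_{i_2,0}}{m_2}\sum_{p=0}^{m_1+m_2+n_1+\delta_{i_2,0}}\binom{p}{m_1}(uv)_{[i_1,j_2]}(p,n_2)z^{p-m_1-m_2-n_1-1-\delta_{i_2,0}}$$ $$-(-1)^{(i_1+i_2)(j_1+j_2)}\delta_{i_1,j_2}\bigl(\delta_{i_1,1}-(n_2+1)\delta_{i_1,0}\bigr)\binom{-n_2-1-\delta_{i_1,0}}{m_1}\sum_{q=0}^{m_1+m_2+n_2+\delta_{i_1,0}}\binom{q}{m_2}(vu)_{[j_1,i_2]}(n_1,q)z^{q-m_1-m_2-n_2-1-\delta_{i_1,0}}.$$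 Then $(R(\mathcal{A}),\partial,Y^+(\cdot,z))$ is a conformal superalgebra, and the subspace $R^{*}_{[k_1,k_2]}$ of the claim is closed under $\partial$ and $Y^+$, hence a conformal superalgebra with the restricted structure. The weight of $u_{[i,j]}(m,n)$ is $m+n+\delta_{i,0}+\delta_{j,0}+(\delta_{i,1}+\delta_{j,1})/2$; a superscript $(w)$ denotes the subspace of elements of weight $w$. *)

theory Defs
  imports "HOL-Analysis.Analysis" "HOL-Library.Z2" "HOL-Library.Poly_Mapping"
begin

section \<open>Formal series\<close>

text \<open>
  A formal Laurent series in one variable with coefficients in a vector space is the function
  \<open>int \<Rightarrow> 'v\<close> sending \<open>e\<close> to the coefficient of the \<open>e\<close>-th power of the variable. Infinite
  summations below are written with \<^const>\<open>Sum_any\<close>; in every use made of them inside a conformal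
  superalgebra only finitely many summands are nonzero.
\<close>

definition binexp :: "int \<Rightarrow> int \<Rightarrow> int \<Rightarrow> 'f::field_char_0"
  \<comment> \<open>coefficient of \<open>z^a x^b\<close> in \<open>(z - x)^e\<close>, expanded in nonnegative powers of \<open>x\<close>\<close>
  where "binexp e a b =
    (if 0 \<le> b \<and> a + b = e then (- 1) ^ nat b * (of_int e gchoose nat b) else 0)"

definition res_geom ::
    "('f::field_char_0 \<Rightarrow> 'v::ab_group_add \<Rightarrow> 'v) \<Rightarrow> (int \<Rightarrow> 'v) \<Rightarrow> int \<Rightarrow> 'v"
  \<comment> \<open>coefficient of \<open>z^a\<close> in \<open>Res_x g(x) / (z - x)\<close>\<close>
  where "res_geom smul g a = Sum_any (\<lambda>b. smul (binexp (- 1) a b) (g (- 1 - b)))"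

definition subst_diff ::
    "('f::field_char_0 \<Rightarrow> 'v::ab_group_add \<Rightarrow> 'v) \<Rightarrow> (int \<Rightarrow> 'v) \<Rightarrow> int \<Rightarrow> int \<Rightarrow> 'v"
  \<comment> \<open>coefficient of \<open>z^a x^b\<close> in \<open>g(z - x)\<close>\<close>
  where "subst_diff smul g a b = Sum_any (\<lambda>e. smul (binexp e a b) (g e))"

definition subst_neg ::
    "('f::field_char_0 \<Rightarrow> 'v::ab_group_add \<Rightarrow> 'v) \<Rightarrow> (int \<Rightarrow> 'v) \<Rightarrow> int \<Rightarrow> 'v"
  \<comment> \<open>\<open>g(- x)\<close>\<close>
  where "subst_neg smul g e = smul ((- 1) powi e) (g e)"

definition series_deriv ::
    "('f::field_char_0 \<Rightarrow> 'v::ab_group_add \<Rightarrow> 'v) \<Rightarrow> (int \<Rightarrow> 'v) \<Rightarrow> int \<Rightarrow> 'v"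
  where "series_deriv smul g e = smul (of_int (e + 1)) (g (e + 1))"

definition exp_shift ::
    "('f::field_char_0 \<Rightarrow> 'v::ab_group_add \<Rightarrow> 'v) \<Rightarrow> ('v \<Rightarrow> 'v) \<Rightarrow> (int \<Rightarrow> 'v) \<Rightarrow> int \<Rightarrow> 'v"
  \<comment> \<open>\<open>e^(x D) g(x)\<close>\<close>
  where "exp_shift smul D g e =
    Sum_any (\<lambda>t::nat. smul (1 / fact t) ((D ^^ t) (g (e - int t))))"


section \<open>Conformal superalgebras\<close>

definition sign2 :: "bit \<Rightarrow> 'f::field_char_0"
  \<comment> \<open>\<open>(-1)^i\<close> for \<open>i\<close> in \<open>Z/2\<close>\<close>
  where "sign2 i = (if i = 0 then 1 else - 1)"

definition total :: "(bit \<Rightarrow> 'v::ab_group_add set) \<Rightarrow> 'v set"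
  where "total R = {a + b | a b. a \<in> R 0 \<and> b \<in> R 1}"

text \<open>
  A conformal superalgebra is carried by a pair of subspaces \<open>R 0\<close>, \<open>R 1\<close> of an ambient vector
  space; \<open>D\<close> and \<open>Y\<close> may be defined on the ambient space, but only their values on \<open>total R\<close>
  matter. \<open>Y u v e\<close> is the coefficient of \<open>z^e\<close> in \<open>Y\<^sup>+(u,z) v\<close>.
\<close>

locale conformal_superalgebra = vector_space smul
  for smul :: "'f::field_char_0 \<Rightarrow> 'v::ab_group_add \<Rightarrow> 'v" +
  fixes R :: "bit \<Rightarrow> 'v set"
    and D :: "'v \<Rightarrow> 'v"
    and Y :: "'v \<Rightarrow> 'v \<Rightarrow> int \<Rightarrow> 'v"
  assumes subspace_R: "subspace (R i)"
    and direct_R: "R 0 \<inter> R 1 = {0}"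
    and D_graded: "u \<in> R i \<Longrightarrow> D u \<in> R i"
    and D_add: "\<lbrakk>u \<in> total R; v \<in> total R\<rbrakk> \<Longrightarrow> D (u + v) = D u + D v"
    and D_scale: "u \<in> total R \<Longrightarrow> D (smul \<alpha> u) = smul \<alpha> (D u)"
    and Y_graded: "\<lbrakk>u \<in> R i; v \<in> R j\<rbrakk> \<Longrightarrow> Y u v e \<in> R (i + j)"
    and Y_add_left: "\<lbrakk>u \<in> total R; u' \<in> total R; v \<in> total R\<rbrakk>
        \<Longrightarrow> Y (u + u') v e = Y u v e + Y u' v e"
    and Y_scale_left: "\<lbrakk>u \<in> total R; v \<in> total R\<rbrakk> \<Longrightarrow> Y (smul \<alpha> u) v e = smul \<alpha> (Y u v e)"
    and Y_add_right: "\<lbrakk>u \<in> total R; v \<in> total R; v' \<in> total R\<rbrakk>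
        \<Longrightarrow> Y u (v + v') e = Y u v e + Y u v' e"
    and Y_scale_right: "\<lbrakk>u \<in> total R; v \<in> total R\<rbrakk> \<Longrightarrow> Y u (smul \<alpha> v) e = smul \<alpha> (Y u v e)"
    and Y_negative: "\<lbrakk>u \<in> total R; v \<in> total R; 0 \<le> e\<rbrakk> \<Longrightarrow> Y u v e = 0"
    and Y_finite: "\<lbrakk>u \<in> total R; v \<in> total R\<rbrakk> \<Longrightarrow> finite {e. Y u v e \<noteq> 0}"
    and Y_deriv: "\<lbrakk>u \<in> R i; v \<in> R j\<rbrakk> \<Longrightarrow> Y (D u) v = series_deriv smul (Y u v)"
    and Y_skew: "\<lbrakk>u \<in> R i; v \<in> R j\<rbrakk> \<Longrightarrow>
        Y u v e = smul (sign2 (i * j))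
          (res_geom smul (exp_shift smul D (subst_neg smul (Y v u))) e)"
    \<comment> \<open>the coefficient of \<open>z\<^sub>1^a z\<^sub>2^c\<close> in the Jacobi identity, applied to \<open>w\<close>\<close>
    and Y_jacobi: "\<lbrakk>u \<in> R i; v \<in> R j; w \<in> total R\<rbrakk> \<Longrightarrow>
        Y u (Y v w c) a - smul (sign2 (i * j)) (Y v (Y u w a) c) =
          res_geom smul (\<lambda>b. Sum_any (\<lambda>d. Y (subst_diff smul (Y u v) a d) w (b - d))) c"

definition conformal_ideal ::
    "('f::field_char_0 \<Rightarrow> 'v::ab_group_add \<Rightarrow> 'v) \<Rightarrow> (bit \<Rightarrow> 'v set) \<Rightarrow> ('v \<Rightarrow> 'v)
      \<Rightarrow> ('v \<Rightarrow> 'v \<Rightarrow> int \<Rightarrow> 'v) \<Rightarrow> 'v set \<Rightarrow> bool"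
  where "conformal_ideal smul R D Y I \<longleftrightarrow>
    module.subspace smul I \<and> I \<subseteq> total R \<and> D ` I \<subseteq> I \<and>
    (\<forall>u\<in>total R. \<forall>v\<in>I. \<forall>e. Y u v e \<in> I)"

definition simple_conformal_superalgebra ::
    "('f::field_char_0 \<Rightarrow> 'v::ab_group_add \<Rightarrow> 'v) \<Rightarrow> (bit \<Rightarrow> 'v set) \<Rightarrow> ('v \<Rightarrow> 'v)
      \<Rightarrow> ('v \<Rightarrow> 'v \<Rightarrow> int \<Rightarrow> 'v) \<Rightarrow> bool"
  where "simple_conformal_superalgebra smul R D Y \<longleftrightarrow>
    conformal_superalgebra smul R D Y \<and>
    (\<forall>I. conformal_ideal smul R D Y I \<longrightarrow> I = {0} \<or> I = total R)"

definition nth_product :: "('v \<Rightarrow> 'v \<Rightarrow> int \<Rightarrow> 'v) \<Rightarrow> 'v \<Rightarrow> nat \<Rightarrow> 'v \<Rightarrow> 'v"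
  \<comment> \<open>\<open>u\<^sub>n v\<close>, where \<open>Y\<^sup>+(u,z) v\<close> is the sum of the \<open>(u\<^sub>n v) z^(-n-1)\<close>\<close>
  where "nth_product Y u n v = Y u v (- int n - 1)"

definition generated_by ::
    "('f::field_char_0 \<Rightarrow> 'v::ab_group_add \<Rightarrow> 'v) \<Rightarrow> (bit \<Rightarrow> 'v set)
      \<Rightarrow> ('v \<Rightarrow> 'v \<Rightarrow> int \<Rightarrow> 'v) \<Rightarrow> 'v set \<Rightarrow> bool"
  where "generated_by smul R Y S \<longleftrightarrow>
    S \<subseteq> total R \<and>
    total R = module.span smul
      {foldr (\<lambda>(u, m) w. nth_product Y u m w) us v | us v. fst ` set us \<subseteq> S \<and> v \<in> S}"


section \<open>The construction from matrices\<close>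

text \<open>
  The row and column indices \<open>1, \<dots>, k\<^sub>1\<close> and \<open>k\<^sub>1 + 1, \<dots>, k\<^sub>1 + k\<^sub>2\<close> are the elements \<open>Inl p\<close> and
  \<open>Inr q\<close> of \<open>'m + 'n\<close>, with \<open>k\<^sub>1 = CARD('m)\<close> and \<open>k\<^sub>2 = CARD('n)\<close>.
\<close>

type_synonym ('f, 'm, 'n) mtx = "'f ^ ('m + 'n) ^ ('m + 'n)"

definition mtx_scale :: "'f::field_char_0 \<Rightarrow> ('f, 'm::finite, 'n::finite) mtx \<Rightarrow> ('f, 'm, 'n) mtx"
  where "mtx_scale c u = (\<chi> r s. c * u $ r $ s)"

definition mtx_unit :: "'m + 'n \<Rightarrow> 'm + 'n \<Rightarrow> ('f::field_char_0, 'm::finite, 'n::finite) mtx"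
  where "mtx_unit p q = (\<chi> r s. if r = p \<and> s = q then 1 else 0)"

definition block :: "'m + 'n \<Rightarrow> bit"
  where "block r = (case r of Inl _ \<Rightarrow> 0 | Inr _ \<Rightarrow> 1)"

definition mtx_graded :: "bit \<Rightarrow> ('f::field_char_0, 'm::finite, 'n::finite) mtx set"
  where "mtx_graded i = {u. \<forall>r s. u $ r $ s \<noteq> 0 \<longrightarrow> block r + block s = i}"

text \<open>
  The coefficient of an element at \<open>(i, j, m, n)\<close> is the matrix standing in front of
  \<open>t\<^sub>1^m t\<^sub>2^n\<close> in the \<open>(i, j)\<close>-summand. The ambient space \<open>ralg\<close> allows arbitrary matrices in each
  summand; \<open>RA\<close> cuts out \<open>R(\<A>)\<close>, in which those at \<open>(i, j, m, n)\<close> lie in \<open>\<A>\<^bsub>i+j\<^esub>\<close>.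
\<close>

type_synonym ('f, 'm, 'n) ralg = "(bit \<times> bit \<times> nat \<times> nat) \<Rightarrow>\<^sub>0 ('f, 'm, 'n) mtx"

definition ra_scale ::
    "'f::field_char_0 \<Rightarrow> ('f, 'm::finite, 'n::finite) ralg \<Rightarrow> ('f, 'm, 'n) ralg"
  where "ra_scale c x = Poly_Mapping.map (mtx_scale c) x"

definition elt ::
    "('f::field_char_0, 'm::finite, 'n::finite) mtx \<Rightarrow> bit \<Rightarrow> bit \<Rightarrow> nat \<Rightarrow> nat \<Rightarrow> ('f, 'm, 'n) ralg"
  \<comment> \<open>\<open>u\<^bsub>[i,j]\<^esub>(m,n)\<close>\<close>
  where "elt u i j m n = Poly_Mapping.single (i, j, m, n) u"

definition RA :: "bit \<Rightarrow> ('f::field_char_0, 'm::finite, 'n::finite) ralg set"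
  where "RA d = {x. \<forall>i j m n. Poly_Mapping.lookup x (i, j, m, n) \<in>
    (if i + j = d then mtx_graded (i + j) else {0})}"

definition ra_D :: "('f::field_char_0, 'm::finite, 'n::finite) ralg \<Rightarrow> ('f, 'm, 'n) ralg"
  where "ra_D x = (\<Sum>(i, j, m, n)\<in>Poly_Mapping.keys x.
    let u = Poly_Mapping.lookup x (i, j, m, n) in
      ra_scale (of_nat (m + 1)) (elt u i j (m + 1) n) +
      ra_scale (of_nat (n + 1)) (elt u i j m (n + 1)))"

definition zmon :: "'v::ab_group_add \<Rightarrow> int \<Rightarrow> int \<Rightarrow> 'v"
  \<comment> \<open>the series \<open>v z^e\<close>\<close>
  where "zmon v e = (\<lambda>a. if a = e then v else 0)"

text \<open>
  \<open>ra_Y_elt u i\<^sub>1 i\<^sub>2 m\<^sub>1 m\<^sub>2 v j\<^sub>1 j\<^sub>2 n\<^sub>1 n\<^sub>2\<close> is the series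
  \<open>Y\<^sup>+(u\<^bsub>[i\<^sub>1,i\<^sub>2]\<^esub>(m\<^sub>1,m\<^sub>2),z) v\<^bsub>[j\<^sub>1,j\<^sub>2]\<^esub>(n\<^sub>1,n\<^sub>2)\<close>, and \<open>ra_Y\<close> is its bilinear extension.
\<close>

definition ra_Y_elt ::
    "('f::field_char_0, 'm::finite, 'n::finite) mtx \<Rightarrow> bit \<Rightarrow> bit \<Rightarrow> nat \<Rightarrow> nat
      \<Rightarrow> ('f, 'm, 'n) mtx \<Rightarrow> bit \<Rightarrow> bit \<Rightarrow> nat \<Rightarrow> nat \<Rightarrow> int \<Rightarrow> ('f, 'm, 'n) ralg"
  where "ra_Y_elt u i1 i2 m1 m2 v j1 j2 n1 n2 e =
    (let \<delta> = (of_bool (i2 = 0) :: nat) in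
      ra_scale
        (of_bool (i2 = j1) * of_nat (n1 * \<delta> + 1) * ((- of_nat n1 - 1 - of_nat \<delta>) gchoose m2))
        (\<Sum>p = 0..m1 + m2 + n1 + \<delta>.
          zmon (ra_scale (of_nat (p choose m1)) (elt (u ** v) i1 j2 p n2))
            (int p - int m1 - int m2 - int n1 - 1 - int \<delta>) e)) -
    (let \<delta> = (of_bool (i1 = 0) :: nat) in
      ra_scale
        (sign2 ((i1 + i2) * (j1 + j2)) * of_bool (i1 = j2) *
          (of_bool (i1 = 1) - of_nat (n2 + 1) * of_nat \<delta>) *
          ((- of_nat n2 - 1 - of_nat \<delta>) gchoose m1))
        (\<Sum>q = 0..m1 + m2 + n2 + \<delta>.
          zmon (ra_scale (of_nat (q choose m2)) (elt (v ** u) j1 i2 n1 q))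
            (int q - int m1 - int m2 - int n2 - 1 - int \<delta>) e))"

definition ra_Y :: "('f::field_char_0, 'm::finite, 'n::finite) ralg \<Rightarrow> ('f, 'm, 'n) ralg
      \<Rightarrow> int \<Rightarrow> ('f, 'm, 'n) ralg"
  where "ra_Y x y e =
    (\<Sum>(i1, i2, m1, m2)\<in>Poly_Mapping.keys x. \<Sum>(j1, j2, n1, n2)\<in>Poly_Mapping.keys y.
      ra_Y_elt (Poly_Mapping.lookup x (i1, i2, m1, m2)) i1 i2 m1 m2
        (Poly_Mapping.lookup y (j1, j2, n1, n2)) j1 j2 n1 n2 e)"

definition weight :: "bit \<times> bit \<times> nat \<times> nat \<Rightarrow> rat"
  where "weight = (\<lambda>(i, j, m, n). of_nat m + of_nat n + of_bool (i = 0) + of_bool (j = 0) +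
    (of_bool (i = 1) + of_bool (j = 1)) / 2)"

definition weight_space ::
    "(bit \<Rightarrow> ('f::field_char_0, 'm::finite, 'n::finite) ralg set) \<Rightarrow> rat \<Rightarrow> ('f, 'm, 'n) ralg set"
  where "weight_space R w = {x \<in> total R. \<forall>\<kappa>\<in>Poly_Mapping.keys x. weight \<kappa> = w}"


section \<open>The subalgebra \<open>R\<^sup>*\<close>\<close>

type_synonym ('f, 'm, 'n) ralg_graded = "bit \<Rightarrow> ('f, 'm, 'n) ralg set"

definition Rstar :: "('f::field_char_0, 'm::finite, 'n::finite) ralg_graded"
  where "Rstar d =
    (if d = 0 then
       module.span ra_scale
         ({elt (mtx_unit (Inl p) (Inl q)) 0 0 m n + elt (mtx_unit (Inl q) (Inl p)) 0 0 n m
            | p q m n. True} \<union>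
          {elt (mtx_unit (Inr p) (Inr q)) 1 1 m n - elt (mtx_unit (Inr q) (Inr p)) 1 1 n m
            | p q m n. True})
     else
       module.span ra_scale
         {elt (mtx_unit (Inl p) (Inr q)) 0 1 m n + elt (mtx_unit (Inr q) (Inl p)) 1 0 n m
            | p q m n. True})"

lemma lookup_ra_scale:
  "Poly_Mapping.lookup (ra_scale c x) k = mtx_scale c (Poly_Mapping.lookup x k)"
  by (auto simp: ra_scale_def Poly_Mapping.map.rep_eq when_def mtx_scale_def vec_eq_iff)

lemma vector_space_ra_scale:
  "vector_space (ra_scale :: 'f::field_char_0 \<Rightarrow> ('f, 'm::finite, 'n::finite) ralg \<Rightarrow> _)"
  by unfold_locales
    (auto intro!: poly_mapping_eqI
      simp: lookup_ra_scale lookup_add mtx_scale_def vec_eq_iff algebra_simps)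

lemma Rstar_subset_RA:
  "(Rstar d :: ('f::field_char_0, 'm::finite, 'n::finite) ralg set) \<subseteq> RA d"
proof -
  interpret vector_space "ra_scale :: 'f \<Rightarrow> ('f, 'm, 'n) ralg \<Rightarrow> _"
    by (rule vector_space_ra_scale)
  have gr_iff: "u \<in> mtx_graded e \<longleftrightarrow> (\<forall>r s. block r + block s \<noteq> e \<longrightarrow> u $ r $ s = 0)"
    for u :: "('f, 'm, 'n) mtx" and e
    unfolding mtx_graded_def by blast
  define C :: "bit \<Rightarrow> bit \<Rightarrow> ('f, 'm, 'n) mtx set"
    where "C e d = (if e = d then mtx_graded e else {0})" for e d
  have C: "0 \<in> C e d" "a \<in> C e d \<Longrightarrow> b \<in> C e d \<Longrightarrow> a + b \<in> C e d"
    "a \<in> C e d \<Longrightarrow> mtx_scale c a \<in> C e d" for a b c e d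
    unfolding C_def by (simp_all add: gr_iff mtx_scale_def vec_eq_iff split: if_splits)
  have RA_C: "RA d = {x. \<forall>i j m n. Poly_Mapping.lookup x (i, j, m, n) \<in> C (i + j) d}" for d
    unfolding RA_def C_def ..
  have sub: "subspace (RA d :: ('f, 'm, 'n) ralg set)" for d
    by (rule subspaceI; unfold RA_C mem_Collect_eq lookup_add lookup_ra_scale lookup_zero)
      (blast intro: C)+
  have elt_RA: "elt u i j m n \<in> RA d" if "u \<in> mtx_graded d" "i + j = d"
    for u :: "('f, 'm, 'n) mtx" and i j m n d
    using that by (auto simp: RA_def elt_def lookup_single when_def mtx_graded_def)
  have units:
    "mtx_unit (Inl p) (Inl q) \<in> (mtx_graded 0 :: ('f, 'm, 'n) mtx set)"
    "mtx_unit (Inr p') (Inr q') \<in> (mtx_graded 0 :: ('f, 'm, 'n) mtx set)"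
    "mtx_unit (Inl p) (Inr q') \<in> (mtx_graded 1 :: ('f, 'm, 'n) mtx set)"
    "mtx_unit (Inr q') (Inl p) \<in> (mtx_graded 1 :: ('f, 'm, 'n) mtx set)" for p q p' q'
    by (auto simp: mtx_unit_def mtx_graded_def block_def)
  show ?thesis
  proof (cases "d = 0")
    case True
    show ?thesis
      unfolding Rstar_def True if_P[OF refl]
      by (rule span_minimal[OF _ sub])
        (auto intro!: sub[THEN subspace_add] sub[THEN subspace_diff] elt_RA units)
  next
    case False
    then have d: "d = 1"
      by (cases d) simp_all
    show ?thesis
      unfolding Rstar_def d if_not_P[OF one_neq_zero]
      by (rule span_minimal[OF _ sub]) (auto intro!: sub[THEN subspace_add] elt_RA units)
  qed
qed

end

theory Submission
  imports Defs
begin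

text \<open>
  On block-compatible elements the product \<open>u\<^sub>l v\<close> is \<open>mu l u v - (-1)^(ij) nu l u v\<close>, where \<open>mu\<close> is
  an associative-type product acting on the first index of \<open>v\<close> and \<open>nu\<close> the transposed one acting
  on the second. The Jacobi identity then splits into five identities for \<open>mu\<close> and \<open>nu\<close>, each of
  which reduces to a Vandermonde convolution. The elements of \<open>R\<^sup>*\<close> are the symmetrised \<open>S a m b n\<close>,
  and \<open>S a m b n\<close> acts on \<open>R\<^sup>*\<close> by super-derivations of the tensor square of the space with basis
  \<open>\<phi>\<^sub>c(p)\<close>. For large \<open>n\<close> and a suitable product index this derivation is a multiple of the elementary
  map \<open>\<phi>\<^sub>b(r) \<mapsto> \<phi>\<^sub>a(t)\<close> on vectors whose \<open>b\<close>-components have index at most \<open>r\<close>. Two such maps send any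
  nonzero element of an ideal to a multiple of a single \<open>S a' t' a t\<close>, whence simplicity. For the
  generation statements, products of generators give the weight 2 elements \<open>S p 0 p 0\<close> and
  \<open>S q 1 q 0\<close> (only their sums if \<open>k = 2\<close>, whence the extra generator), whose zeroth products raise the indices of odd elements; the even
  elements are elementary products of odd ones.
\<close>

text \<open>The coefficients become transparent in terms of free fields. For an index
  \<open>a\<close> of the first block let \<open>\<phi>\<^sub>a\<close> be a boson of weight 1, for
  one of the second block a fermion of weight 1/2, and let \<open>\<phi>\<^sub>a(m)\<close> be the
  m-th divided derivative. Then \<open>E a m b n\<close> behaves like the product of
  \<open>\<phi>\<^sub>a(m)\<close> and \<open>\<phi>\<^sub>b(n)\<close>, and \<open>mu\<close> and
  \<open>nu\<close> are two of the four single contractions in Wick's formula; symmetrisation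
  supplies the other two. Contracting \<open>\<phi>\<^sub>b(n)\<close> at z with
  \<open>\<phi>\<^sub>b(r)\<close> at w means differentiating (z - w)^(-1-d), which yields
  \<open>(- 1) ^ n * ct d n r\<close>. The remaining \<open>\<phi>\<^sub>a(m)\<close> at z is Taylor
  expanded about w, which yields the binomial coefficient in \<open>lam\<close>. The axioms compare
  different orders of contracting and expanding.

  Generation has an obstacle of its own: in the words that define it, all left factors are
  generators, while the argument multiplies by composite elements. That such products stay in the
  span of the words follows from the Jacobi identity.\<close>

interpretation ra: vector_space "ra_scale :: 'f::field_char_0 \<Rightarrow> ('f, 'm::finite, 'n::finite) ralg \<Rightarrow> _"
  by (rule vector_space_ra_scale)

section \<open>Scalar identities\<close>

text \<open>For \<open>d \<le> 1\<close> and up to the sign \<open>(- 1) ^ n\<close>, this is the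
  coefficient left by the divided derivatives of order \<open>n\<close> in z and \<open>r\<close> in
  w of (z - w)^(-1-d). Its symmetry in \<open>n\<close> and \<open>r\<close> is what skew-symmetry
  rests on.\<close>

definition ct :: "nat \<Rightarrow> nat \<Rightarrow> nat \<Rightarrow> 'f::field_char_0"
  where "ct d n r = fact (n + r + d) / (fact n * fact r)"

text \<open>
  \<open>lam d m n r l\<close> is the coefficient of the first sum in the definition of \<open>Y\<^sup>+\<close> at the \<open>l\<close>-th product,
  for \<open>(m\<^sub>1, m\<^sub>2, n\<^sub>1) = (m, n, r)\<close> and \<open>d = \<delta>\<^bsub>i\<^sub>2,0\<^esub>\<close>. The cutoff on \<open>l\<close> guards the truncated subtraction.
\<close>

definition lam :: "nat \<Rightarrow> nat \<Rightarrow> nat \<Rightarrow> nat \<Rightarrow> nat \<Rightarrow> 'f::field_char_0"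
  where "lam d m n r l =
    (if l \<le> m + n + r + d
     then (- 1) ^ n * ct d n r * of_nat ((m + n + r + d - l) choose m) else 0)"

lemma ct_commute: "ct d n r = ct d r n"
  by (simp add: ct_def add.commute mult.commute)

text \<open>For \<open>p \<le> r\<close> both sides are (n+r+d)! / (n! p! (r-p)!); otherwise both
  vanish.\<close>

lemma ct_choose:
  "(ct d n p :: 'f::field_char_0) * of_nat ((n + r + d) choose (n + p + d)) =
    of_nat (r choose p) * ct d n r"
proof (cases "p \<le> r")
  case True
  have *: "(of_nat ((n + r + d) choose (n + p + d)) :: 'f) =
      fact (n + r + d) / (fact (n + p + d) * fact (r - p))"
    using True by (subst binomial_fact) (simp_all)
  have **: "(of_nat (r choose p) :: 'f) = fact r / (fact p * fact (r - p))"
    using True by (rule binomial_fact)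
  show ?thesis
    unfolding ct_def * ** by (simp add: divide_simps)
next
  case False
  then show ?thesis by (simp add: binomial_eq_0)
qed

text \<open>Both sides are (y+r+d)! / (n! (y-n)! r!). The left-hand product arises when an index
  that was Taylor expanded in one product is contracted in the next.\<close>

lemma choose_ct:
  assumes "n \<le> y"
  shows "of_nat (y choose n) * (ct d y r :: 'f::field_char_0) =
    ct d n r * of_nat ((y + r + d) choose (y - n))"
proof -
  have *: "(of_nat (y choose n) :: 'f) = fact y / (fact n * fact (y - n))"
    using assms by (rule binomial_fact)
  have **: "(of_nat ((y + r + d) choose (y - n)) :: 'f) =
      fact (y + r + d) / (fact (y - n) * fact (n + r + d))"
    using assms by (subst binomial_fact) (simp_all add: add_ac)
  show ?thesis
    unfolding ct_def * ** by (simp add: divide_simps)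
qed

text \<open>Trinomial revision \<open>(R choose s) * (s choose m) = (R choose m) * ((R - m) choose
  (s - m))\<close> with \<open>s = m + K - j\<close> leaves a Vandermonde sum in \<open>j\<close>.
  The condition \<open>j \<le> m + K\<close> guards the truncated subtraction.\<close>

lemma choose_choose_sum:
  "(\<Sum>j\<le>M. (M choose j) *
      (if j \<le> m + K then ((m + K - j) choose m) * (R choose (m + K - j)) else 0)) =
    (R choose m) * ((M + R - m) choose K)"
proof (cases "m \<le> R")
  case True
  have "(\<Sum>j\<le>M. (M choose j) *
      (if j \<le> m + K then ((m + K - j) choose m) * (R choose (m + K - j)) else 0)) =
    (\<Sum>j\<le>M. if j \<le> K then (R choose m) * ((M choose j) * ((R - m) choose (K - j))) else 0)"
  proof (rule sum.cong[OF refl])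
    fix j
    show "(M choose j) *
        (if j \<le> m + K then ((m + K - j) choose m) * (R choose (m + K - j)) else 0) =
      (if j \<le> K then (R choose m) * ((M choose j) * ((R - m) choose (K - j))) else 0)"
    proof (cases "j \<le> K")
      case jK: True
      have "((m + K - j) choose m) * (R choose (m + K - j)) = (R choose m) * ((R - m) choose (K - j))"
      proof (cases "m + K - j \<le> R")
        case True
        have "(R choose (m + K - j)) * ((m + K - j) choose m) =
            (R choose m) * ((R - m) choose (m + K - j - m))"
          by (rule choose_mult) (use True jK in auto)
        moreover have "m + K - j - m = K - j" using jK by simp
        ultimately show ?thesis by (simp add: mult.commute)
      next
        case False
        then show ?thesis using jK True by (simp add: binomial_eq_0)
      qed
      then show ?thesis using jK by simp
    next
      case False
      then show ?thesis by (simp add: binomial_eq_0)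
    qed
  qed
  also have "\<dots> = (\<Sum>j\<le>K. (R choose m) * ((M choose j) * ((R - m) choose (K - j))))"
    by (rule sum.mono_neutral_cong) auto
  also have "\<dots> = (R choose m) * ((M + (R - m)) choose K)"
    by (simp add: sum_distrib_left[symmetric] vandermonde)
  finally show ?thesis using True by simp
next
  case False
  then have "((m + K - j) choose m) * (R choose (m + K - j)) = 0" for j
    by (cases "m \<le> m + K - j") (simp_all add: binomial_eq_0)
  then show ?thesis using False by (simp add: binomial_eq_0)
qed

text \<open>A chain of two contractions, u with v and v with w, can be carried out in either order.
  All terms with nonzero coefficient end at the same index \<open>R\<close>, so only scalars have to
  be compared. \<open>F\<close> is left open because the moving index sits in the first slot for
  \<open>mu\<close> and in the second for \<open>nu\<close>.\<close>

lemma lam_comp: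
  fixes F :: "nat \<Rightarrow> ('f::field_char_0, 'm::finite, 'n::finite) ralg"
  shows "ra_scale (lam d' p q r N * lam d m n (p + q + r + d' - N) M)
      (F (m + n + (p + q + r + d' - N) + d - M)) =
    (\<Sum>j\<le>M. ra_scale (of_nat (M choose j) *
      (lam d m n p j * lam d' (m + n + p + d - j) q r (M + N - j)))
      (F ((m + n + p + d - j) + q + r + d' - (M + N - j))))"
    (is "ra_scale ?c (F ?i) = (\<Sum>j\<le>M. ra_scale (?f j) (F (?k j)))")
proof (cases "M + N \<le> m + n + p + q + r + d + d'")
  case True
  define R where "R = m + n + p + q + r + d + d' - (M + N)"
  \<comment> \<open>Neither factor \<open>ct\<close> depends on \<open>j\<close>; what does is the
    summand of \<open>choose_choose_sum\<close> with \<open>K = n + p + d\<close>.\<close>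
  have f: "?f j = of_nat ((M choose j) * (if j \<le> m + (n + p + d)
      then ((m + (n + p + d) - j) choose m) * (R choose (m + (n + p + d) - j)) else 0)) *
      ((-1) ^ n * ct d n p * ((-1) ^ q * ct d' q r)) \<and> (?f j \<noteq> 0 \<longrightarrow> ?k j = R)" if "j \<le> M" for j
  proof (cases "j \<le> m + n + p + d")
    case j: True
    have k: "?k j = R" using True that j by (simp add: R_def)
    have g: "M + N - j \<le> (m + n + p + d - j) + q + r + d'" using True that j by linarith
    have "?f j = of_nat (M choose j) * (((- 1) ^ n * ct d n p * of_nat ((m + n + p + d - j) choose m)) *
        ((- 1) ^ q * ct d' q r * of_nat (R choose (m + n + p + d - j))))"
      unfolding lam_def if_P[OF g] if_P[OF j] k ..
    then have "?f j = of_nat ((M choose j) * (if j \<le> m + (n + p + d)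
      then ((m + (n + p + d) - j) choose m) * (R choose (m + (n + p + d) - j)) else 0)) *
      ((-1) ^ n * ct d n p * ((-1) ^ q * ct d' q r))"
      using j by (simp add: add.assoc mult_ac)
    with k show ?thesis by blast
  next
    case False
    then show ?thesis by (simp add: lam_def)
  qed
  have "(\<Sum>j\<le>M. ra_scale (?f j) (F (?k j))) = (\<Sum>j\<le>M. ra_scale (?f j) (F R))"
    by (rule sum.cong[OF refl]) (use f in fastforce)
  also have "\<dots> = ra_scale (\<Sum>j\<le>M. ?f j) (F R)"
    by (rule ra.scale_sum_left[symmetric])
  also have "(\<Sum>j\<le>M. ?f j) = of_nat ((R choose m) * ((M + R - m) choose (n + p + d))) *
      ((-1) ^ n * ct d n p * ((-1) ^ q * ct d' q r))"
    unfolding choose_choose_sum[symmetric] of_nat_sum sum_distrib_right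
    by (rule sum.cong[OF refl]) (use f in simp)
  also have "\<dots> = ?c"
  proof (cases "N \<le> p + q + r + d'")
    case N: True
    define r' where "r' = p + q + r + d' - N"
    have R: "R = m + n + r' + d - M" "M \<le> m + n + r' + d"
      using N True by (auto simp: R_def r'_def)
    have l1: "lam d' p q r N = ((- 1) ^ q * ct d' q r * of_nat (r' choose p) :: 'f)"
      unfolding lam_def if_P[OF N] r'_def ..
    have l2: "lam d m n r' M = ((- 1) ^ n * ct d n r' * of_nat (R choose m) :: 'f)"
      unfolding lam_def if_P[OF R(2)] R(1) ..
    show ?thesis
    proof (cases "m \<le> R")
      case m: True
      then have e: "M + R - m = n + r' + d" using R by simp
      \<comment> \<open>The Vandermonde value contains
        \<open>(n + r' + d) choose (n + p + d)\<close>, which \<open>ct_choose\<close> trades for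
        \<open>r' choose p\<close>, the binomial coefficient of the inner product.\<close>
      have "of_nat ((R choose m) * ((M + R - m) choose (n + p + d))) *
          ((-1) ^ n * ct d n p * ((-1) ^ q * ct d' q r)) =
        (ct d n p * of_nat ((n + r' + d) choose (n + p + d))) *
          (of_nat (R choose m) * (-1) ^ n * (-1) ^ q * (ct d' q r :: 'f))"
        unfolding e of_nat_mult by (simp only: mult_ac)
      then show ?thesis
        unfolding ct_choose r'_def[symmetric] l1 l2 by (simp only: mult_ac)
    next
      case False
      then show ?thesis unfolding r'_def[symmetric] l2 by (simp add: binomial_eq_0)
    qed
  next
    case False
    have "(R choose m) * ((M + R - m) choose (n + p + d)) = 0"
    proof (cases "m \<le> R")
      case m: True
      then have "M + R - m < n + p + d" using False True unfolding R_def by linarith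
      then show ?thesis by (simp add: binomial_eq_0)
    qed (simp add: binomial_eq_0)
    then show ?thesis using False by (simp add: lam_def)
  qed
  also have "ra_scale ?c (F R) = ra_scale ?c (F ?i)"
  proof (cases "N \<le> p + q + r + d'")
    case N: True
    then have "?i = R" using True by (simp add: R_def)
    then show ?thesis by simp
  qed (simp add: lam_def)
  finally show ?thesis by simp
next
  case False
  have c: "?c = 0" using False by (auto simp: lam_def)
  have "?f j = 0" if "j \<le> M" for j
    using False that by (auto simp: lam_def)
  then have "(\<Sum>j\<le>M. ra_scale (?f j) (F (?k j))) = 0"
    by (intro sum.neutral ballI) (simp only: atMost_iff ra.scale_zero_left)
  then show ?thesis unfolding c by (simp only: ra.scale_zero_left)
qed

text \<open>Upper negation turns the signed factor into \<open>(- B - 1) gchoose (K - j)\<close>, so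
  this is the Vandermonde convolution with upper arguments \<open>M\<close> and
  \<open>- B - 1\<close>. Their sum can have either sign, hence \<open>gchoose\<close> on the
  right.\<close>

lemma alternating_vandermonde:
  "(\<Sum>j\<le>M. if j \<le> K then of_nat (M choose j) * ((- 1) ^ (K - j) *
      of_nat ((B + K - j) choose (K - j))) else 0) =
    ((of_int (int M - int B - 1) :: 'f::field_char_0) gchoose K)"
proof -
  have g: "((- of_nat B - 1 :: 'f) gchoose i) = (- 1) ^ i * of_nat ((B + i) choose i)" for i
    using gbinomial_minus[of "of_nat B + 1 :: 'f" i]
    by (simp add: binomial_gbinomial minus_add_distrib flip: diff_conv_add_uminus)
  have "(\<Sum>j\<le>M. if j \<le> K then of_nat (M choose j) * ((- 1) ^ (K - j) *
      of_nat ((B + K - j) choose (K - j))) else (0 :: 'f)) =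
    (\<Sum>j\<in>{0..K}. (of_nat M gchoose j) * ((- of_nat B - 1) gchoose (K - j)))"
    by (rule sum.mono_neutral_cong) (auto simp: g binomial_gbinomial[symmetric] binomial_eq_0)
  also have "\<dots> = ((of_nat M + (- of_nat B - 1)) gchoose K)"
    by (rule gbinomial_Vandermonde)
  finally show ?thesis by (simp add: algebra_simps)
qed

text \<open>Here the index contracted with w has already been moved by the product of u and v. So
  \<open>j\<close> also enters the sign and the constant \<open>ct\<close>, and the sum alternates;
  \<open>choose_ct\<close> extracts the dependence on \<open>j\<close> from the constant.\<close>

lemma lam_comp_transposed:
  fixes F :: "nat \<Rightarrow> ('f::field_char_0, 'm::finite, 'n::finite) ralg"
  shows "ra_scale (lam d' m n r M * lam d p q (m + n + r + d' - M) N)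
      (F (p + q + (m + n + r + d' - M) + d - N)) =
    (\<Sum>j\<le>M. ra_scale (of_nat (M choose j) *
      ((- 1) ^ d * lam d n m q j * lam d' p (m + n + q + d - j) r (M + N - j)))
      (F (p + (m + n + q + d - j) + r + d' - (M + N - j))))"
    (is "ra_scale ?c (F ?i) = (\<Sum>j\<le>M. ra_scale (?f j) (F (?k j)))")
proof (cases "M + N \<le> m + n + p + q + r + d + d'")
  case True
  define R where "R = m + n + p + q + r + d + d' - (M + N)"
  define K where "K = m + q + d"
  define B where "B = n + r + d'"
  define C :: 'f where "C = (- 1) ^ d * (- 1) ^ m * ct d m q * of_nat (R choose p) * (- 1) ^ n * ct d' n r"
  have f: "?f j = (if j \<le> K then of_nat (M choose j) * ((- 1) ^ (K - j) *
      of_nat ((B + K - j) choose (K - j))) else 0) * C \<and> (?f j \<noteq> 0 \<longrightarrow> ?k j = R)" if "j \<le> M" for j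
  proof (cases "j \<le> n + K")
    case j: True
    have k: "?k j = R" using True that j by (simp add: R_def K_def)
    have g: "M + N - j \<le> p + (m + n + q + d - j) + r + d'" using True that j
      unfolding K_def by linarith
    have y: "m + n + q + d - j = n + K - j" "n + m + q + d - j = n + K - j" by (simp_all add: K_def)
    have g2: "j \<le> n + m + q + d" using j by (simp add: K_def)
    have f0: "?f j = of_nat (M choose j) * ((- 1) ^ d * ((- 1) ^ m * ct d m q) *
        (of_nat ((n + K - j) choose n) * ct d' (n + K - j) r * (- 1) ^ (n + K - j)) * of_nat (R choose p))"
      unfolding lam_def if_P[OF g] if_P[OF g2] k unfolding y by (simp add: mult_ac)
    show ?thesis
    proof (cases "j \<le> K")
      case jK: True
      then have s: "n + K - j - n = K - j" "n + K - j + r + d' = B + K - j"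
          "n + K - j = n + (K - j)"
        by (simp_all add: B_def)
      have n: "n \<le> n + K - j" using jK by simp
      have e1: "of_nat ((n + K - j) choose n) * ct d' (n + K - j) r =
          (ct d' n r :: 'f) * of_nat ((B + K - j) choose (K - j))"
        using choose_ct[OF n, of d' r, where 'f='f] unfolding s(1,2) .
      have e2: "((- 1) ^ (n + K - j) :: 'f) = (- 1) ^ n * (- 1) ^ (K - j)"
        by (subst s(3)) (rule power_add)
      have "?f j = of_nat (M choose j) * ((- 1) ^ d * ((- 1) ^ m * ct d m q) *
        (ct d' n r * of_nat ((B + K - j) choose (K - j)) * ((- 1) ^ n * (- 1) ^ (K - j))) * of_nat (R choose p))"
        unfolding f0 e1 e2 ..
      then have "?f j = (if j \<le> K then of_nat (M choose j) * ((- 1) ^ (K - j) *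
          of_nat ((B + K - j) choose (K - j))) else 0) * C"
        unfolding C_def if_P[OF jK] by (simp only: mult_ac)
      with k show ?thesis by blast
    next
      case False
      then have "((n + K - j) choose n) = 0" using j by (simp add: binomial_eq_0)
      with False show ?thesis unfolding f0 by simp
    qed
  next
    case False
    then show ?thesis by (simp add: lam_def K_def)
  qed
  have "(\<Sum>j\<le>M. ra_scale (?f j) (F (?k j))) = (\<Sum>j\<le>M. ra_scale (?f j) (F R))"
    by (rule sum.cong[OF refl]) (use f in fastforce)
  also have "\<dots> = ra_scale (\<Sum>j\<le>M. ?f j) (F R)"
    by (rule ra.scale_sum_left[symmetric])
  also have "(\<Sum>j\<le>M. ?f j) = (of_int (int M - int B - 1) gchoose K) * C"
    unfolding alternating_vandermonde[symmetric] sum_distrib_right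
    by (rule sum.cong[OF refl]) (use f in simp)
  also have "\<dots> = ?c"
  proof (cases "M \<le> m + n + r + d'")
    case M: True
    define s where "s = m + n + r + d' - M"
    have R: "R = p + q + s + d - N" "N \<le> p + q + s + d"
      using M True by (auto simp: R_def s_def)
    have l1: "lam d' m n r M = ((- 1) ^ n * ct d' n r * of_nat (s choose m) :: 'f)"
      unfolding lam_def if_P[OF M] s_def ..
    have l2: "lam d p q s N = ((- 1) ^ q * ct d q s * of_nat (R choose p) :: 'f)"
      unfolding lam_def if_P[OF R(2)] R(1) ..
    \<comment> \<open>The upper argument equals m - s - 1. If it is negative, upper negation
      applies; otherwise it is a natural number below \<open>K\<close> and both sides
      vanish.\<close>
    have "(of_int (int M - int B - 1) gchoose K :: 'f) = (- 1) ^ K * of_nat ((s + q + d) choose K)"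
    proof (cases "m \<le> s")
      case ms: True
      have e: "int M - int B - 1 = - (int (s - m) + 1)"
        using M ms by (auto simp: s_def B_def)
      have h1: "(of_int (int M - int B - 1) :: 'f) = - (of_nat (s - m) + 1)"
        unfolding e by simp
      have h2: "of_nat (s - m) + 1 + of_nat K - 1 = (of_nat (s + q + d) :: 'f)"
        using ms by (simp add: K_def of_nat_diff)
      show ?thesis
        unfolding h1 gbinomial_minus h2 binomial_gbinomial ..
    next
      case False
      have e: "int M - int B - 1 = int (m - s - 1)"
        using M False by (auto simp: s_def B_def)
      have "(of_int (int M - int B - 1) :: 'f) = of_nat (m - s - 1)"
        unfolding e by simp
      moreover have "m - s - 1 < K" "s + q + d < K" using False by (auto simp: K_def)
      ultimately show ?thesis
        by (simp add: binomial_gbinomial[symmetric] binomial_eq_0)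
    qed
    moreover have X: "ct d m q * of_nat ((s + q + d) choose K) = of_nat (s choose m) * (ct d q s :: 'f)"
      using ct_choose[of d q m s, where 'f='f] by (simp add: K_def ct_commute[of d q m] add_ac)
    ultimately have "(of_int (int M - int B - 1) gchoose K) * C =
        (- 1) ^ K * (- 1) ^ d * (- 1) ^ m * (of_nat (s choose m) * ct d q s) * of_nat (R choose p) *
        (- 1) ^ n * ct d' n r"
      unfolding C_def X[symmetric] by (simp only: mult_ac)
    also have "(- 1) ^ K * (- 1) ^ d * (- 1) ^ m = ((- 1) ^ q :: 'f)"
      by (cases "even m"; cases "even d"; cases "even q") (simp_all add: K_def power_add)
    also have "(- 1) ^ q * (of_nat (s choose m) * ct d q s) * of_nat (R choose p) *
        (- 1) ^ n * ct d' n r = ?c"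
      unfolding s_def[symmetric] l1 l2 by (simp only: mult_ac)
    finally show ?thesis .
  next
    case False
    have "(of_int (int M - int B - 1) gchoose K) * (of_nat (R choose p) :: 'f) = 0"
    proof (cases "p \<le> R")
      case p: True
      have e: "int M - int B - 1 = int (M - B - 1)"
        using False by (simp add: B_def)
      have "M - B - 1 < K" using False True p unfolding R_def B_def K_def by linarith
      then show ?thesis unfolding e
        by (simp add: binomial_gbinomial[symmetric] binomial_eq_0)
    qed (simp add: binomial_eq_0)
    then have "(of_int (int M - int B - 1) gchoose K) * C = 0" by (auto simp: C_def)
    then show ?thesis using False by (simp add: lam_def)
  qed
  also have "ra_scale ?c (F R) = ra_scale ?c (F ?i)"
  proof (cases "M \<le> m + n + r + d'")
    case M: True
    then have "?i = R" using True by (simp add: R_def)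
    then show ?thesis by simp
  qed (simp add: lam_def)
  finally show ?thesis by simp
next
  case False
  have c: "?c = 0" using False by (auto simp: lam_def)
  have "?f j = 0" if "j \<le> M" for j
    using False that by (auto simp: lam_def)
  then have "(\<Sum>j\<le>M. ra_scale (?f j) (F (?k j))) = 0"
    by (intro sum.neutral ballI) (simp only: atMost_iff ra.scale_zero_left)
  then show ?thesis unfolding c by (simp only: ra.scale_zero_left)
qed


section \<open>Bilinear products on \<open>ralg\<close>\<close>

type_synonym key = "bit \<times> bit \<times> nat \<times> nat"

definition bilext ::
    "(key \<Rightarrow> key \<Rightarrow> ('f::field_char_0, 'm::finite, 'n::finite) mtx \<Rightarrow> ('f, 'm, 'n) mtx \<Rightarrow> ('f, 'm, 'n) ralg)
      \<Rightarrow> ('f, 'm, 'n) ralg \<Rightarrow> ('f, 'm, 'n) ralg \<Rightarrow> ('f, 'm, 'n) ralg"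
  where "bilext G x y = (\<Sum>\<kappa>\<in>Poly_Mapping.keys x. \<Sum>\<kappa>'\<in>Poly_Mapping.keys y.
    G \<kappa> \<kappa>' (Poly_Mapping.lookup x \<kappa>) (Poly_Mapping.lookup y \<kappa>'))"

locale bilinear_kernel =
  fixes G :: "key \<Rightarrow> key \<Rightarrow> ('f::field_char_0, 'm::finite, 'n::finite) mtx
    \<Rightarrow> ('f, 'm, 'n) mtx \<Rightarrow> ('f, 'm, 'n) ralg"
  assumes kernel_add_left: "G \<kappa> \<kappa>' (u + u') v = G \<kappa> \<kappa>' u v + G \<kappa> \<kappa>' u' v"
    and kernel_add_right: "G \<kappa> \<kappa>' u (v + v') = G \<kappa> \<kappa>' u v + G \<kappa> \<kappa>' u v'"
    and kernel_scale_left: "G \<kappa> \<kappa>' (mtx_scale c u) v = ra_scale c (G \<kappa> \<kappa>' u v)"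
    and kernel_scale_right: "G \<kappa> \<kappa>' u (mtx_scale c v) = ra_scale c (G \<kappa> \<kappa>' u v)"
begin

lemma kernel_zero_left [simp]: "G \<kappa> \<kappa>' 0 v = 0"
  using kernel_add_left[of \<kappa> \<kappa>' 0 0 v] by simp

lemma kernel_zero_right [simp]: "G \<kappa> \<kappa>' u 0 = 0"
  using kernel_add_right[of \<kappa> \<kappa>' u 0 0] by simp

text \<open>Additivity cannot be read off the sum over the supports, since the support of
  \<open>x + x'\<close> may shrink. A common finite index set removes this dependence.\<close>

lemma bilext_superset:
  assumes "finite A" "Poly_Mapping.keys x \<subseteq> A" "finite B" "Poly_Mapping.keys y \<subseteq> B"
  shows "bilext G x y = (\<Sum>\<kappa>\<in>A. \<Sum>\<kappa>'\<in>B. G \<kappa> \<kappa>' (Poly_Mapping.lookup x \<kappa>) (Poly_Mapping.lookup y \<kappa>'))"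
proof -
  have "bilext G x y = (\<Sum>\<kappa>\<in>Poly_Mapping.keys x. \<Sum>\<kappa>'\<in>B.
      G \<kappa> \<kappa>' (Poly_Mapping.lookup x \<kappa>) (Poly_Mapping.lookup y \<kappa>'))"
    unfolding bilext_def using assms
    by (intro sum.cong refl sum.mono_neutral_left) (auto simp: in_keys_iff)
  also have "\<dots> = (\<Sum>\<kappa>\<in>A. \<Sum>\<kappa>'\<in>B. G \<kappa> \<kappa>' (Poly_Mapping.lookup x \<kappa>) (Poly_Mapping.lookup y \<kappa>'))"
    using assms by (intro sum.mono_neutral_left) (auto simp: in_keys_iff)
  finally show ?thesis .
qed

lemma bilext_add_left: "bilext G (x + x') y = bilext G x y + bilext G x' y"
proof -
  let ?A = "Poly_Mapping.keys x \<union> Poly_Mapping.keys x'"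
  have "Poly_Mapping.keys (x + x') \<subseteq> ?A" by (rule Poly_Mapping.keys_add)
  then show ?thesis
    by (simp add: bilext_superset[where A = ?A and B = "Poly_Mapping.keys y"]
        lookup_add kernel_add_left sum.distrib)
qed

lemma bilext_add_right: "bilext G x (y + y') = bilext G x y + bilext G x y'"
proof -
  let ?B = "Poly_Mapping.keys y \<union> Poly_Mapping.keys y'"
  have "Poly_Mapping.keys (y + y') \<subseteq> ?B" by (rule Poly_Mapping.keys_add)
  then show ?thesis
    by (simp add: bilext_superset[where A = "Poly_Mapping.keys x" and B = ?B]
        lookup_add kernel_add_right sum.distrib)
qed

lemma keys_ra_scale_subset: "Poly_Mapping.keys (ra_scale c x) \<subseteq> Poly_Mapping.keys x"
  by (auto simp: in_keys_iff lookup_ra_scale mtx_scale_def vec_eq_iff)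

lemma bilext_scale_left: "bilext G (ra_scale c x) y = ra_scale c (bilext G x y)"
  by (simp add: bilext_superset[where A = "Poly_Mapping.keys x" and B = "Poly_Mapping.keys y"]
      keys_ra_scale_subset lookup_ra_scale kernel_scale_left ra.scale_sum_right)

lemma bilext_scale_right: "bilext G x (ra_scale c y) = ra_scale c (bilext G x y)"
  by (simp add: bilext_superset[where A = "Poly_Mapping.keys x" and B = "Poly_Mapping.keys y"]
      keys_ra_scale_subset lookup_ra_scale kernel_scale_right ra.scale_sum_right)

lemma bilext_zero [simp]: "bilext G 0 y = 0" "bilext G x 0 = 0"
  by (simp_all add: bilext_def)

lemma bilext_minus: "bilext G (- x) y = - bilext G x y" "bilext G x (- y) = - bilext G x y"
  using bilext_add_left[of x "- x" y] bilext_add_right[of x y "- y"] by (simp_all add: eq_neg_iff_add_eq_0 add.commute)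

lemma bilext_diff:
  "bilext G (x - x') y = bilext G x y - bilext G x' y"
  "bilext G x (y - y') = bilext G x y - bilext G x y'"
  using bilext_add_left[of x "- x'" y] bilext_add_right[of x y "- y'"] by (simp_all add: bilext_minus)

lemma bilext_sum_left: "bilext G (\<Sum>i\<in>A. f i) y = (\<Sum>i\<in>A. bilext G (f i) y)"
  by (induction A rule: infinite_finite_induct) (simp_all add: bilext_add_left)

lemma bilext_sum_right: "bilext G x (\<Sum>i\<in>A. f i) = (\<Sum>i\<in>A. bilext G x (f i))"
  by (induction A rule: infinite_finite_induct) (simp_all add: bilext_add_right)

lemma bilext_elt: "bilext G (elt u i1 i2 m1 m2) (elt v j1 j2 n1 n2) = G (i1, i2, m1, m2) (j1, j2, n1, n2) u v"
  by (simp add: bilext_superset[where A = "{(i1, i2, m1, m2)}" and B = "{(j1, j2, n1, n2)}"] elt_def)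

lemmas bilext_linear = bilext_add_left bilext_add_right bilext_scale_left bilext_scale_right
  bilext_minus bilext_diff bilext_sum_left bilext_sum_right

end

lemma mtx_add_mult: "(u + u') ** v = u ** v + u' ** (v :: ('f::field_char_0, 'm::finite, 'n::finite) mtx)"
  by (simp add: vec_eq_iff matrix_matrix_mult_def sum.distrib algebra_simps)

lemma mtx_scale_mult:
  fixes u v :: "('f::field_char_0, 'm::finite, 'n::finite) mtx"
  shows "mtx_scale c u ** v = mtx_scale c (u ** v)" "u ** mtx_scale c v = mtx_scale c (u ** v)"
  by (simp_all add: vec_eq_iff matrix_matrix_mult_def mtx_scale_def sum_distrib_left mult_ac)

lemma elt_add: "elt (u + v) i j m n = elt u i j m n + elt v i j m n"
  by (simp add: elt_def single_add)

lemma elt_scale: "elt (mtx_scale c u) i j m n = ra_scale c (elt u i j m n)"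
  by (rule poly_mapping_eqI) (auto simp: elt_def lookup_ra_scale lookup_single when_def mtx_scale_def vec_eq_iff)

lemma elt_zero [simp]: "elt 0 i j m n = 0"
  by (simp add: elt_def)

lemma mtx_unit_mult:
  "mtx_unit a b ** mtx_unit c d =
    (if b = c then mtx_unit a d else 0 :: ('f::field_char_0, 'm::finite, 'n::finite) mtx)"
  by (auto simp: vec_eq_iff matrix_matrix_mult_def mtx_unit_def if_distrib[of "\<lambda>x. x * _"]
      if_distrib[of "\<lambda>x. _ * x"] sum.delta cong: if_cong intro!: sum.neutral)

definition mu_kernel :: "nat \<Rightarrow> key \<Rightarrow> key \<Rightarrow> ('f::field_char_0, 'm::finite, 'n::finite) mtx
    \<Rightarrow> ('f, 'm, 'n) mtx \<Rightarrow> ('f, 'm, 'n) ralg"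
  where "mu_kernel l = (\<lambda>(i1, i2, m1, m2) (j1, j2, n1, n2) u v.
    let d = of_bool (i2 = 0) in
      if i2 = j1 then ra_scale (lam d m1 m2 n1 l) (elt (u ** v) i1 j2 (m1 + m2 + n1 + d - l) n2) else 0)"

text \<open>The sign of the two parities is left out, so the composition rules hold without signs
  from parities. The power \<open>(- 1) ^ d\<close> is the sign of the factor \<delta>(i1,1) -
  (n2+1) \<delta>(i1,0) of the defining formula.\<close>

definition nu_kernel :: "nat \<Rightarrow> key \<Rightarrow> key \<Rightarrow> ('f::field_char_0, 'm::finite, 'n::finite) mtx
    \<Rightarrow> ('f, 'm, 'n) mtx \<Rightarrow> ('f, 'm, 'n) ralg"
  where "nu_kernel l = (\<lambda>(i1, i2, m1, m2) (j1, j2, n1, n2) u v.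
    let d = of_bool (i1 = 0) in
      if i1 = j2 then ra_scale ((- 1) ^ d * lam d m2 m1 n2 l)
        (elt (v ** u) j1 i2 n1 (m2 + m1 + n2 + d - l)) else 0)"

interpretation mu: bilinear_kernel "mu_kernel l"
  by unfold_locales (auto simp: mu_kernel_def Let_def mtx_add_mult matrix_add_ldistrib mtx_scale_mult
      elt_add elt_scale ra.scale_right_distrib mult.commute split: prod.splits)

interpretation nu: bilinear_kernel "nu_kernel l"
  by unfold_locales (auto simp: nu_kernel_def Let_def mtx_add_mult matrix_add_ldistrib mtx_scale_mult
      elt_add elt_scale ra.scale_right_distrib mult.commute split: prod.splits)

text \<open>Upper negation produces (r+d+n)! / (n! (r+d)!), and for \<open>d \<le> 1\<close> the
  prefactor \<open>r * d + 1\<close> is (r+d)! / r!.\<close>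

lemma ct_gbinomial:
  assumes "d \<le> 1"
  shows "(of_nat (r * d + 1) * ((- of_nat r - 1 - of_nat d) gchoose n) :: 'f::field_char_0) =
    (- 1) ^ n * ct d n r"
proof -
  have "(- of_nat r - 1 - of_nat d :: 'f) = - (of_nat (r + 1 + d))" by simp
  moreover have "(of_nat (r + 1 + d) + of_nat n - 1 :: 'f) = of_nat (r + d + n)" by simp
  ultimately have "((- of_nat r - 1 - of_nat d :: 'f) gchoose n) = (- 1) ^ n * of_nat ((r + d + n) choose n)"
    unfolding binomial_gbinomial by (simp only: gbinomial_minus)
  moreover have "(of_nat ((r + d + n) choose n) :: 'f) = fact (r + d + n) / (fact n * fact (r + d))"
    by (subst binomial_fact) simp_all
  moreover have "(fact (r + d) :: 'f) = of_nat (r * d + 1) * fact r"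
    using assms by (cases "d = 0") (auto simp: le_Suc_eq)
  moreover have "(of_nat (r * d + 1) :: 'f) \<noteq> 0"
    by (metis Suc_eq_plus1 of_nat_neq_0)
  ultimately show ?thesis
    by (simp add: ct_def add_ac)
qed

lemma sum_zmon:
  "(\<Sum>p = 0..N. zmon (X p) (int p - int N - 1) (- int l - 1)) = (if l \<le> N then X (N - l) else 0)"
proof (cases "l \<le> N")
  case True
  have "(\<Sum>p = 0..N. zmon (X p) (int p - int N - 1) (- int l - 1)) =
      (\<Sum>p = 0..N. if p = N - l then X p else 0)"
    by (rule sum.cong) (use True in \<open>auto simp: zmon_def\<close>)
  then show ?thesis using True by simp
next
  case False
  then show ?thesis by (auto simp: zmon_def intro!: sum.neutral)
qed

lemma ra_Y_elt_eq:
  "ra_Y_elt u i1 i2 m1 m2 v j1 j2 n1 n2 (- int l - 1) =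
    mu_kernel l (i1, i2, m1, m2) (j1, j2, n1, n2) u v -
    ra_scale (sign2 ((i1 + i2) * (j1 + j2))) (nu_kernel l (i1, i2, m1, m2) (j1, j2, n1, n2) u v)"
proof -
  define d1 d2 where "d1 = (of_bool (i1 = 0) :: nat)" and "d2 = (of_bool (i2 = 0) :: nat)"
  have c1: "(of_nat (n1 * d2 + 1) * ((- of_nat n1 - 1 - of_nat d2) gchoose m2) :: 'a) = (- 1) ^ m2 * ct d2 m2 n1"
    by (rule ct_gbinomial) (simp add: d2_def)
  have s: "(of_bool (i1 = 1) - of_nat (n2 + 1) * of_nat d1 :: 'a) = (- 1) ^ d1 * of_nat (n2 * d1 + 1)"
    by (cases i1) (simp_all add: d1_def)
  have c2: "(of_nat (n2 * d1 + 1) * ((- of_nat n2 - 1 - of_nat d1) gchoose m1) :: 'a) = (- 1) ^ m1 * ct d1 m1 n2"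
    by (rule ct_gbinomial) (simp add: d1_def)
  have i1: "int p - int m1 - int m2 - int n1 - 1 - int d2 = int p - int (m1 + m2 + n1 + d2) - 1" for p by simp
  have i2: "int p - int m1 - int m2 - int n2 - 1 - int d1 = int p - int (m2 + m1 + n2 + d1) - 1" for p by simp
  have r: "m1 + m2 + n2 + d1 = m2 + m1 + n2 + d1" by simp
  have 1: "of_bool (i2 = j1) * of_nat (n1 * d2 + 1) * ((- of_nat n1 - 1 - of_nat d2) gchoose m2) =
      (of_bool (i2 = j1) * ((- 1) ^ m2 * ct d2 m2 n1) :: 'a)"
    unfolding c1[symmetric] by (simp only: mult.assoc)
  have 2: "sign2 ((i1 + i2) * (j1 + j2)) * of_bool (i1 = j2) *
      (of_bool (i1 = 1) - of_nat (n2 + 1) * of_nat d1) * ((- of_nat n2 - 1 - of_nat d1) gchoose m1) =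
      (sign2 ((i1 + i2) * (j1 + j2)) * of_bool (i1 = j2) * (- 1) ^ d1 * ((- 1) ^ m1 * ct d1 m1 n2) :: 'a)"
    unfolding s c2[symmetric] by (simp only: mult.assoc)
  show ?thesis
    unfolding ra_Y_elt_def Let_def d1_def[symmetric] d2_def[symmetric] i1 i2 r sum_zmon
      mu_kernel_def nu_kernel_def split 1 2
    by (simp add: lam_def mult_ac of_bool_def)
qed

lemma ra_Y_elt_eq_0:
  assumes "0 \<le> e"
  shows "ra_Y_elt u i1 i2 m1 m2 v j1 j2 n1 n2 e = 0"
  using assms by (auto simp: ra_Y_elt_def Let_def zmon_def intro!: sum.neutral)

definition Y_kernel :: "int \<Rightarrow> key \<Rightarrow> key \<Rightarrow> ('f::field_char_0, 'm::finite, 'n::finite) mtx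
    \<Rightarrow> ('f, 'm, 'n) mtx \<Rightarrow> ('f, 'm, 'n) ralg"
  where "Y_kernel e = (\<lambda>(i1, i2, m1, m2) (j1, j2, n1, n2) u v. ra_Y_elt u i1 i2 m1 m2 v j1 j2 n1 n2 e)"

lemma Y_kernel_eq_0: "0 \<le> e \<Longrightarrow> Y_kernel e \<kappa> \<kappa>' u v = 0"
  by (auto simp: Y_kernel_def ra_Y_elt_eq_0 split: prod.splits)

text \<open>Since \<open>c\<close> depends only on the two keys, bilinearity passes from the kernels
  of \<open>mu\<close> and \<open>nu\<close> to that of \<open>Y\<close>.\<close>

lemma Y_kernel_eq:
  "\<exists>c. \<forall>u v. Y_kernel (- int l - 1) \<kappa> \<kappa>' u v = mu_kernel l \<kappa> \<kappa>' u v - ra_scale c (nu_kernel l \<kappa> \<kappa>' u v)"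
  by (cases \<kappa>, cases \<kappa>') (auto simp: Y_kernel_def ra_Y_elt_eq)

lemma int_cases_pole: obtains "0 \<le> e" | l where "e = - int l - 1"
  by (cases e) (force+)

interpretation Y: bilinear_kernel "Y_kernel e"
proof (unfold_locales; cases e rule: int_cases_pole)
  fix \<kappa> \<kappa>' :: key and u u' v v' :: "('f::field_char_0, 'm::finite, 'n::finite) mtx" and c :: 'f and l
  assume e: "e = - int l - 1"
  obtain b :: 'f where b: "\<And>u v :: ('f, 'm, 'n) mtx. Y_kernel e \<kappa> \<kappa>' u v = mu_kernel l \<kappa> \<kappa>' u v - ra_scale b (nu_kernel l \<kappa> \<kappa>' u v)"
    using Y_kernel_eq unfolding e by blast
  show "Y_kernel e \<kappa> \<kappa>' (u + u') v = Y_kernel e \<kappa> \<kappa>' u v + Y_kernel e \<kappa> \<kappa>' u' v"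
    by (simp add: b mu.kernel_add_left nu.kernel_add_left ra.scale_right_distrib)
  show "Y_kernel e \<kappa> \<kappa>' u (v + v') = Y_kernel e \<kappa> \<kappa>' u v + Y_kernel e \<kappa> \<kappa>' u v'"
    by (simp add: b mu.kernel_add_right nu.kernel_add_right ra.scale_right_distrib)
  show "Y_kernel e \<kappa> \<kappa>' (mtx_scale c u) v = ra_scale c (Y_kernel e \<kappa> \<kappa>' u v)"
    by (simp add: b mu.kernel_scale_left nu.kernel_scale_left ra.scale_right_diff_distrib mult.commute)
  show "Y_kernel e \<kappa> \<kappa>' u (mtx_scale c v) = ra_scale c (Y_kernel e \<kappa> \<kappa>' u v)"
    by (simp add: b mu.kernel_scale_right nu.kernel_scale_right ra.scale_right_diff_distrib mult.commute)
qed (simp_all add: Y_kernel_eq_0)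

lemma ra_Y_bilext: "ra_Y x y e = bilext (Y_kernel e) x y"
  unfolding ra_Y_def bilext_def Y_kernel_def by (simp add: case_prod_unfold)

lemmas ra_Y_linear = Y.bilext_linear[folded ra_Y_bilext]

lemma ra_Y_nonneg: "0 \<le> e \<Longrightarrow> ra_Y x y e = 0"
  by (simp add: ra_Y_bilext bilext_def Y_kernel_eq_0)

lemma ra_D_superset:
  assumes "finite A" "Poly_Mapping.keys x \<subseteq> A"
  shows "ra_D x = (\<Sum>(i, j, m, n)\<in>A.
    ra_scale (of_nat (m + 1)) (elt (Poly_Mapping.lookup x (i, j, m, n)) i j (m + 1) n) +
    ra_scale (of_nat (n + 1)) (elt (Poly_Mapping.lookup x (i, j, m, n)) i j m (n + 1)))"
  unfolding ra_D_def Let_def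
  by (rule sum.mono_neutral_left) (use assms in \<open>auto simp: in_keys_iff split: prod.splits\<close>)

lemma ra_D_add: "ra_D (x + y) = ra_D x + ra_D y"
proof -
  let ?A = "Poly_Mapping.keys x \<union> Poly_Mapping.keys y"
  have "Poly_Mapping.keys (x + y) \<subseteq> ?A" by (rule Poly_Mapping.keys_add)
  then show ?thesis
    by (simp add: ra_D_superset[where A = ?A] lookup_add elt_add ra.scale_right_distrib
        sum.distrib[symmetric] case_prod_unfold algebra_simps)
qed

lemma ra_D_scale: "ra_D (ra_scale c x) = ra_scale c (ra_D x)"
  by (simp add: ra_D_superset[where A = "Poly_Mapping.keys x"] mu.keys_ra_scale_subset lookup_ra_scale
      elt_scale ra.scale_sum_right ra.scale_right_distrib case_prod_unfold mult.commute)

lemma ra_D_elt: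
  "ra_D (elt u i j m n) =
    ra_scale (of_nat (m + 1)) (elt u i j (m + 1) n) + ra_scale (of_nat (n + 1)) (elt u i j m (n + 1))"
  by (simp add: ra_D_superset[where A = "{(i, j, m, n)}"] elt_def)


section \<open>The algebra of block-compatible elements\<close>

text \<open>The index \<open>r\<close> contributes the weight \<open>(1 + dl r) / 2\<close>, and
  \<open>1 + dl r\<close> is the order of the pole in the contraction of its field with
  itself.\<close>

definition dl :: "'m + 'n \<Rightarrow> nat"
  where "dl r = of_bool (block r = 0)"

text \<open>The blocks of the two indices dictate the summand. Contracted indices that agree then
  lie in the same block, so the matrix product already enforces the Kronecker delta on
  summands.\<close>

definition E :: "'m + 'n \<Rightarrow> nat \<Rightarrow> 'm + 'n \<Rightarrow> nat \<Rightarrow> ('f::field_char_0, 'm::finite, 'n::finite) ralg"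
  where "E a m b n = elt (mtx_unit a b) (block a) (block b) m n"

abbreviation mu :: "nat \<Rightarrow> ('f::field_char_0, 'm::finite, 'n::finite) ralg \<Rightarrow> ('f, 'm, 'n) ralg \<Rightarrow> ('f, 'm, 'n) ralg"
  where "mu l \<equiv> bilext (mu_kernel l)"

abbreviation nu :: "nat \<Rightarrow> ('f::field_char_0, 'm::finite, 'n::finite) ralg \<Rightarrow> ('f, 'm, 'n) ralg \<Rightarrow> ('f, 'm, 'n) ralg"
  where "nu l \<equiv> bilext (nu_kernel l)"

lemma mu_E:
  "mu l (E a m b n) (E c p d q) =
    (if b = c then ra_scale (lam (dl b) m n p l) (E a (m + n + p + dl b - l) d q) else 0)"
  unfolding E_def mu.bilext_elt by (auto simp: mu_kernel_def Let_def dl_def mtx_unit_mult)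

lemma nu_E:
  "nu l (E a m b n) (E c p d q) =
    (if a = d then ra_scale ((- 1) ^ dl a * lam (dl a) n m q l) (E c p b (n + m + q + dl a - l)) else 0)"
  unfolding E_def nu.bilext_elt by (auto simp: nu_kernel_def Let_def dl_def mtx_unit_mult)

lemma ra_Y_E:
  "ra_Y (E a m b n) (E c p d q) (- int l - 1) =
    mu l (E a m b n) (E c p d q) -
    ra_scale (sign2 ((block a + block b) * (block c + block d))) (nu l (E a m b n) (E c p d q))"
  unfolding ra_Y_bilext E_def Y.bilext_elt mu.bilext_elt nu.bilext_elt
  by (simp only: Y_kernel_def split ra_Y_elt_eq)

lemma ra_D_E:
  "ra_D (E a m b n) = ra_scale (of_nat (m + 1)) (E a (m + 1) b n) + ra_scale (of_nat (n + 1)) (E a m b (n + 1))"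
  by (simp add: E_def ra_D_elt)

definition basisE :: "bit \<Rightarrow> ('f::field_char_0, 'm::finite, 'n::finite) ralg set"
  where "basisE i = {E a m b n | a m b n. block a + block b = i}"

definition Rplus :: "bit \<Rightarrow> ('f::field_char_0, 'm::finite, 'n::finite) ralg set"
  where "Rplus i = ra.span (basisE i)"

section \<open>Linear extension from basis elements\<close>

definition Eall :: "('f::field_char_0, 'm::finite, 'n::finite) ralg set"
  where "Eall = {E a m b n | a m b n. True}"

definition lin :: "(('f::field_char_0, 'm::finite, 'n::finite) ralg \<Rightarrow> ('f, 'm, 'n) ralg) \<Rightarrow> bool"
  where "lin f \<longleftrightarrow> (\<forall>x y. f (x + y) = f x + f y) \<and> (\<forall>c x. f (ra_scale c x) = ra_scale c (f x))"

lemma lin_zero: "lin f \<Longrightarrow> f 0 = 0"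
  using ra.scale_zero_left unfolding lin_def by metis

text \<open>The point from which a truncated sum is correct depends on the element, so equality
  holds only eventually in \<open>K\<close>; this property survives linear combinations.\<close>

lemma eventually_eq_on_span:
  assumes "lin f" "\<And>K. lin (g K)" "\<And>x. x \<in> B \<Longrightarrow> \<forall>\<^sub>F K in F. f x = g K x" "x \<in> ra.span B"
  shows "\<forall>\<^sub>F K in F. f x = g K x"
  using assms(4)
proof (induction rule: ra.span_induct_alt)
  case base
  show ?case using lin_zero[OF assms(1)] lin_zero[OF assms(2)] by simp
next
  case (step c x y)
  show ?case using assms(3)[OF step(1)] step(2)
  proof eventually_elim
    case (elim K)
    then show ?case using assms(1) assms(2)[of K] by (simp add: lin_def)
  qed
qed

lemma eq_on_span:
  assumes "lin f" "lin g" "\<And>x. x \<in> B \<Longrightarrow> f x = g x" "x \<in> ra.span B"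
  shows "f x = g x"
  using assms(4)
proof (induction rule: ra.span_induct_alt)
  case base
  show ?case using lin_zero[OF assms(1)] lin_zero[OF assms(2)] by simp
next
  case (step c x y)
  then show ?case using assms(1-3) by (simp add: lin_def)
qed

lemma trilinear_eq_on_span:
  assumes "\<And>v w. lin (\<lambda>u. f u v w)" "\<And>u w. lin (\<lambda>v. f u v w)" "\<And>u v. lin (f u v)"
    and "\<And>v w. lin (\<lambda>u. g u v w)" "\<And>u w. lin (\<lambda>v. g u v w)" "\<And>u v. lin (g u v)"
    and "\<And>u v w. u \<in> B \<Longrightarrow> v \<in> B \<Longrightarrow> w \<in> B \<Longrightarrow> f u v w = g u v w"
    and "u \<in> ra.span B" "v \<in> ra.span B" "w \<in> ra.span B"
  shows "f u v w = g u v w"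
proof -
  have 1: "f u v w = g u v w" if "u \<in> B" "v \<in> B" for u v
    by (rule eq_on_span[OF assms(3) assms(6) _ assms(10)]) (use that assms(7) in auto)
  have 2: "f u v w = g u v w" if "u \<in> B" for u
    by (rule eq_on_span[OF assms(2) assms(5) _ assms(9)]) (use that 1 in auto)
  show ?thesis
    by (rule eq_on_span[OF assms(1) assms(4) _ assms(8)]) (use 2 in auto)
qed

section \<open>Composition rules for \<open>mu\<close> and \<open>nu\<close>, and the Jacobi
  identity\<close>

lemmas lin_simps = lin_def mu.bilext_linear nu.bilext_linear ra_Y_linear ra_D_add ra_D_scale
  ra.scale_right_distrib sum.distrib ra.scale_sum_right mult_ac

lemma ra_scale_if: "ra_scale c (if P then x else y) = (if P then ra_scale c x else ra_scale c y)"
  by simp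

text \<open>This is the associativity law of an associative conformal algebra, written in
  coefficients.\<close>

lemma mu_mu:
  assumes "u \<in> ra.span Eall" "v \<in> ra.span Eall" "w \<in> ra.span Eall"
  shows "mu M u (mu N v w) = (\<Sum>j\<le>M. ra_scale (of_nat (M choose j)) (mu (M + N - j) (mu j u v) w))"
proof (rule trilinear_eq_on_span[OF _ _ _ _ _ _ _ assms])
  fix u v w :: "('a, 'b, 'c) ralg" assume "u \<in> Eall" "v \<in> Eall" "w \<in> Eall"
  then obtain a m b n c p d q g r h s where
    u: "u = E a m b n" and v: "v = E c p d q" and w: "w = E g r h s"
    unfolding Eall_def by blast
  show "mu M u (mu N v w) = (\<Sum>j\<le>M. ra_scale (of_nat (M choose j)) (mu (M + N - j) (mu j u v) w))"
  proof (cases "b = c \<and> d = g")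
    case True
    then show ?thesis
      using lam_comp[of "dl d" p q r N "dl b" m n M "\<lambda>k. E a k h s"]
      unfolding u v w by (simp add: mu_E mu.bilext_linear mult_ac)
  next
    case False
    then show ?thesis unfolding u v w by (auto simp: mu_E mu.bilext_linear)
  qed
qed (simp_all add: lin_simps)

text \<open>\<open>nu j u v\<close> multiplies the matrices in the order v u, so acting with it by
  \<open>mu\<close> amounts to acting by u and then by v.\<close>

lemma mu_mu_swap:
  assumes "u \<in> ra.span Eall" "v \<in> ra.span Eall" "w \<in> ra.span Eall"
  shows "mu N v (mu M u w) = (\<Sum>j\<le>M. ra_scale (of_nat (M choose j)) (mu (M + N - j) (nu j u v) w))"
proof (rule trilinear_eq_on_span[OF _ _ _ _ _ _ _ assms])
  fix u v w :: "('a, 'b, 'c) ralg" assume "u \<in> Eall" "v \<in> Eall" "w \<in> Eall"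
  then obtain a m b n c p d q g r h s where
    u: "u = E a m b n" and v: "v = E c p d q" and w: "w = E g r h s"
    unfolding Eall_def by blast
  show "mu N v (mu M u w) = (\<Sum>j\<le>M. ra_scale (of_nat (M choose j)) (mu (M + N - j) (nu j u v) w))"
  proof (cases "b = g \<and> a = d")
    case True
    then show ?thesis
      using lam_comp_transposed[of "dl b" m n r M "dl a" p q N "\<lambda>k. E c k h s"]
      unfolding u v w by (simp add: mu_E nu_E mu.bilext_linear nu.bilext_linear mult_ac add_ac)
  next
    case False
    then show ?thesis unfolding u v w by (auto simp: mu_E nu_E mu.bilext_linear nu.bilext_linear)
  qed
qed (simp_all add: lin_simps)

lemma nu_nu:
  assumes "u \<in> ra.span Eall" "v \<in> ra.span Eall" "w \<in> ra.span Eall"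
  shows "nu M u (nu N v w) = (\<Sum>j\<le>M. ra_scale (of_nat (M choose j)) (nu (M + N - j) (nu j u v) w))"
proof (rule trilinear_eq_on_span[OF _ _ _ _ _ _ _ assms])
  fix u v w :: "('a, 'b, 'c) ralg" assume "u \<in> Eall" "v \<in> Eall" "w \<in> Eall"
  then obtain a m b n c p d q g r h s where
    u: "u = E a m b n" and v: "v = E c p d q" and w: "w = E g r h s"
    unfolding Eall_def by blast
  show "nu M u (nu N v w) = (\<Sum>j\<le>M. ra_scale (of_nat (M choose j)) (nu (M + N - j) (nu j u v) w))"
  proof (cases "a = d \<and> c = h")
    case True
    then show ?thesis
      using lam_comp[of "dl c" q p s N "dl a" n m M "\<lambda>k. ra_scale ((- 1) ^ dl a * (- 1) ^ dl c) (E g r b k)"]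
      unfolding u v w by (simp add: nu_E nu.bilext_linear mult_ac)
  next
    case False
    then show ?thesis unfolding u v w by (auto simp: nu_E nu.bilext_linear)
  qed
qed (simp_all add: lin_simps)

lemma nu_nu_swap:
  assumes "u \<in> ra.span Eall" "v \<in> ra.span Eall" "w \<in> ra.span Eall"
  shows "nu N v (nu M u w) = (\<Sum>j\<le>M. ra_scale (of_nat (M choose j)) (nu (M + N - j) (mu j u v) w))"
proof (rule trilinear_eq_on_span[OF _ _ _ _ _ _ _ assms])
  fix u v w :: "('a, 'b, 'c) ralg" assume "u \<in> Eall" "v \<in> Eall" "w \<in> Eall"
  then obtain a m b n c p d q g r h s where
    u: "u = E a m b n" and v: "v = E c p d q" and w: "w = E g r h s"
    unfolding Eall_def by blast
  show "nu N v (nu M u w) = (\<Sum>j\<le>M. ra_scale (of_nat (M choose j)) (nu (M + N - j) (mu j u v) w))"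
  proof (cases "a = h \<and> b = c")
    case True
    \<comment> \<open>The sign \<open>(- 1) ^ dl b\<close> in \<open>lam_comp_transposed\<close>
      meets the one placed into \<open>F\<close> below, and only the sign of the outer
      \<open>nu\<close> remains.\<close>
    have sq: "((- 1) ^ dl b * ((- 1) ^ dl b * x) :: 'a) = x" for x
      by (simp flip: mult.assoc power_mult_distrib)
    show ?thesis
      using lam_comp_transposed[of "dl a" n m s M "dl b" q p N "\<lambda>k. ra_scale ((- 1) ^ dl a * (- 1) ^ dl b) (E g r d k)"]
        True unfolding u v w by (simp add: mu_E nu_E mu.bilext_linear nu.bilext_linear mult_ac add_ac sq)
  next
    case False
    then show ?thesis unfolding u v w by (auto simp: mu_E nu_E mu.bilext_linear nu.bilext_linear)
  qed
qed (simp_all add: lin_simps)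

lemma mu_nu_commute:
  assumes "u \<in> ra.span Eall" "v \<in> ra.span Eall" "w \<in> ra.span Eall"
  shows "mu M u (nu N v w) = nu N v (mu M u w)"
proof (rule trilinear_eq_on_span[OF _ _ _ _ _ _ _ assms])
  fix u v w :: "('a, 'b, 'c) ralg" assume "u \<in> Eall" "v \<in> Eall" "w \<in> Eall"
  then show "mu M u (nu N v w) = nu N v (mu M u w)"
    unfolding Eall_def by (auto simp: mu_E nu_E mu.bilext_linear nu.bilext_linear mult_ac)
qed (simp_all add: lin_simps)

lemma Rplus_subset: "Rplus i \<subseteq> ra.span Eall"
  unfolding Rplus_def by (rule ra.span_mono) (auto simp: basisE_def Eall_def)

lemma bilinear_eq_on_span:
  assumes "\<And>v. lin (\<lambda>u. f u v)" "\<And>u. lin (f u)" "\<And>v. lin (\<lambda>u. g u v)" "\<And>u. lin (g u)"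
    and "\<And>u v. u \<in> B \<Longrightarrow> v \<in> C \<Longrightarrow> f u v = g u v" "u \<in> ra.span B" "v \<in> ra.span C"
  shows "f u v = g u v"
proof -
  have 1: "f u v = g u v" if "u \<in> B" for u
    by (rule eq_on_span[OF assms(2) assms(4) _ assms(7)]) (use that assms(5) in auto)
  show ?thesis
    by (rule eq_on_span[OF assms(1) assms(3) _ assms(6)]) (use 1 in auto)
qed

lemma ra_Y_mu_nu:
  assumes "u \<in> Rplus i" "v \<in> Rplus j"
  shows "ra_Y u v (- int l - 1) = mu l u v - ra_scale (sign2 (i * j)) (nu l u v)"
proof (rule bilinear_eq_on_span[OF _ _ _ _ _ assms[unfolded Rplus_def]])
  fix u v :: "('a, 'b, 'c) ralg" assume "u \<in> basisE i" "v \<in> basisE j"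
  then show "ra_Y u v (- int l - 1) = mu l u v - ra_scale (sign2 (i * j)) (nu l u v)"
    unfolding basisE_def using ra_Y_E by blast
qed (simp_all add: lin_simps ra.scale_right_diff_distrib)

lemma bilinear_in_span:
  assumes "\<And>v. lin (\<lambda>u. f u v)" "\<And>u. lin (f u)"
    and "\<And>u v. u \<in> B \<Longrightarrow> v \<in> C \<Longrightarrow> f u v \<in> ra.span A" "u \<in> ra.span B" "v \<in> ra.span C"
  shows "f u v \<in> ra.span A"
proof -
  have *: "f x \<in> ra.span A" if "lin f" "\<And>x. x \<in> B \<Longrightarrow> f x \<in> ra.span A" "x \<in> ra.span B" for f B x
    using that(3)
  proof (induction rule: ra.span_induct_alt)
    case base
    show ?case by (simp add: lin_zero[OF that(1)] ra.span_zero)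
  next
    case (step c x y)
    then show ?case using that(1,2) by (simp add: lin_def ra.span_add ra.span_scale)
  qed
  have 1: "f u v \<in> ra.span A" if "u \<in> B" for u
    by (rule *[of "f u" C]) (use assms that in auto)
  show ?thesis by (rule *[of "\<lambda>u. f u v" B]) (use assms 1 in auto)
qed

lemma bit_add_self: "x + (x + y) = y" for x y :: bit
  by (cases x; cases y) simp_all

lemma E_in_Rplus: "block a + block b = i \<Longrightarrow> E a m b n \<in> Rplus i"
  unfolding Rplus_def basisE_def by (rule ra.span_base) blast

lemma mu_Rplus:
  assumes "u \<in> Rplus i" "v \<in> Rplus j"
  shows "mu l u v \<in> Rplus (i + j)"
  unfolding Rplus_def
proof (rule bilinear_in_span[OF _ _ _ assms[unfolded Rplus_def]])
  fix u v :: "('a, 'b, 'c) ralg" assume "u \<in> basisE i" "v \<in> basisE j"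
  then show "mu l u v \<in> ra.span (basisE (i + j))"
    unfolding basisE_def[of i] basisE_def[of j] Rplus_def[symmetric]
    by (auto simp: mu_E Rplus_def ra.span_zero bit_add_self add_ac
        intro!: ra.span_scale E_in_Rplus[unfolded Rplus_def])
qed (simp_all add: lin_simps)

lemma nu_Rplus:
  assumes "u \<in> Rplus i" "v \<in> Rplus j"
  shows "nu l u v \<in> Rplus (i + j)"
  unfolding Rplus_def
proof (rule bilinear_in_span[OF _ _ _ assms[unfolded Rplus_def]])
  fix u v :: "('a, 'b, 'c) ralg" assume "u \<in> basisE i" "v \<in> basisE j"
  then show "nu l u v \<in> ra.span (basisE (i + j))"
    unfolding basisE_def[of i] basisE_def[of j] Rplus_def[symmetric]
    by (auto simp: nu_E Rplus_def ra.span_zero bit_add_self add_ac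
        intro!: ra.span_scale E_in_Rplus[unfolded Rplus_def])
qed (simp_all add: lin_simps)

lemma sign2_mult_self: "sign2 i * sign2 i = (1 :: 'f::field_char_0)"
  by (simp add: sign2_def)

lemma sign2_mult_add:
  "sign2 (i * (j + k)) = (sign2 (i * j) * sign2 (i * k) :: 'f::field_char_0)"
  "sign2 ((j + k) * i) = (sign2 (j * i) * sign2 (k * i) :: 'f::field_char_0)"
  unfolding sign2_def by (cases i; cases j; cases k; simp_all)+

abbreviation prod_n :: "('f::field_char_0, 'm::finite, 'n::finite) ralg \<Rightarrow> nat \<Rightarrow> ('f, 'm, 'n) ralg \<Rightarrow> ('f, 'm, 'n) ralg"
  where "prod_n u l v \<equiv> ra_Y u v (- int l - 1)"

lemma prod_n_Rplus:
  assumes "u \<in> Rplus i" "v \<in> Rplus j"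
  shows "prod_n u l v \<in> Rplus (i + j)"
  using mu_Rplus[OF assms] nu_Rplus[OF assms]
  unfolding ra_Y_mu_nu[OF assms] Rplus_def by (intro ra.span_diff ra.span_scale)

text \<open>Parity signs are bimultiplicative, so all of them are products of \<open>x\<close>,
  \<open>y\<close> and \<open>z\<close>. The mixed terms, with one \<open>mu\<close> and one
  \<open>nu\<close>, cancel between the two orders by \<open>mu_nu_commute\<close> and
  \<open>x * x = 1\<close>; the four remaining terms are the left-hand sides of the four composition
  rules.\<close>

lemma Rplus_jacobi:
  fixes u v w :: "('f::field_char_0, 'm::finite, 'n::finite) ralg"
  assumes u: "u \<in> Rplus i" and v: "v \<in> Rplus j" and w: "w \<in> Rplus k"
  shows "prod_n u M (prod_n v N w) - ra_scale (sign2 (i * j)) (prod_n v N (prod_n u M w)) =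
    (\<Sum>t\<le>M. ra_scale (of_nat (M choose t)) (prod_n (prod_n u t v) (M + N - t) w))"
proof -
  note uvw = Rplus_subset[THEN subsetD, OF u] Rplus_subset[THEN subsetD, OF v] Rplus_subset[THEN subsetD, OF w]
  define x y z :: 'f where "x = sign2 (i * j)" and "y = sign2 (i * k)" and "z = sign2 (j * k)"
  have sgn: "sign2 (i * (j + k)) = x * y" "sign2 (j * (i + k)) = x * z" "sign2 ((i + j) * k) = y * z"
    unfolding sign2_mult_add x_def y_def z_def by (simp_all only: mult.commute)
  have xx: "x * x = 1" "x * (x * t) = t" for t
    by (simp_all add: x_def sign2_mult_self flip: mult.assoc)
  have 1: "prod_n u M (prod_n v N w) = mu M u (mu N v w) - ra_scale z (mu M u (nu N v w)) -
      ra_scale (x * y) (nu M u (mu N v w)) + ra_scale (x * y * z) (nu M u (nu N v w))"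
    using ra_Y_mu_nu[OF u prod_n_Rplus[OF v w], of N M] unfolding ra_Y_mu_nu[OF v w] sgn z_def[symmetric]
    by (simp add: mu.bilext_linear nu.bilext_linear ra.scale_right_diff_distrib mult_ac)
  have 2: "prod_n v N (prod_n u M w) = mu N v (mu M u w) - ra_scale y (mu N v (nu M u w)) -
      ra_scale (x * z) (nu N v (mu M u w)) + ra_scale (x * y * z) (nu N v (nu M u w))"
    using ra_Y_mu_nu[OF v prod_n_Rplus[OF u w], of M N] unfolding ra_Y_mu_nu[OF u w] sgn y_def[symmetric]
    by (simp add: mu.bilext_linear nu.bilext_linear ra.scale_right_diff_distrib mult_ac)
  have 3: "prod_n (prod_n u t v) L w = mu L (mu t u v) w - ra_scale x (mu L (nu t u v) w) -
      ra_scale (y * z) (nu L (mu t u v) w) + ra_scale (x * y * z) (nu L (nu t u v) w)" for t L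
    using ra_Y_mu_nu[OF prod_n_Rplus[OF u v] w, of t L] unfolding ra_Y_mu_nu[OF u v] sgn x_def[symmetric]
    by (simp add: mu.bilext_linear nu.bilext_linear ra.scale_right_diff_distrib mult_ac)
  have "(\<Sum>t\<le>M. ra_scale (of_nat (M choose t)) (prod_n (prod_n u t v) (M + N - t) w)) =
      mu M u (mu N v w) - ra_scale x (mu N v (mu M u w)) -
      ra_scale (y * z) (nu N v (nu M u w)) + ra_scale (x * y * z) (nu M u (nu N v w))"
    unfolding 3 mu_mu[OF uvw] mu_mu_swap[OF uvw] nu_nu[OF uvw] nu_nu_swap[OF uvw]
    by (simp add: ra.scale_right_diff_distrib ra.scale_right_distrib sum.distrib sum_subtractf
        ra.scale_sum_right mult_ac)
  also have "\<dots> = prod_n u M (prod_n v N w) - ra_scale x (prod_n v N (prod_n u M w))"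
    unfolding 1 2 mu_nu_commute[OF uvw] mu_nu_commute[OF uvw(2,1,3)]
    by (simp add: ra.scale_right_diff_distrib ra.scale_right_distrib mult_ac xx)
  finally show ?thesis by (simp add: x_def)
qed


section \<open>Products and the derivation\<close>

lemma lam_deriv:
  "(of_nat (m + 1) * lam d (m + 1) n p l + of_nat (n + 1) * lam d m (n + 1) p l :: 'f::field_char_0) =
    - of_nat l * lam d m n p (l - 1)"
proof (cases "l \<le> m + n + p + d + 1")
  case True
  define X where "X = m + n + p + d + 1 - l"
  have 1: "(of_nat (m + 1) * of_nat (X choose (m + 1)) :: 'f) = (of_nat X - of_nat m) * of_nat (X choose m)"
  proof (cases "m \<le> X")
    case True
    have "(m + 1) * (X choose (m + 1)) = (X - m) * (X choose m)"
      by (simp only: Suc_eq_plus1[symmetric] binomial_absorption binomial_absorb_comp)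
    then have "(of_nat ((m + 1) * (X choose (m + 1))) :: 'f) = of_nat ((X - m) * (X choose m))"
      by (rule arg_cong)
    then show ?thesis using True by (simp only: of_nat_mult of_nat_diff)
  qed (simp add: binomial_eq_0)
  \<comment> \<open>The two absorption identities contribute the factors X - m and n + p + d + 1
    with opposite signs, and these differ exactly by \<open>l\<close>.\<close>
  have X: "(of_nat X - of_nat m :: 'f) = of_nat (n + p + d + 1) - of_nat l"
    using True by (simp add: X_def of_nat_diff)
  have 2: "(of_nat (n + 1) * ct d (n + 1) p :: 'f) = of_nat (n + p + d + 1) * ct d n p"
    by (simp add: ct_def field_simps del: of_nat_Suc)
  have L: "lam d (m + 1) n p l = ((- 1) ^ n * ct d n p * of_nat (X choose (m + 1)) :: 'f)"
    "lam d m (n + 1) p l = (- ((- 1) ^ n * ct d (n + 1) p * of_nat (X choose m)) :: 'f)"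
    using True by (simp_all add: lam_def X_def)
  have R: "of_nat l * lam d m n p (l - 1) = (of_nat l * ((- 1) ^ n * ct d n p * of_nat (X choose m)) :: 'f)"
    using True by (cases l) (simp_all add: lam_def X_def)
  have "(of_nat (m + 1) * lam d (m + 1) n p l + of_nat (n + 1) * lam d m (n + 1) p l :: 'f) =
      (- 1) ^ n * ct d n p * (of_nat (m + 1) * of_nat (X choose (m + 1))) -
      (of_nat (n + 1) * ct d (n + 1) p) * (- 1) ^ n * of_nat (X choose m)"
    unfolding L by (simp add: mult_ac)
  also have "\<dots> = - (of_nat l * lam d m n p (l - 1))"
    unfolding 1 2 X R by (simp add: algebra_simps)
  finally show ?thesis by simp
next
  case False
  then show ?thesis by (auto simp: lam_def)
qed

lemma mu_D:
  assumes "u \<in> ra.span Eall" "v \<in> ra.span Eall"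
  shows "mu l (ra_D u) v = ra_scale (- of_nat l) (mu (l - 1) u v)"
proof (rule bilinear_eq_on_span[OF _ _ _ _ _ assms])
  fix u v :: "('a, 'b, 'c) ralg" assume "u \<in> Eall" "v \<in> Eall"
  then obtain a m b n c p d q where u: "u = E a m b n" and v: "v = E c p d q"
    unfolding Eall_def by blast
  show "mu l (ra_D u) v = ra_scale (- of_nat l) (mu (l - 1) u v)"
  proof (cases "b = c")
    case True
    then show ?thesis
      using lam_deriv[of m "dl b" n p l, where 'f='a] unfolding u v
      by (cases l) (simp_all add: ra_D_E mu.bilext_linear mu_E
        flip: ra.scale_left_distrib ra.scale_minus_left del: of_nat_add of_nat_Suc)
  next
    case False
    then show ?thesis unfolding u v by (simp add: ra_D_E mu.bilext_linear mu_E)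
  qed
qed (simp_all add: lin_simps)

lemma nu_D:
  assumes "u \<in> ra.span Eall" "v \<in> ra.span Eall"
  shows "nu l (ra_D u) v = ra_scale (- of_nat l) (nu (l - 1) u v)"
proof (rule bilinear_eq_on_span[OF _ _ _ _ _ assms])
  fix u v :: "('a, 'b, 'c) ralg" assume "u \<in> Eall" "v \<in> Eall"
  then obtain a m b n c p d q where u: "u = E a m b n" and v: "v = E c p d q"
    unfolding Eall_def by blast
  let ?s = "(- 1) ^ dl a :: 'a"
  have *: "of_nat (m + 1) * (?s * lam (dl a) n (m + 1) q l) +
      of_nat (n + 1) * (?s * lam (dl a) (n + 1) m q l) = - of_nat l * (?s * lam (dl a) n m q (l - 1))"
    using arg_cong[OF lam_deriv[of n "dl a" m q l, where 'f='a], of "\<lambda>x. ?s * x"]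
    by (simp add: algebra_simps)
  show "nu l (ra_D u) v = ra_scale (- of_nat l) (nu (l - 1) u v)"
  proof (cases "a = d")
    case True
    then show ?thesis
      using * unfolding u v
      by (cases l) (simp_all add: ra_D_E nu.bilext_linear nu_E
        flip: ra.scale_left_distrib ra.scale_minus_left del: of_nat_add of_nat_Suc)
  next
    case False
    then show ?thesis unfolding u v by (simp add: ra_D_E nu.bilext_linear nu_E)
  qed
qed (simp_all add: lin_simps)

section \<open>Divided powers of the derivation, and skew-symmetry\<close>

definition Dterm :: "'m + 'n \<Rightarrow> nat \<Rightarrow> 'm + 'n \<Rightarrow> nat \<Rightarrow> nat \<Rightarrow> nat \<Rightarrow> ('f::field_char_0, 'm::finite, 'n::finite) ralg"
  where "Dterm a m b n i s = ra_scale (of_nat ((m + i) choose i) * of_nat ((n + s) choose s)) (E a (m + i) b (n + s))"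

lemma Suc_times_choose: "(of_nat (m + i + 1) * of_nat ((m + i) choose i) :: 'f::field_char_0) =
    of_nat (i + 1) * of_nat ((m + (i + 1)) choose (i + 1))"
proof -
  have "(m + i + 1) * ((m + i) choose i) = (i + 1) * ((m + (i + 1)) choose (i + 1))"
    using Suc_times_binomial_eq[of "m + i" i] by (simp add: mult.commute del: binomial_Suc_Suc)
  from arg_cong[OF this, of of_nat] show ?thesis by (simp only: of_nat_mult)
qed

lemma ra_D_Dterm:
  "ra_D (Dterm a m b n i s) = ra_scale (of_nat (i + 1)) (Dterm a m b n (i + 1) s) +
    ra_scale (of_nat (s + 1)) (Dterm a m b n i (s + 1))"
proof -
  have "ra_D (Dterm a m b n i s) =
    ra_scale ((of_nat (m + i + 1) * of_nat ((m + i) choose i)) * of_nat ((n + s) choose s)) (E a (m + (i + 1)) b (n + s)) +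
    ra_scale ((of_nat (n + s + 1) * of_nat ((n + s) choose s)) * of_nat ((m + i) choose i)) (E a (m + i) b (n + (s + 1)))"
    by (simp add: Dterm_def ra_D_scale ra_D_E ra.scale_right_distrib mult_ac del: of_nat_add of_nat_Suc)
  then show ?thesis
    unfolding Suc_times_choose by (simp add: Dterm_def mult_ac del: of_nat_add of_nat_Suc)
qed

lemma ra_D_sum: "ra_D (\<Sum>i\<in>A. f i) = (\<Sum>i\<in>A. ra_D (f i))"
proof (induction A rule: infinite_finite_induct)
  case (infinite A)
  then show ?case using ra_D_scale[of 0 0] by simp
next
  case empty
  then show ?case using ra_D_scale[of 0 0] by simp
qed (simp add: ra_D_add)

text \<open>The Leibniz rule for divided powers: \<open>Dterm a m b n i s\<close> applies the
  divided power of order \<open>i\<close> to the first index and that of order \<open>s\<close> to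
  the second.\<close>

lemma ra_D_funpow: "(ra_D ^^ t) (E a m b n) = ra_scale (fact t) (\<Sum>i\<le>t. Dterm a m b n i (t - i))"
proof (induction t)
  case 0
  then show ?case by (simp add: Dterm_def)
next
  case (Suc t)
  let ?W = "Dterm a m b n"
  have "(\<Sum>i\<le>t. ra_D (?W i (t - i))) =
      (\<Sum>i\<le>t. ra_scale (of_nat (i + 1)) (?W (i + 1) (t - i))) +
      (\<Sum>i\<le>t. ra_scale (of_nat (t - i + 1)) (?W i (t - i + 1)))"
    unfolding ra_D_Dterm by (simp add: sum.distrib)
  also have "(\<Sum>i\<le>t. ra_scale (of_nat (i + 1)) (?W (i + 1) (t - i))) =
      (\<Sum>i\<le>Suc t. ra_scale (of_nat i) (?W i (Suc t - i)))"
    unfolding sum.atMost_Suc_shift by simp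
  also have "(\<Sum>i\<le>t. ra_scale (of_nat (t - i + 1)) (?W i (t - i + 1))) =
      (\<Sum>i\<le>t. ra_scale (of_nat (Suc t - i)) (?W i (Suc t - i)))"
    by (rule sum.cong[OF refl]) (simp add: Suc_diff_le)
  also have "\<dots> = (\<Sum>i\<le>Suc t. ra_scale (of_nat (Suc t - i)) (?W i (Suc t - i)))"
    by simp
  also have "(\<Sum>i\<le>Suc t. ra_scale (of_nat i) (?W i (Suc t - i))) + \<dots> =
      ra_scale (of_nat (Suc t)) (\<Sum>i\<le>Suc t. ?W i (Suc t - i))"
    unfolding ra.scale_sum_right sum.distrib[symmetric]
    by (rule sum.cong[OF refl]) (simp flip: ra.scale_left_distrib of_nat_add add: le_Suc_eq)
  finally have *: "(\<Sum>i\<le>t. ra_D (?W i (t - i))) = ra_scale (of_nat (Suc t)) (\<Sum>i\<le>Suc t. ?W i (Suc t - i))" .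
  show ?case
    unfolding funpow.simps o_apply Suc.IH ra_D_scale ra_D_sum * ra.scale_scale fact_Suc
    by (simp only: mult.commute)
qed

text \<open>Binomial inversion: trinomial revision pulls out \<open>Q choose q\<close> and leaves
  the alternating sum of the binomial coefficients of \<open>Q - q\<close>.\<close>

lemma alternating_choose_sum:
  "(\<Sum>j\<le>Q. (- 1) ^ j * of_nat ((Q - j) choose q) * of_nat (Q choose j)) =
    (if Q = q then 1 else 0 :: 'f::field_char_0)"
proof (cases "q \<le> Q")
  case True
  have "(\<Sum>j\<le>Q. (- 1) ^ j * of_nat ((Q - j) choose q) * of_nat (Q choose j)) =
      (\<Sum>j\<le>Q - q. of_nat (Q choose q) * ((- 1) ^ j * of_nat ((Q - q) choose j)) :: 'f)"
  proof (rule sum.mono_neutral_cong_right)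
    fix j assume "j \<in> {..Q - q}"
    then have j: "j + q \<le> Q" using True by auto
    have "(Q choose (Q - j)) * ((Q - j) choose q) = (Q choose q) * ((Q - q) choose (Q - j - q))"
      by (rule choose_mult) (use j in auto)
    moreover have "(Q choose (Q - j)) = (Q choose j)"
      using j binomial_symmetric[of j Q] by simp
    moreover have "(Q - q) choose (Q - j - q) = (Q - q) choose j"
      using j binomial_symmetric[of j "Q - q"] by (simp add: add.commute)
    ultimately have "(Q choose j) * ((Q - j) choose q) = (Q choose q) * ((Q - q) choose j)" by simp
    then have "(of_nat (Q choose j) * of_nat ((Q - j) choose q) :: 'f) = of_nat (Q choose q) * of_nat ((Q - q) choose j)"
      by (metis of_nat_mult)
    then show "(- 1) ^ j * of_nat ((Q - j) choose q) * of_nat (Q choose j) =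
        (of_nat (Q choose q) * ((- 1) ^ j * of_nat ((Q - q) choose j)) :: 'f)"
      by (simp add: mult_ac)
  qed (auto simp: binomial_eq_0)
  also have "\<dots> = of_nat (Q choose q) * (\<Sum>j\<le>Q - q. (- 1) ^ j * of_nat ((Q - q) choose j))"
    by (simp add: sum_distrib_left)
  also have "\<dots> = (if Q = q then 1 else 0)"
    using choose_alternating_sum[of "Q - q", where 'a='f] True by auto
  finally show ?thesis .
next
  case False
  then show ?thesis by (auto intro!: sum.neutral simp: binomial_eq_0)
qed

text \<open>Put \<open>t = i + j\<close> and sum over \<open>j\<close> first. The vector depends on
  \<open>i\<close> only, and the inner sum vanishes unless \<open>Z - i = q\<close>. In terms of
  fields, the spectator with index \<open>q\<close> is expanded about the other point and then moved
  back.\<close>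

lemma skew_sum:
  fixes F :: "nat \<Rightarrow> nat \<Rightarrow> ('f::field_char_0, 'm::finite, 'n::finite) ralg"
  shows "(\<Sum>t\<le>Z. ra_scale ((- 1) ^ t * of_nat ((Z - t) choose q))
      (\<Sum>i\<le>t. ra_scale (of_nat ((m + i) choose i) * of_nat ((Z - t + (t - i)) choose (t - i)))
        (F (m + i) (Z - t + (t - i))))) =
    (if q \<le> Z then ra_scale ((- 1) ^ (Z - q) * of_nat ((m + (Z - q)) choose m)) (F (m + (Z - q)) q) else 0)"
proof -
  define g where "g i j = ra_scale ((- 1) ^ (i + j) * of_nat ((Z - i - j) choose q) *
    of_nat ((m + i) choose i) * of_nat ((Z - i) choose j)) (F (m + i) (Z - i))" for i j
  have "(\<Sum>t\<le>Z. ra_scale ((- 1) ^ t * of_nat ((Z - t) choose q))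
      (\<Sum>i\<le>t. ra_scale (of_nat ((m + i) choose i) * of_nat ((Z - t + (t - i)) choose (t - i)))
        (F (m + i) (Z - t + (t - i))))) = (\<Sum>t\<le>Z. \<Sum>i\<le>t. g i (t - i))"
    unfolding ra.scale_sum_right
    by (intro sum.cong refl) (simp add: g_def mult_ac)
  also have "\<dots> = (\<Sum>(i, j)\<in>{(i, j). i + j \<le> Z}. g i j)"
    by (rule sum.triangle_reindex_eq[symmetric])
  also have "{(i, j). i + j \<le> Z} = Sigma {..Z} (\<lambda>i. {..Z - i})"
    by auto
  also have "(\<Sum>(i, j)\<in>\<dots>. g i j) = (\<Sum>i\<le>Z. \<Sum>j\<le>Z - i. g i j)"
    by (simp add: sum.Sigma)
  also have "\<dots> = (\<Sum>i\<le>Z. if Z - i = q then ra_scale ((- 1) ^ i * of_nat ((m + i) choose i)) (F (m + i) (Z - i)) else 0)"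
  proof (rule sum.cong[OF refl])
    fix i
    have "(\<Sum>j\<le>Z - i. g i j) = ra_scale (((- 1) ^ i * of_nat ((m + i) choose i)) *
        (\<Sum>j\<le>Z - i. (- 1) ^ j * of_nat ((Z - i - j) choose q) * of_nat ((Z - i) choose j))) (F (m + i) (Z - i))"
      unfolding g_def ra.scale_sum_left[symmetric] sum_distrib_left by (simp add: power_add mult_ac)
    then show "(\<Sum>j\<le>Z - i. g i j) = (if Z - i = q then ra_scale ((- 1) ^ i * of_nat ((m + i) choose i)) (F (m + i) (Z - i)) else 0)"
      unfolding alternating_choose_sum by simp
  qed
  also have "\<dots> = (if q \<le> Z then ra_scale ((- 1) ^ (Z - q) * of_nat ((m + (Z - q)) choose m)) (F (m + (Z - q)) q) else 0)"
  proof (cases "q \<le> Z")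
    case True
    have "(\<Sum>i\<le>Z. if Z - i = q then ra_scale ((- 1) ^ i * of_nat ((m + i) choose i)) (F (m + i) (Z - i)) else 0) =
        (\<Sum>i\<le>Z. if i = Z - q then ra_scale ((- 1) ^ i * of_nat ((m + i) choose i)) (F (m + i) (Z - i)) else 0)"
      by (rule sum.cong) (use True in auto)
    then show ?thesis using True binomial_symmetric[of m "m + (Z - q)"] by simp
  next
    case False
    then show ?thesis by (auto intro!: sum.neutral)
  qed
  finally show ?thesis .
qed

lemma ra_D_zero [simp]: "ra_D 0 = 0"
  using ra_D_scale[of 0 0] by simp

lemma lin_funpow_D: "(ra_D ^^ t) (x + y) = (ra_D ^^ t) x + (ra_D ^^ t) y"
    "(ra_D ^^ t) (ra_scale c x) = ra_scale c ((ra_D ^^ t) x)" "(ra_D ^^ t) 0 = 0"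
    "(ra_D ^^ t) (x - y) = (ra_D ^^ t) x - (ra_D ^^ t) y"
proof -
  show *: "(ra_D ^^ t) (x + y) = (ra_D ^^ t) x + (ra_D ^^ t) y" for x y :: "('a, 'b, 'c) ralg"
    by (induction t) (simp_all add: ra_D_add)
  show "(ra_D ^^ t) (ra_scale c x) = ra_scale c ((ra_D ^^ t) x)"
    by (induction t) (simp_all add: ra_D_scale)
  show "(ra_D ^^ t) 0 = 0"
    by (induction t) simp_all
  show "(ra_D ^^ t) (x - y) = (ra_D ^^ t) x - (ra_D ^^ t) y"
    using *[of "x - y" y] by (simp add: algebra_simps)
qed

text \<open>Exchanging u and v makes the same contraction one of \<open>nu\<close> type, with the
  same constant by \<open>ct_commute\<close>. The vanishing of \<open>lam\<close> beyond the pole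
  order makes the sum independent of \<open>K\<close> above the stated bound.\<close>

lemma mu_skew_E:
  assumes "K > p + q + n + dl b"
  shows "mu l (E a m b n) (E c p d q) = (\<Sum>t<K. ra_scale ((- 1) ^ (l + t) / fact t)
    ((ra_D ^^ t) (nu (l + t) (E c p d q) (E a m b n :: ('f::field_char_0, 'm::finite, 'n::finite) ralg))))"
proof (cases "b = c \<and> l \<le> p + q + n + dl b")
  case True
  define Z where "Z = p + q + n + dl b - l"
  define C :: 'f where "C = (- 1) ^ l * (- 1) ^ dl b * (- 1) ^ p * ct (dl b) p n"
  have "(\<Sum>t<K. ra_scale ((- 1) ^ (l + t) / fact t) ((ra_D ^^ t) (nu (l + t) (E c p d q) (E a m b n)))) =
    (\<Sum>t\<le>Z. ra_scale C (ra_scale ((- 1) ^ t * of_nat ((Z - t) choose q)) (\<Sum>i\<le>t. ra_scale (of_nat ((m + i) choose i) *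
      of_nat ((Z - t + (t - i)) choose (t - i))) (E a (m + i) d (Z - t + (t - i))))))"
  proof (rule sum.mono_neutral_cong_right)
    show "\<forall>t\<in>{..<K} - {..Z}. ra_scale ((- 1) ^ (l + t) / fact t)
        ((ra_D ^^ t) (nu (l + t) (E c p d q) (E a m b n))) = 0"
      using True by (auto simp: nu_E lam_def Z_def lin_funpow_D)
    fix t assume "t \<in> {..Z}"
    then have t: "l + t \<le> q + p + n + dl b" and e: "q + p + n + dl b - (l + t) = Z - t"
      using True by (auto simp: Z_def)
    have lam: "lam (dl b) q p n (l + t) = ((- 1) ^ p * ct (dl b) p n * of_nat ((Z - t) choose q) :: 'f)"
      unfolding lam_def if_P[OF t] e ..
    have nuE: "nu (l + t) (E c p d q) (E a m b n) =
        ra_scale ((- 1) ^ dl b * ((- 1) ^ p * ct (dl b) p n * of_nat ((Z - t) choose q))) (E a m d (Z - t) :: ('f, 'm, 'n) ralg)"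
      unfolding conjunct1[OF True, symmetric] nu_E if_P[OF refl] lam e ..
    show "ra_scale ((- 1) ^ (l + t) / fact t) ((ra_D ^^ t) (nu (l + t) (E c p d q) (E a m b n :: ('f, 'm, 'n) ralg))) =
      ra_scale C (ra_scale ((- 1) ^ t * of_nat ((Z - t) choose q)) (\<Sum>i\<le>t. ra_scale (of_nat ((m + i) choose i) *
        of_nat ((Z - t + (t - i)) choose (t - i))) (E a (m + i) d (Z - t + (t - i)))))"
      unfolding nuE lin_funpow_D ra_D_funpow Dterm_def
      by (simp add: C_def power_add mult_ac)
  qed (use assms in \<open>auto simp: Z_def\<close>)
  also have "\<dots> = ra_scale C (if q \<le> Z then ra_scale ((- 1) ^ (Z - q) * of_nat ((m + (Z - q)) choose m)) (E a (m + (Z - q)) d q) else 0)"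
    unfolding ra.scale_sum_right[symmetric] skew_sum[where F = "\<lambda>x y. E a x d y"] ..
  also have "\<dots> = mu l (E a m b n) (E c p d q)"
  proof (cases "q \<le> Z")
    case qZ: True
    then have Zq: "Z - q + l = p + n + dl b" "l \<le> m + n + p + dl b" "m + (Z - q) = m + n + p + dl b - l"
      using True by (auto simp: Z_def)
    \<comment> \<open>The exponents add up to \<open>p + n + dl b\<close>. This replaces the sign
      \<open>(- 1) ^ p\<close> of the \<open>nu\<close> coefficient by the \<open>(- 1) ^ n\<close>
      of \<open>mu\<close> and uses up \<open>(- 1) ^ dl b\<close>.\<close>
    have sg: "(- 1) ^ l * (- 1) ^ (Z - q) = ((- 1) ^ p * (- 1) ^ n * (- 1) ^ dl b :: 'f)"
      unfolding power_add[symmetric] Zq(1)[unfolded add.commute[of _ l]] ..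
    have "C * (- 1) ^ (Z - q) = ((- 1) ^ l * (- 1) ^ (Z - q)) * (- 1) ^ dl b * (- 1) ^ p * ct (dl b) p n"
      unfolding C_def by (simp only: mult_ac)
    also have "\<dots> = ((- 1) ^ p * (- 1) ^ n * (- 1) ^ dl b) * (- 1) ^ dl b * (- 1) ^ p * ct (dl b) p n"
      unfolding sg ..
    also have "\<dots> = (- 1) ^ n * ct (dl b) n p"
      by (cases "even p"; cases "even (dl b)") (simp_all add: ct_commute)
    finally have C: "C * (- 1) ^ (Z - q) = (- 1) ^ n * ct (dl b) n p" .
    have "ra_scale C (ra_scale ((- 1) ^ (Z - q) * of_nat ((m + (Z - q)) choose m)) (E a (m + (Z - q)) d q)) =
      ra_scale ((C * (- 1) ^ (Z - q)) * of_nat ((m + (Z - q)) choose m)) (E a (m + (Z - q)) d q :: ('f, 'm, 'n) ralg)"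
      by (simp add: mult_ac)
    then show ?thesis
      unfolding C using True qZ Zq(2) unfolding Zq(3) by (simp add: mu_E lam_def)
  next
    case False
    then have "m + n + p + dl b - l < m" if "l \<le> m + n + p + dl b"
      using True that by (auto simp: Z_def)
    then show ?thesis using False by (auto simp: mu_E lam_def binomial_eq_0)
  qed
  finally show ?thesis by simp
next
  case False
  then show ?thesis by (auto simp: mu_E nu_E lam_def lin_funpow_D binomial_eq_0)
qed

lemma nu_skew_E:
  assumes "K > p + q + m + dl a"
  shows "nu l (E a m b n) (E c p d q) = (\<Sum>t<K. ra_scale ((- 1) ^ (l + t) / fact t)
    ((ra_D ^^ t) (mu (l + t) (E c p d q) (E a m b n :: ('f::field_char_0, 'm::finite, 'n::finite) ralg))))"
proof (cases "a = d \<and> l \<le> p + q + m + dl a")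
  case True
  define Z where "Z = p + q + m + dl a - l"
  define C :: 'f where "C = (- 1) ^ l * (- 1) ^ q * ct (dl a) q m"
  have "(\<Sum>t<K. ra_scale ((- 1) ^ (l + t) / fact t) ((ra_D ^^ t) (mu (l + t) (E c p d q) (E a m b n)))) =
    (\<Sum>t\<le>Z. ra_scale C (ra_scale ((- 1) ^ t * of_nat ((Z - t) choose p)) (\<Sum>i\<le>t. ra_scale (of_nat ((n + i) choose i) *
      of_nat ((Z - t + (t - i)) choose (t - i))) (E c (Z - t + (t - i)) b (n + i)))))"
  proof (rule sum.mono_neutral_cong_right)
    show "\<forall>t\<in>{..<K} - {..Z}. ra_scale ((- 1) ^ (l + t) / fact t)
        ((ra_D ^^ t) (mu (l + t) (E c p d q) (E a m b n))) = 0"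
      using True by (auto simp: mu_E lam_def Z_def lin_funpow_D)
    fix t assume "t \<in> {..Z}"
    then have t: "l + t \<le> p + q + m + dl a" and e: "p + q + m + dl a - (l + t) = Z - t"
      using True by (auto simp: Z_def)
    have lam: "lam (dl a) p q m (l + t) = ((- 1) ^ q * ct (dl a) q m * of_nat ((Z - t) choose p) :: 'f)"
      unfolding lam_def if_P[OF t] e ..
    have muE: "mu (l + t) (E c p d q) (E a m b n) =
        ra_scale ((- 1) ^ q * ct (dl a) q m * of_nat ((Z - t) choose p)) (E c (Z - t) b n :: ('f, 'm, 'n) ralg)"
      unfolding conjunct1[OF True, symmetric] mu_E if_P[OF refl] lam e ..
    \<comment> \<open>\<open>mu\<close> expands the first index, so the Leibniz sum is read
      backwards to fit \<open>skew_sum\<close> with the two slots interchanged.\<close>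
    have rev: "(\<Sum>i\<le>t. ra_scale (of_nat ((Z - t + i) choose i) * of_nat ((n + (t - i)) choose (t - i))) (E c (Z - t + i) b (n + (t - i)))) =
      (\<Sum>i\<le>t. ra_scale (of_nat ((n + i) choose i) * of_nat ((Z - t + (t - i)) choose (t - i))) (E c (Z - t + (t - i)) b (n + i) :: ('f, 'm, 'n) ralg))"
      by (rule sum.reindex_bij_witness[where i = "\<lambda>i. t - i" and j = "\<lambda>i. t - i"]) (auto simp: mult_ac)
    show "ra_scale ((- 1) ^ (l + t) / fact t) ((ra_D ^^ t) (mu (l + t) (E c p d q) (E a m b n :: ('f, 'm, 'n) ralg))) =
      ra_scale C (ra_scale ((- 1) ^ t * of_nat ((Z - t) choose p)) (\<Sum>i\<le>t. ra_scale (of_nat ((n + i) choose i) *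
        of_nat ((Z - t + (t - i)) choose (t - i))) (E c (Z - t + (t - i)) b (n + i))))"
      unfolding muE lin_funpow_D ra_D_funpow Dterm_def rev
      by (simp add: C_def power_add mult_ac)
  qed (use assms in \<open>auto simp: Z_def\<close>)
  also have "\<dots> = ra_scale C (if p \<le> Z then ra_scale ((- 1) ^ (Z - p) * of_nat ((n + (Z - p)) choose n)) (E c p b (n + (Z - p))) else 0)"
    unfolding ra.scale_sum_right[symmetric] skew_sum[where F = "\<lambda>x y. E c y b x"] ..
  also have "\<dots> = nu l (E a m b n) (E c p d q)"
  proof (cases "p \<le> Z")
    case pZ: True
    then have Zp: "Z - p + l = q + m + dl a" "l \<le> n + m + q + dl a" "n + (Z - p) = n + m + q + dl a - l"
      using True by (auto simp: Z_def)
    have sg: "(- 1) ^ l * (- 1) ^ (Z - p) = ((- 1) ^ q * (- 1) ^ m * (- 1) ^ dl a :: 'f)"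
      unfolding power_add[symmetric] Zp(1)[unfolded add.commute[of _ l]] ..
    have "C * (- 1) ^ (Z - p) = ((- 1) ^ l * (- 1) ^ (Z - p)) * (- 1) ^ q * ct (dl a) q m"
      unfolding C_def by (simp only: mult_ac)
    also have "\<dots> = ((- 1) ^ q * (- 1) ^ m * (- 1) ^ dl a) * (- 1) ^ q * ct (dl a) q m"
      unfolding sg ..
    also have "\<dots> = (- 1) ^ dl a * ((- 1) ^ m * ct (dl a) m q)"
      by (cases "even q") (simp_all add: ct_commute)
    finally have C: "C * (- 1) ^ (Z - p) = (- 1) ^ dl a * ((- 1) ^ m * ct (dl a) m q)" .
    have "ra_scale C (ra_scale ((- 1) ^ (Z - p) * of_nat ((n + (Z - p)) choose n)) (E c p b (n + (Z - p)))) =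
      ra_scale ((C * (- 1) ^ (Z - p)) * of_nat ((n + (Z - p)) choose n)) (E c p b (n + (Z - p)) :: ('f, 'm, 'n) ralg)"
      by (simp add: mult_ac)
    then show ?thesis
      unfolding C using True pZ Zp(2) unfolding Zp(3) by (simp add: nu_E lam_def)
  next
    case False
    then have "n + m + q + dl a - l < n" if "l \<le> n + m + q + dl a"
      using True that by (auto simp: Z_def)
    then show ?thesis using False by (auto simp: nu_E lam_def binomial_eq_0)
  qed
  finally show ?thesis by simp
next
  case False
  then show ?thesis by (auto simp: mu_E nu_E lam_def lin_funpow_D binomial_eq_0)
qed

lemma bilinear_eventually_eq_on_span:
  assumes "\<And>v. lin (\<lambda>u. f u v)" "\<And>u. lin (f u)" "\<And>K v. lin (\<lambda>u. g K u v)" "\<And>K u. lin (g K u)"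
    and "\<And>u v. u \<in> B \<Longrightarrow> v \<in> C \<Longrightarrow> \<forall>\<^sub>F K in F. f u v = g K u v" "u \<in> ra.span B" "v \<in> ra.span C"
  shows "\<forall>\<^sub>F K in F. f u v = g K u v"
proof -
  have 1: "\<forall>\<^sub>F K in F. f u v = g K u v" if "u \<in> B" for u
    by (rule eventually_eq_on_span[OF assms(2) assms(4) _ assms(7)]) (use that assms(5) in auto)
  show ?thesis
    by (rule eventually_eq_on_span[where g = "\<lambda>K u. g K u v", OF assms(1) assms(3) _ assms(6)]) (use 1 in auto)
qed

lemma mu_skew:
  assumes "u \<in> ra.span Eall" "v \<in> ra.span Eall"
  shows "\<forall>\<^sub>F K in sequentially. mu l u v =
    (\<Sum>t<K. ra_scale ((- 1) ^ (l + t) / fact t) ((ra_D ^^ t) (nu (l + t) v u)))"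
proof (rule bilinear_eventually_eq_on_span[OF _ _ _ _ _ assms,
    where g = "\<lambda>K u v. \<Sum>t<K. ra_scale ((- 1) ^ (l + t) / fact t) ((ra_D ^^ t) (nu (l + t) v u))"])
  fix u v :: "('a, 'b, 'c) ralg" assume "u \<in> Eall" "v \<in> Eall"
  then obtain a m b n c p d q where u: "u = E a m b n" and v: "v = E c p d q"
    unfolding Eall_def by blast
  show "\<forall>\<^sub>F K in sequentially. mu l u v =
      (\<Sum>t<K. ra_scale ((- 1) ^ (l + t) / fact t) ((ra_D ^^ t) (nu (l + t) v u)))"
    using eventually_gt_at_top[of "p + q + n + dl b"] unfolding u v
    by eventually_elim (rule mu_skew_E)
qed (simp_all add: lin_simps lin_funpow_D)

lemma nu_skew:
  assumes "u \<in> ra.span Eall" "v \<in> ra.span Eall"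
  shows "\<forall>\<^sub>F K in sequentially. nu l u v =
    (\<Sum>t<K. ra_scale ((- 1) ^ (l + t) / fact t) ((ra_D ^^ t) (mu (l + t) v u)))"
proof (rule bilinear_eventually_eq_on_span[OF _ _ _ _ _ assms,
    where g = "\<lambda>K u v. \<Sum>t<K. ra_scale ((- 1) ^ (l + t) / fact t) ((ra_D ^^ t) (mu (l + t) v u))"])
  fix u v :: "('a, 'b, 'c) ralg" assume "u \<in> Eall" "v \<in> Eall"
  then obtain a m b n c p d q where u: "u = E a m b n" and v: "v = E c p d q"
    unfolding Eall_def by blast
  show "\<forall>\<^sub>F K in sequentially. nu l u v =
      (\<Sum>t<K. ra_scale ((- 1) ^ (l + t) / fact t) ((ra_D ^^ t) (mu (l + t) v u)))"
    using eventually_gt_at_top[of "p + q + m + dl a"] unfolding u v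
    by eventually_elim (rule nu_skew_E)
qed (simp_all add: lin_simps lin_funpow_D)

lemma prod_n_eventually_zero:
  assumes "u \<in> ra.span Eall" "v \<in> ra.span Eall"
  shows "\<forall>\<^sub>F l in sequentially. prod_n u l v = 0"
proof -
  have "\<forall>\<^sub>F l in sequentially. 0 = prod_n u l v"
  proof (rule bilinear_eventually_eq_on_span[OF _ _ _ _ _ assms,
      where f = "\<lambda>u v. 0" and g = "\<lambda>l u v. prod_n u l v"])
    fix u v :: "('a, 'b, 'c) ralg" assume "u \<in> Eall" "v \<in> Eall"
    then obtain a m b n c p d q where u: "u = E a m b n" and v: "v = E c p d q"
      unfolding Eall_def by blast
    show "\<forall>\<^sub>F l in sequentially. 0 = prod_n u l v"
      using eventually_gt_at_top[of "m + n + p + q + dl a + dl b"] unfolding u v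
    proof eventually_elim
      case (elim l)
      have z: "lam (dl b) m n p l = (0 :: 'a)" "lam (dl a) n m q l = (0 :: 'a)"
        using elim by (simp_all add: lam_def)
      show ?case unfolding ra_Y_E mu_E nu_E z by simp
    qed
  qed (simp_all add: lin_simps)
  then show ?thesis by eventually_elim simp
qed

lemma Rplus_deriv:
  assumes "u \<in> Rplus i" "ra_D u \<in> Rplus i" "v \<in> Rplus j"
  shows "ra_Y (ra_D u) v = series_deriv ra_scale (ra_Y u v)"
proof
  fix e
  note uv = Rplus_subset[THEN subsetD, OF assms(1)] Rplus_subset[THEN subsetD, OF assms(3)]
  show "ra_Y (ra_D u) v e = series_deriv ra_scale (ra_Y u v) e"
  proof (cases e rule: int_cases_pole)
    case 1
    then show ?thesis by (simp add: series_deriv_def ra_Y_nonneg)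
  next
    case (2 l)
    have "prod_n (ra_D u) l v = ra_scale (- of_nat l) (prod_n u (l - 1) v)"
      unfolding ra_Y_mu_nu[OF assms(2,3)] ra_Y_mu_nu[OF assms(1,3)] mu_D[OF uv] nu_D[OF uv]
      by (simp add: ra.scale_right_diff_distrib mult.commute)
    moreover have "e + 1 = - int (l - 1) - 1" if "l > 0" using 2 that by simp
    ultimately show ?thesis unfolding series_deriv_def
      by (cases "l = 0") (simp_all add: 2)
  qed
qed

text \<open>All coefficients in the expansion of 1/(z - x) are 1, so this residue is the projection
  onto the negative powers.\<close>

lemma res_geom_eq:
  fixes g :: "int \<Rightarrow> ('f::field_char_0, 'm::finite, 'n::finite) ralg"
  shows "res_geom ra_scale g e = (if e < 0 then g e else 0)"
proof -
  have "(\<lambda>b. ra_scale (binexp (- 1) e b) (g (- 1 - b))) =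
      (\<lambda>b. (if e < 0 then g e else 0) when b = - 1 - e)"
  proof
    fix b
    have "(- 1 :: 'f) ^ nat b * ((- 1) gchoose nat b) = 1"
      using gbinomial_minus[of "1 :: 'f" "nat b"]
      by (simp flip: power_mult_distrib binomial_gbinomial)
    then show "ra_scale (binexp (- 1) e b) (g (- 1 - b)) = ((if e < 0 then g e else 0) when b = - 1 - e)"
      by (auto simp: binexp_def when_def)
  qed
  then show ?thesis unfolding res_geom_def by (simp only: Sum_any_when_equal)
qed

lemma Rplus_skew:
  fixes u v :: "('f::field_char_0, 'm::finite, 'n::finite) ralg"
  assumes u: "u \<in> Rplus i" and v: "v \<in> Rplus j"
  shows "ra_Y u v e = ra_scale (sign2 (i * j))
    (res_geom ra_scale (exp_shift ra_scale ra_D (subst_neg ra_scale (ra_Y v u))) e)"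
proof -
  note uv = Rplus_subset[THEN subsetD, OF u] Rplus_subset[THEN subsetD, OF v]
  show ?thesis
  proof (cases e rule: int_cases_pole)
    case 1
    then show ?thesis by (simp add: res_geom_eq ra_Y_nonneg)
  next
    case (2 l)
    let ?s = "sign2 (i * j) :: 'f"
    have sg: "sign2 (j * i) = ?s" by (simp only: mult.commute)
    have "\<forall>\<^sub>F t in sequentially. prod_n v (l + t) u = 0"
      using prod_n_eventually_zero[OF uv(2,1)] eventually_sequentially_seg[of "\<lambda>t. prod_n v t u = 0" l]
      unfolding add.commute[of _ l] by blast
    then have "\<forall>\<^sub>F K in sequentially. \<forall>t\<ge>K. prod_n v (l + t) u = 0"
      by (rule eventually_all_ge_at_top)
    with mu_skew[OF uv, of l] nu_skew[OF uv, of l]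
    have "\<forall>\<^sub>F K in sequentially. prod_n u l v = ra_scale ?s (exp_shift ra_scale ra_D (subst_neg ra_scale (ra_Y v u)) e)"
    proof eventually_elim
      case (elim K)
      have t: "e - int t = - int (l + t) - 1" for t using 2 by simp
      \<comment> \<open>The extra minus sign turns \<open>mu\<close> minus \<open>?s\<close> times
        \<open>nu\<close>, taken at (v, u), into \<open>?s\<close> times \<open>nu\<close> minus
        \<open>mu\<close>; this is what the exchange of \<open>mu\<close> and \<open>nu\<close> by
        \<open>mu_skew\<close> and \<open>nu_skew\<close> calls for.\<close>
      have pw: "(- 1 :: 'f) powi (- int (l + t) - 1) = - ((- 1) ^ (l + t))" for t
      proof -
        have "nat (- (- int (l + t) - 1)) = Suc (l + t)" by linarith
        then show ?thesis by (simp add: power_int_def del: minus_diff_eq)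
      qed
      have "exp_shift ra_scale ra_D (subst_neg ra_scale (ra_Y v u)) e =
          Sum_any (\<lambda>t. ra_scale (1 / fact t) ((ra_D ^^ t) (ra_scale (- ((- 1) ^ (l + t))) (prod_n v (l + t) u))))"
        unfolding exp_shift_def subst_neg_def t pw ..
      also have "\<dots> = (\<Sum>t<K. ra_scale (1 / fact t) ((ra_D ^^ t) (ra_scale (- ((- 1) ^ (l + t))) (prod_n v (l + t) u))))"
        by (rule Sum_any.expand_superset) (use elim(3) in \<open>auto simp: lin_funpow_D not_less intro: ccontr\<close>)
      also have "\<dots> = (\<Sum>t<K. ra_scale ((- 1) ^ (l + t) / fact t) (ra_scale ?s ((ra_D ^^ t) (nu (l + t) v u)) - (ra_D ^^ t) (mu (l + t) v u)))"
        unfolding ra_Y_mu_nu[OF v u] sg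
        by (intro sum.cong refl) (simp add: lin_funpow_D ra.scale_right_diff_distrib mult_ac)
      also have "\<dots> = ra_scale ?s (mu l u v) - nu l u v"
        unfolding elim(1,2) ra.scale_sum_right sum_subtractf[symmetric]
        by (intro sum.cong refl) (simp add: ra.scale_right_diff_distrib mult_ac)
      finally show ?case
        unfolding ra_Y_mu_nu[OF u v] by (simp add: ra.scale_right_diff_distrib sign2_mult_self)
    qed
    from eventually_happens'[OF sequentially_bot this]
    have "prod_n u l v = ra_scale ?s (exp_shift ra_scale ra_D (subst_neg ra_scale (ra_Y v u)) e)"
      by blast
    moreover have "e < 0" using 2 by simp
    ultimately show ?thesis unfolding res_geom_eq 2[symmetric] by (simp only: if_True)
  qed
qed


section \<open>The subalgebra \<open>R\<^sup>*\<close>\<close>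

lemma ra_Y_zero [simp]: "ra_Y 0 y e = 0" "ra_Y x 0 e = 0"
  by (simp_all add: ra_Y_bilext)

text \<open>The sign (-1)^(|a||b|) of exchanging two fields, with |a| the block of \<open>a\<close>:
  only two fermions anticommute.\<close>

definition eps :: "'m + 'n \<Rightarrow> 'm + 'n \<Rightarrow> 'f::field_char_0"
  where "eps a b = (if block a = 1 \<and> block b = 1 then - 1 else 1)"

definition S :: "'m + 'n \<Rightarrow> nat \<Rightarrow> 'm + 'n \<Rightarrow> nat \<Rightarrow> ('f::field_char_0, 'm::finite, 'n::finite) ralg"
  where "S a m b n = E a m b n + ra_scale (eps a b) (E b n a m)"

lemma eps_commute: "eps a b = eps b a"
  by (auto simp: eps_def)

lemma eps_mult_self [simp]: "eps a b * eps a b = 1" "eps a b * (eps a b * x) = x"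
  by (simp_all add: eps_def)

lemma S_swap: "S b n a m = ra_scale (eps a b) (S a m b n)"
  by (simp add: S_def eps_commute[of b a] ra.scale_right_distrib add.commute)

definition basisS :: "bit \<Rightarrow> ('f::field_char_0, 'm::finite, 'n::finite) ralg set"
  where "basisS i = {S a m b n | a m b n. block a + block b = i}"

lemma block_simps [simp]: "block (Inl p) = 0" "block (Inr q) = 1"
  by (simp_all add: block_def)

text \<open>With the sign \<open>eps\<close> the three families of spanning elements become one.
  Mixed pairs in the order \<open>Inr\<close>, \<open>Inl\<close> add nothing new by
  \<open>S_swap\<close>.\<close>

lemma Rstar_eq: "(Rstar i :: ('a::field_char_0, 'b::finite, 'c::finite) ralg set) = ra.span (basisS i)"
proof -
  consider "i = 0" | "i = 1" by (cases i) auto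
  then show ?thesis
proof cases
  case 1
  note i = 1
  have S1: "elt (mtx_unit (Inl p) (Inl q)) 0 0 m n + elt (mtx_unit (Inl q) (Inl p)) 0 0 n m = S (Inl p) m (Inl q) n"
    and S2: "elt (mtx_unit (Inr r) (Inr s)) 1 1 m n - elt (mtx_unit (Inr s) (Inr r)) 1 1 n m = S (Inr r) m (Inr s) n"
    for p q :: 'b and r s :: 'c and m n
    by (simp_all add: S_def E_def eps_def)
  have B: "(basisS i :: ('a, 'b, 'c) ralg set) = {S (Inl p) m (Inl q) n | p q m n. True} \<union> {S (Inr p) m (Inr q) n | p q m n. True}" (is "_ = ?A")
  proof
    show "basisS i \<subseteq> ?A"
    proof
      fix x :: "('a, 'b, 'c) ralg" assume "x \<in> basisS i"
      then obtain a m b n where "x = S a m b n" "block a + block b = 0"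
        unfolding basisS_def i by blast
      then show "x \<in> ?A" by (cases a; cases b) (simp_all, blast+)
    qed
    show "?A \<subseteq> basisS i" unfolding basisS_def i
    proof (rule subsetI, unfold mem_Collect_eq)
      fix x :: "('a, 'b, 'c) ralg" assume "x \<in> ?A"
      then obtain a b :: "'b + 'c" and m n where x: "x = S a m b n" and "block a = block b" by auto
      then have "block a + block b = 0" by (cases "block b") simp_all
      then show "\<exists>a m b n. x = S a m b n \<and> block a + block b = 0" unfolding x by blast
    qed
  qed
  show ?thesis unfolding B Rstar_def S1 S2 using i by simp
next
  case 2
  note i = 2
  have S1: "elt (mtx_unit (Inl p) (Inr q)) 0 1 m n + elt (mtx_unit (Inr q) (Inl p)) 1 0 n m = S (Inl p) m (Inr q) n"
    for p :: 'b and q :: 'c and m n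
    by (simp add: S_def E_def eps_def)
  have B: "(basisS i :: ('a, 'b, 'c) ralg set) = {S (Inl p) m (Inr q) n | p q m n. True}" (is "_ = ?A")
  proof
    show "basisS i \<subseteq> ?A"
    proof
      fix x :: "('a, 'b, 'c) ralg" assume "x \<in> basisS i"
      then obtain a m b n where x: "x = S a m b n" and ab: "block a + block b = 1"
        unfolding basisS_def i by blast
      have sw: "(S (Inr q) m (Inl p) n :: ('a, 'b, 'c) ralg) = S (Inl p) n (Inr q) m" for p :: 'b and q :: 'c
        using S_swap[of "Inr q" m "Inl p" n] by (simp add: eps_def)
      show "x \<in> ?A" using ab unfolding x by (cases a; cases b) (simp_all add: sw, blast+)
    qed
    show "?A \<subseteq> basisS i" unfolding basisS_def i
    proof clarify
      fix p :: 'b and q :: 'c and m n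
      have "block (Inl p :: 'b + 'c) + block (Inr q :: 'b + 'c) = 1" by simp
      then show "\<exists>a m' b n'. S (Inl p) m (Inr q) n = S a m' b n' \<and> block a + block b = 1" by blast
    qed
  qed
  show ?thesis unfolding B Rstar_def S1 using i by simp
qed
qed

text \<open>The action of \<open>S a m b n\<close> on the single index \<open>(c, p)\<close>, continued by \<open>F\<close>.\<close>

definition act :: "'m + 'n \<Rightarrow> nat \<Rightarrow> 'm + 'n \<Rightarrow> nat \<Rightarrow> nat \<Rightarrow> 'm + 'n \<Rightarrow> nat
    \<Rightarrow> ('m + 'n \<Rightarrow> nat \<Rightarrow> ('f::field_char_0, 'm::finite, 'n::finite) ralg) \<Rightarrow> ('f, 'm, 'n) ralg"
  where "act a m b n l c p F =
    (if b = c then ra_scale (lam (dl b) m n p l) (F a (m + n + p + dl b - l)) else 0) +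
    (if a = c then ra_scale (eps a b * lam (dl a) n m p l) (F b (n + m + p + dl a - l)) else 0)"

text \<open>Each half of \<open>S a m b n\<close> gives one contraction with each slot. The signs
  from \<open>nu\<close>, from \<open>eps\<close> and from the parities combine to the Koszul sign
  of passing over the field of \<open>c\<close>, as the cases on the blocks confirm.\<close>

lemma prod_S_E:
  "prod_n (S a m b n) l (E c p d q) =
    act a m b n l c p (\<lambda>x y. E x y d q) +
    ra_scale (sign2 ((block a + block b) * block c)) (act a m b n l d q (\<lambda>x y. E c p x y))"
proof -
  have 1: "prod_n (E a m b n) l (E c p d q) = (if b = c then ra_scale (lam (dl b) m n p l) (E a (m + n + p + dl b - l) d q) else 0) -
    (if a = d then ra_scale (sign2 ((block a + block b) * (block c + block d)) * ((- 1) ^ dl a * lam (dl a) n m q l)) (E c p b (n + m + q + dl a - l)) else 0)"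
    for a m b n unfolding ra_Y_E mu_E nu_E by simp
  show ?thesis
    unfolding S_def ra_Y_linear 1 act_def
    by (cases a; cases b; cases c; cases d) (auto simp: eps_def dl_def sign2_def algebra_simps)
qed

lemma act_add: "act a m b n l c p (\<lambda>x y. F x y + G x y) = act a m b n l c p F + act a m b n l c p G"
  by (simp add: act_def ra.scale_right_distrib)

lemma prod_S:
  fixes a b c d :: "'m::finite + 'n::finite"
  shows "prod_n (S a m b n) l (S c p d q :: ('f::field_char_0, 'm, 'n) ralg) =
    act a m b n l c p (\<lambda>x y. S x y d q) +
    ra_scale (sign2 ((block a + block b) * block c)) (act a m b n l d q (\<lambda>x y. S c p x y))"
proof -
  \<comment> \<open>A nonzero contraction replaces \<open>c\<close> by an index \<open>x\<close>
    with |x| = |a| + |b| + |c|; hence \<open>eps x d\<close> and \<open>eps c d\<close> differ by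
    the Koszul sign over \<open>d\<close>. The next fact is the same for the other slot.\<close>
  have 1: "ra_scale (eps c d * sign2 ((block a + block b) * block d)) (act a m b n l c p (\<lambda>x y. E d q x y)) =
      act a m b n l c p (\<lambda>x y. ra_scale (eps x d) (E d q x y) :: ('f, 'm, 'n) ralg)"
    unfolding act_def
    by (cases a; cases b; cases c; cases d) (auto simp: eps_def sign2_def)
  have 2: "ra_scale (eps c d) (act a m b n l d q (\<lambda>x y. E x y c p)) =
      ra_scale (sign2 ((block a + block b) * block c)) (act a m b n l d q (\<lambda>x y. ra_scale (eps c x) (E x y c p) :: ('f, 'm, 'n) ralg))"
    unfolding act_def
    by (cases a; cases b; cases c; cases d) (auto simp: eps_def sign2_def)
  have "prod_n (S a m b n) l (S c p d q :: ('f, 'm, 'n) ralg) = prod_n (S a m b n) l (E c p d q) + ra_scale (eps c d) (prod_n (S a m b n) l (E d q c p))"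
    unfolding S_def[of c] ra_Y_linear ..
  also have "\<dots> = act a m b n l c p (\<lambda>x y. S x y d q) +
    ra_scale (sign2 ((block a + block b) * block c)) (act a m b n l d q (\<lambda>x y. S c p x y))"
    unfolding prod_S_E S_def[of c] S_def[of _ _ d q] act_add ra.scale_right_distrib ra.scale_scale 1 2
    by (simp only: add_ac)
  finally show ?thesis .
qed

lemma S_in_Rstar: "block a + block b = i \<Longrightarrow> S a m b n \<in> Rstar i"
  unfolding Rstar_eq basisS_def by (rule ra.span_base) blast

lemma Rstar_subspace: "ra.subspace (Rstar i)"
  unfolding Rstar_eq by (rule ra.subspace_span)

lemma Rstar_subset_Rplus: "Rstar i \<subseteq> Rplus i"
  unfolding Rstar_eq Rplus_def
  by (rule ra.span_minimal)
    (auto simp: basisS_def S_def add.commute intro!: ra.span_add ra.span_scale E_in_Rplus[unfolded Rplus_def])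

lemma act_in_Rstar:
  assumes "\<And>y. b = c \<Longrightarrow> F a y \<in> Rstar i" "\<And>y. a = c \<Longrightarrow> F b y \<in> Rstar i"
  shows "act a m b n l c p F \<in> Rstar i"
  using assms unfolding act_def
  by (auto intro!: ra.subspace_add[OF Rstar_subspace] ra.subspace_scale[OF Rstar_subspace] simp: ra.subspace_0[OF Rstar_subspace])

lemma prod_n_Rstar:
  assumes "u \<in> Rstar i" "v \<in> Rstar j"
  shows "prod_n u l v \<in> Rstar (i + j)"
  unfolding Rstar_eq
proof (rule bilinear_in_span[OF _ _ _ assms[unfolded Rstar_eq]])
  fix u v :: "('a, 'b, 'c) ralg" assume "u \<in> basisS i" "v \<in> basisS j"
  then obtain a m b n c p d q where u: "u = S a m b n" "block a + block b = i"
    and v: "v = S c p d q" "block c + block d = j"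
    unfolding basisS_def by blast
  have 1: "b = c \<Longrightarrow> block a + block d = block a + block b + (block c + block d)"
    "a = c \<Longrightarrow> block b + block d = block a + block b + (block c + block d)"
    "b = d \<Longrightarrow> block c + block a = block a + block b + (block c + block d)"
    "a = d \<Longrightarrow> block c + block b = block a + block b + (block c + block d)"
    by (cases a; cases b; cases c; cases d; simp)+
  show "prod_n u l v \<in> ra.span (basisS (i + j))"
    unfolding u(1) v(1) prod_S u(2)[symmetric] v(2)[symmetric] Rstar_eq[symmetric]
    by (intro ra.subspace_add[OF Rstar_subspace] ra.subspace_scale[OF Rstar_subspace] act_in_Rstar S_in_Rstar; (rule 1, assumption))
qed (simp_all add: lin_simps)

lemma ra_D_S: "ra_D (S a m b n) = ra_scale (of_nat (m + 1)) (S a (m + 1) b n) + ra_scale (of_nat (n + 1)) (S a m b (n + 1))"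
  by (simp add: S_def ra_D_add ra_D_scale ra_D_E ra.scale_right_distrib mult.commute add_ac del: of_nat_add of_nat_Suc)

lemma ra_D_Rstar:
  assumes "u \<in> Rstar i"
  shows "ra_D u \<in> Rstar i"
  using assms[unfolded Rstar_eq]
proof (induction rule: ra.span_induct_alt)
  case base
  show ?case by (simp add: ra.subspace_0[OF Rstar_subspace])
next
  case (step c x y)
  then have "ra_D x \<in> Rstar i"
    unfolding basisS_def
    by (auto simp: ra_D_S intro!: ra.subspace_add[OF Rstar_subspace] ra.subspace_scale[OF Rstar_subspace] S_in_Rstar)
  then show ?case using step
    by (simp add: ra_D_add ra_D_scale ra.subspace_add[OF Rstar_subspace] ra.subspace_scale[OF Rstar_subspace])
qed

section \<open>Coefficients of the formal series, and the axioms for \<open>Rstar\<close>\<close>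

lemma subst_diff_eq:
  fixes g :: "int \<Rightarrow> ('f::field_char_0, 'm::finite, 'n::finite) ralg"
  shows "subst_diff ra_scale g a d = (if 0 \<le> d then ra_scale (binexp (a + d) a d) (g (a + d)) else 0)"
proof -
  have "(\<lambda>e. ra_scale (binexp e a d) (g e)) =
      (\<lambda>e. (if 0 \<le> d then ra_scale (binexp (a + d) a d) (g (a + d)) else 0) when e = a + d)"
    by (auto simp: fun_eq_iff binexp_def when_def)
  then show ?thesis unfolding subst_diff_def by (simp only: Sum_any_when_equal)
qed

lemma binexp_neg:
  assumes "t \<le> M"
  shows "binexp (- int t - 1) (- int M - 1) (int (M - t)) = (of_nat (M choose t) :: 'f::field_char_0)"
proof -
  have "(of_int (- int t - 1) :: 'f) = - (of_nat (t + 1))" by simp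
  moreover have "(of_nat (t + 1) + of_nat (M - t) - 1 :: 'f) = of_nat M"
    using assms by (simp add: of_nat_diff)
  ultimately have "(of_int (- int t - 1) gchoose (M - t) :: 'f) = (- 1) ^ (M - t) * of_nat (M choose (M - t))"
    unfolding binomial_gbinomial by (simp only: gbinomial_minus)
  then have g: "(of_int (- int t - 1) gchoose (M - t) :: 'f) = (- 1) ^ (M - t) * of_nat (M choose t)"
    unfolding binomial_symmetric[OF assms] .
  have c: "0 \<le> int (M - t) \<and> - int M - 1 + int (M - t) = - int t - 1"
    using assms by auto
  show ?thesis
    unfolding binexp_def if_P[OF c] nat_int g
    by (simp flip: mult.assoc power_mult_distrib)
qed

text \<open>Only \<open>0 \<le> d \<le> M\<close> contributes: the expansion of the powers of z - x
  forces the lower bound, and the absence of nonnegative powers in \<open>ra_Y u v\<close> the upper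
  one. The summation index is then \<open>t = M - d\<close>.\<close>

lemma jacobi_rhs:
  fixes u v w :: "('f::field_char_0, 'm::finite, 'n::finite) ralg"
  shows "Sum_any (\<lambda>d. ra_Y (subst_diff ra_scale (ra_Y u v) (- int M - 1) d) w (- int N - 1 - d)) =
    (\<Sum>t\<le>M. ra_scale (of_nat (M choose t)) (prod_n (prod_n u t v) (M + N - t) w))"
proof -
  define h where "h d = ra_Y (subst_diff ra_scale (ra_Y u v) (- int M - 1) d) w (- int N - 1 - d)" for d
  have "Sum_any h = sum h ((\<lambda>t. int (M - t)) ` {..M})"
  proof (rule Sum_any.expand_superset)
    show "{d. h d \<noteq> 0} \<subseteq> (\<lambda>t. int (M - t)) ` {..M}"
    proof
      fix d assume "d \<in> {d. h d \<noteq> 0}"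
      then have nz: "h d \<noteq> 0" by simp
      have "0 \<le> d"
        by (rule ccontr) (use nz in \<open>simp add: h_def subst_diff_eq\<close>)
      moreover have "- int M - 1 + d < 0"
      proof (rule ccontr)
        assume "\<not> - int M - 1 + d < 0"
        then have "h d = 0"
          unfolding h_def subst_diff_eq by (simp only: not_less ra_Y_nonneg) simp
        with nz show False ..
      qed
      ultimately have "d = int (M - (M - nat d))" "M - nat d \<le> M" by auto
      then show "d \<in> (\<lambda>t. int (M - t)) ` {..M}" by blast
    qed
  qed simp
  also have "\<dots> = (\<Sum>t\<le>M. h (int (M - t)))"
    by (subst sum.reindex) (auto simp: inj_on_def)
  also have "\<dots> = (\<Sum>t\<le>M. ra_scale (of_nat (M choose t)) (prod_n (prod_n u t v) (M + N - t) w))"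
  proof (rule sum.cong[OF refl])
    fix t assume "t \<in> {..M}"
    then have t: "t \<le> M" by simp
    then have e: "- int M - 1 + int (M - t) = - int t - 1" "- int N - 1 - int (M - t) = - int (M + N - t) - 1"
      by auto
    show "h (int (M - t)) = ra_scale (of_nat (M choose t)) (prod_n (prod_n u t v) (M + N - t) w)"
      unfolding h_def subst_diff_eq e binexp_neg[OF t] by (simp add: ra_Y_linear)
  qed
  finally show ?thesis unfolding h_def .
qed

lemma total_Rstar: "total Rstar = ra.span {S a m b n | a m b n. True}" (is "_ = ra.span ?B")
proof
  have "Rstar i \<subseteq> ra.span ?B" for i
    unfolding Rstar_eq by (rule ra.span_mono) (auto simp: basisS_def)
  then show "total Rstar \<subseteq> ra.span ?B"
    unfolding total_def by (blast intro: ra.span_add)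
  have "ra.span ?B = ra.span (basisS 0 \<union> basisS 1)"
  proof -
    have "?B = basisS 0 \<union> basisS 1"
      unfolding basisS_def by (auto, metis bit.exhaust)
    then show ?thesis by simp
  qed
  then show "ra.span ?B \<subseteq> total Rstar"
    unfolding ra.span_Un total_def Rstar_eq by auto
qed

lemma total_Rstar_subspace: "ra.subspace (total Rstar)"
  unfolding total_Rstar by (rule ra.subspace_span)

lemma Rstar_subset_total: "Rstar i \<subseteq> total Rstar"
  unfolding total_Rstar Rstar_eq by (rule ra.span_mono) (auto simp: basisS_def)

lemma E_in_Eall: "E a m b n \<in> Eall"
  unfolding Eall_def by blast

lemma total_Rstar_subset: "total Rstar \<subseteq> ra.span Eall"
  unfolding total_Rstar
  by (rule ra.span_minimal) (auto simp: S_def intro!: ra.span_add ra.span_scale ra.span_base[OF E_in_Eall])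

lemma Rstar_jacobi:
  assumes uv: "u \<in> Rstar i" "v \<in> Rstar j" and w: "w \<in> total Rstar"
  shows "prod_n u M (prod_n v N w) - ra_scale (sign2 (i * j)) (prod_n v N (prod_n u M w)) =
    (\<Sum>t\<le>M. ra_scale (of_nat (M choose t)) (prod_n (prod_n u t v) (M + N - t) w))"
proof -
  have uv': "u \<in> Rplus i" "v \<in> Rplus j" using uv Rstar_subset_Rplus by blast+
  obtain w0 w1 where w01: "w = w0 + w1" "w0 \<in> Rplus 0" "w1 \<in> Rplus 1"
    using w Rstar_subset_Rplus unfolding total_def by blast
  have "prod_n u M (prod_n v N w) - ra_scale (sign2 (i * j)) (prod_n v N (prod_n u M w)) =
      (prod_n u M (prod_n v N w0) - ra_scale (sign2 (i * j)) (prod_n v N (prod_n u M w0))) +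
      (prod_n u M (prod_n v N w1) - ra_scale (sign2 (i * j)) (prod_n v N (prod_n u M w1)))"
    unfolding w01(1) by (simp only: ra_Y_linear ra.scale_right_distrib add_diff_add)
  also have "\<dots> = (\<Sum>t\<le>M. ra_scale (of_nat (M choose t)) (prod_n (prod_n u t v) (M + N - t) w))"
    unfolding Rplus_jacobi[OF uv' w01(2)] Rplus_jacobi[OF uv' w01(3)] w01(1)
    by (simp only: ra_Y_linear ra.scale_right_distrib sum.distrib)
  finally show ?thesis .
qed

lemma Rstar_conformal_superalgebra:
  "conformal_superalgebra ra_scale (Rstar :: ('f::field_char_0, 'm::finite, 'n::finite) ralg_graded) ra_D ra_Y"
proof
  show "module.subspace ra_scale (Rstar i :: ('f, 'm, 'n) ralg set)" for i
    by (rule Rstar_subspace)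
  show "Rstar 0 \<inter> Rstar 1 = ({0} :: ('f, 'm, 'n) ralg set)"
  proof
    show "Rstar 0 \<inter> Rstar 1 \<subseteq> ({0} :: ('f, 'm, 'n) ralg set)"
    proof
      fix x :: "('f, 'm, 'n) ralg" assume "x \<in> Rstar 0 \<inter> Rstar 1"
      then have x: "x \<in> RA 0" "x \<in> RA 1" using Rstar_subset_RA by blast+
      have m: "Poly_Mapping.lookup x (i, j, m, n) \<in> (if i + j = d then mtx_graded (i + j) else {0})"
        if "x \<in> RA d" for i j m n d
        using that unfolding RA_def mem_Collect_eq by (elim allE)
      have "Poly_Mapping.lookup x (i, j, m, n) = 0" for i j m n
      proof (cases "i + j = 0")
        case True
        then have "i + j \<noteq> 1" by (metis zero_neq_one)
        then show ?thesis using m[OF x(2), of i j m n] by (simp only: if_False singleton_iff)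
      next
        case False
        then show ?thesis using m[OF x(1), of i j m n] by (simp only: if_False singleton_iff)
      qed
      then have "x = 0" by (intro poly_mapping_eqI) (metis lookup_zero prod_cases4)
      then show "x \<in> {0}" by simp
    qed
  qed (simp add: ra.subspace_0[OF Rstar_subspace])
  show "ra_D u \<in> Rstar i" if "u \<in> Rstar i" for u :: "('f, 'm, 'n) ralg" and i
    using that by (rule ra_D_Rstar)
  show "ra_Y u v e \<in> Rstar (i + j)" if "u \<in> Rstar i" "v \<in> Rstar j" for u v :: "('f, 'm, 'n) ralg" and i j e
    using prod_n_Rstar[OF that] by (cases e rule: int_cases_pole) (simp_all add: ra_Y_nonneg ra.subspace_0[OF Rstar_subspace])
  show "finite {e. ra_Y u v e \<noteq> 0}" if uv: "u \<in> total Rstar" "v \<in> total Rstar" for u v :: "('f, 'm, 'n) ralg"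
  proof -
    obtain K where K: "\<And>l. K \<le> l \<Longrightarrow> prod_n u l v = 0"
      using prod_n_eventually_zero[OF subsetD[OF total_Rstar_subset uv(1)] subsetD[OF total_Rstar_subset uv(2)]]
      unfolding eventually_sequentially by blast
    have "{e. ra_Y u v e \<noteq> 0} \<subseteq> (\<lambda>l. - int l - 1) ` {..<K}"
    proof
      fix e assume e: "e \<in> {e. ra_Y u v e \<noteq> 0}"
      show "e \<in> (\<lambda>l. - int l - 1) ` {..<K}"
      proof (cases e rule: int_cases_pole)
        case 1
        then show ?thesis using e by (simp add: ra_Y_nonneg)
      next
        case (2 l)
        then have "l < K" using e K[of l] by (cases "K \<le> l") auto
        then show ?thesis using 2 by blast
      qed
    qed
    then show ?thesis by (rule finite_subset) simp
  qed
  show "ra_Y (ra_D u) v = series_deriv ra_scale (ra_Y u v)" if "u \<in> Rstar i" "v \<in> Rstar j"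
    for u v :: "('f, 'm, 'n) ralg" and i j
    using that ra_D_Rstar[OF that(1)] Rstar_subset_Rplus by (blast intro: Rplus_deriv)
  show "ra_Y u v e = ra_scale (sign2 (i * j))
      (res_geom ra_scale (exp_shift ra_scale ra_D (subst_neg ra_scale (ra_Y v u))) e)"
    if "u \<in> Rstar i" "v \<in> Rstar j" for u v :: "('f, 'm, 'n) ralg" and i j e
    using that Rstar_subset_Rplus by (blast intro: Rplus_skew)
  show "ra_Y u (ra_Y v w c) a - ra_scale (sign2 (i * j)) (ra_Y v (ra_Y u w a) c) =
      res_geom ra_scale (\<lambda>b. Sum_any (\<lambda>d. ra_Y (subst_diff ra_scale (ra_Y u v) a d) w (b - d))) c"
    if uv: "u \<in> Rstar i" "v \<in> Rstar j" and w: "w \<in> total Rstar" for u v w :: "('f, 'm, 'n) ralg" and i j a c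
  proof (cases c rule: int_cases_pole)
    case 1
    then show ?thesis by (simp add: res_geom_eq ra_Y_nonneg)
  next
    case (2 N)
    note c = 2
    show ?thesis
    proof (cases a rule: int_cases_pole)
      case 1
      have "ra_Y (subst_diff ra_scale (ra_Y u v) a d) w b = 0" for d b
        using 1 by (simp add: subst_diff_eq ra_Y_nonneg)
      then show ?thesis using 1 by (simp add: res_geom_eq ra_Y_nonneg)
    next
      case (2 M)
      note a = 2
      have neg: "- int N - 1 < 0" by simp
      show ?thesis
        unfolding a c res_geom_eq if_P[OF neg] jacobi_rhs by (rule Rstar_jacobi[OF uv w])
    qed
  qed
qed (simp_all add: ra_D_add ra_D_scale ra_Y_linear ra_Y_nonneg)

section \<open>Simplicity\<close>

text \<open>
  A large \<open>n\<close> annihilates the \<open>a = c\<close> summand of the action, and the remaining summand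
  is nonzero only for \<open>p \<ge> r\<close>.
\<close>

lemma act_elementary:
  fixes F :: "'m + 'n \<Rightarrow> nat \<Rightarrow> ('f::field_char_0, 'm::finite, 'n::finite) ralg"
  assumes "c = b \<longrightarrow> p \<le> r" "t + p + 1 < n"
  shows "act a t b n (n + r + dl b) c p F =
    (if c = b \<and> p = r then ra_scale ((- 1) ^ n * ct (dl b) n r) (F a t) else 0)"
proof -
  \<comment> \<open>The upper entry of the binomial coefficient is at most
    \<open>t + p + dl a\<close>, hence at most \<open>t + p + 1\<close>, which is below
    \<open>n\<close>.\<close>
  have 1: "lam (dl a) n t p (n + r + dl b) = (0 :: 'f)"
    using assms(2) by (auto simp: lam_def dl_def binomial_eq_0)
  have 2: "(if b = c then ra_scale (lam (dl b) t n p (n + r + dl b)) (F a (t + n + p + dl b - (n + r + dl b))) else 0) =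
    (if c = b \<and> p = r then ra_scale ((- 1) ^ n * ct (dl b) n r) (F a t) else 0)"
    using assms(1) by (auto simp: lam_def binomial_eq_0)
  show ?thesis unfolding act_def 1 2 by simp
qed

lemma ct_nonzero: "(ct d n r :: 'f::field_char_0) \<noteq> 0"
  by (simp add: ct_def)

section \<open>Coordinates with respect to \<open>E\<close>\<close>

definition coef :: "('f::field_char_0, 'm::finite, 'n::finite) ralg \<Rightarrow> ('m + 'n) \<times> nat \<times> ('m + 'n) \<times> nat \<Rightarrow> 'f"
  where "coef x = (\<lambda>(a, m, b, n). Poly_Mapping.lookup x (block a, block b, m, n) $ a $ b)"

lemma coef_simps:
  "coef (x + y) \<kappa> = coef x \<kappa> + coef y \<kappa>" "coef (ra_scale c x) \<kappa> = c * coef x \<kappa>" "coef 0 \<kappa> = 0"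
  by (simp_all add: coef_def lookup_add lookup_ra_scale mtx_scale_def split: prod.splits)

lemma coef_E: "coef (E a m b n) \<kappa> = (if \<kappa> = (a, m, b, n) then 1 else 0)"
  by (cases \<kappa>) (auto simp: coef_def E_def elt_def lookup_single mtx_unit_def when_def)

lemma finite_coef: "finite {\<kappa>. coef x \<kappa> \<noteq> 0}"
proof (rule finite_subset)
  show "{\<kappa>. coef x \<kappa> \<noteq> 0} \<subseteq> (\<lambda>(a, b, i, j, m, n). (a, m, b, n)) ` (UNIV \<times> UNIV \<times> Poly_Mapping.keys x)"
  proof
    fix \<kappa> assume "\<kappa> \<in> {\<kappa>. coef x \<kappa> \<noteq> 0}"
    moreover obtain a m b n where "\<kappa> = (a, m, b, n)" by (cases \<kappa>)
    ultimately show "\<kappa> \<in> (\<lambda>(a, b, i, j, m, n). (a, m, b, n)) ` (UNIV \<times> UNIV \<times> Poly_Mapping.keys x)"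
      by (intro image_eqI[where x = "(a, b, block a, block b, m, n)"]) (auto simp: coef_def in_keys_iff)
  qed
qed (simp add: finite_Prod_UNIV)

text \<open>\<open>A\<close> may exceed the support, so that in the induction a single index set
  serves both summands.\<close>

lemma E_expansion:
  assumes "x \<in> ra.span Eall" "finite A" "{\<kappa>. coef x \<kappa> \<noteq> 0} \<subseteq> A"
  shows "x = (\<Sum>(a, m, b, n)\<in>A. ra_scale (coef x (a, m, b, n)) (E a m b n))"
proof -
  have *: "(\<Sum>(a, m, b, n)\<in>A. ra_scale (coef x (a, m, b, n)) (E a m b n)) =
      (\<Sum>(a, m, b, n)\<in>B. ra_scale (coef x (a, m, b, n)) (E a m b n))"
    if "finite B" "A \<subseteq> B" "{\<kappa>. coef x \<kappa> \<noteq> 0} \<subseteq> A" for A B and x :: "('a, 'b, 'c) ralg"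
    by (rule sum.mono_neutral_left) (use that in auto)
  show ?thesis using assms
  proof (induction arbitrary: A rule: ra.span_induct_alt)
    case base
    then show ?case by (simp add: coef_simps)
  next
    case (step c x y)
    obtain a m b n where x: "x = E a m b n" using step unfolding Eall_def by blast
    define B where "B = insert (a, m, b, n) (A \<union> {\<kappa>. coef y \<kappa> \<noteq> 0})"
    have B: "finite B" "A \<subseteq> B" "{\<kappa>. coef y \<kappa> \<noteq> 0} \<subseteq> B" "(a, m, b, n) \<in> B"
      using step.prems finite_coef[of y] by (auto simp: B_def)
    have "(\<Sum>(a', m', b', n')\<in>B. ra_scale (coef x (a', m', b', n')) (E a' m' b' n')) =
        (\<Sum>\<kappa>\<in>B. if \<kappa> = (a, m, b, n) then E a m b n else 0)"
      by (rule sum.cong) (auto simp: x coef_E split: if_splits)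
    also have "\<dots> = x" using B by (simp add: x)
    finally have 1: "(\<Sum>(a, m, b, n)\<in>B. ra_scale (coef x (a, m, b, n)) (E a m b n)) = x" .
    have "ra_scale c x + y = (\<Sum>(a, m, b, n)\<in>B. ra_scale (coef (ra_scale c x + y) (a, m, b, n)) (E a m b n))"
      unfolding coef_simps ra.scale_left_distrib sum.distrib case_prod_unfold ra.scale_scale[symmetric] ra.scale_sum_right[symmetric]
      by (rule arg_cong2[of _ _ _ _ "(+)", OF arg_cong[OF 1[symmetric], unfolded case_prod_unfold]
            step.IH[OF B(1,3), unfolded case_prod_unfold]])
    then show ?case using *[OF B(1,2) step.prems(2)] by simp
  qed
qed

lemma coef_swap:
  assumes "x \<in> total Rstar"
  shows "coef x (b, n, a, m) = eps a b * coef x (a, m, b, n)"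
  using assms unfolding total_Rstar
proof (induction rule: ra.span_induct_alt)
  case (step c x y)
  have "coef x (b, n, a, m) = eps a b * coef x (a, m, b, n)"
  proof -
    obtain a' m' b' n' where x: "x = S a' m' b' n'" using step(1) by blast
    have c: "coef x (a, m, b, n) = of_bool ((a, m, b, n) = (a', m', b', n')) + eps a' b' * of_bool ((a, m, b, n) = (b', n', a', m'))"
      for a m b n
      unfolding x S_def coef_simps coef_E by (simp only: of_bool_def)
    have sw: "((b, n, a, m) = (a', m', b', n')) = ((a, m, b, n) = (b', n', a', m'))"
      "((b, n, a, m) = (b', n', a', m')) = ((a, m, b, n) = (a', m', b', n'))" by blast+
    consider "(a, m, b, n) = (a', m', b', n')" | "(a, m, b, n) = (b', n', a', m')"
      | "(a, m, b, n) \<noteq> (a', m', b', n')" "(a, m, b, n) \<noteq> (b', n', a', m')" by blast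
    then show ?thesis
    proof cases
      case 1
      then have e: "eps a b = (eps a' b' :: 'a)" by simp
      show ?thesis unfolding c sw e using 1 by (simp add: distrib_left)
    next
      case 2
      then have e: "eps a b = (eps a' b' :: 'a)" by (simp add: eps_commute)
      show ?thesis unfolding c sw e using 2 by (simp add: distrib_left)
    next
      case 3
      then show ?thesis unfolding c sw by (simp only: of_bool_def if_False mult_zero_right add_0_left)
    qed
  qed
  then show ?case using step by (simp add: coef_simps algebra_simps)
qed (simp add: coef_simps)

lemma support_swap:
  assumes "x \<in> total Rstar" "coef x (a, m, b, n) \<noteq> 0"
  shows "coef x (b, n, a, m) \<noteq> 0"
  using coef_swap[OF assms(1), of b n a m] assms(2) by (simp add: eps_def)

text \<open>The factor 2 arises because each pair of indices is counted in both orders; this avoids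
  choosing representatives of the unordered pairs.\<close>

lemma S_expansion:
  fixes x :: "('f::field_char_0, 'm::finite, 'n::finite) ralg"
  assumes "x \<in> total Rstar"
  shows "ra_scale 2 x = (\<Sum>(a, m, b, n)\<in>{\<kappa>. coef x \<kappa> \<noteq> 0}. ra_scale (coef x (a, m, b, n)) (S a m b n))"
proof -
  define A where "A = {\<kappa>. coef x \<kappa> \<noteq> 0}"
  have sym: "(b, n, a, m) \<in> A \<longleftrightarrow> (a, m, b, n) \<in> A" for a m b n
    using support_swap[OF assms] by (auto simp: A_def)
  have x: "x = (\<Sum>(a, m, b, n)\<in>A. ra_scale (coef x (a, m, b, n)) (E a m b n))"
    by (rule E_expansion) (use assms total_Rstar_subset finite_coef in \<open>auto simp: A_def\<close>)
  have sw: "coef x (a, m, b, n) * eps a b = coef x (b, n, a, m)" for a m b n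
    using coef_swap[OF assms, of b n a m] by simp
  have "(\<Sum>(a, m, b, n)\<in>A. ra_scale (coef x (a, m, b, n) * eps a b) (E b n a m)) =
      (\<Sum>(a, m, b, n)\<in>A. ra_scale (coef x (a, m, b, n)) (E a m b n))"
    by (rule sum.reindex_bij_witness[where i = "\<lambda>(a, m, b, n). (b, n, a, m)" and j = "\<lambda>(a, m, b, n). (b, n, a, m)"])
      (auto simp: sym sw)
  then have "(\<Sum>(a, m, b, n)\<in>A. ra_scale (coef x (a, m, b, n)) (S a m b n)) = x + x"
    unfolding S_def case_prod_unfold ra.scale_right_distrib ra.scale_scale sum.distrib
    by (simp only: x[unfolded case_prod_unfold, symmetric])
  moreover have "ra_scale 2 x = x + x"
    using ra.scale_left_distrib[of 1 1 x] by simp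
  ultimately show ?thesis
    unfolding A_def by (simp only:)
qed

definition elementary_factor :: "'m + 'n \<Rightarrow> nat \<Rightarrow> nat \<Rightarrow> 'f::field_char_0"
  where "elementary_factor b n r = (- 1) ^ n * ct (dl b) n r"

lemma elementary_factor_nonzero: "(elementary_factor b n r :: 'f::field_char_0) \<noteq> 0"
  by (simp add: elementary_factor_def ct_nonzero)

lemma prod_S_elementary:
  fixes a b c d :: "'m::finite + 'n::finite"
  assumes "c = b \<longrightarrow> p \<le> r" "d = b \<longrightarrow> q \<le> r" "t + p + 1 < n" "t + q + 1 < n"
  shows "prod_n (S a t b n) (n + r + dl b) (S c p d q :: ('f::field_char_0, 'm, 'n) ralg) =
    ra_scale (elementary_factor b n r) ((if c = b \<and> p = r then S a t d q else 0) +
      (if d = b \<and> q = r then ra_scale (eps c b) (S a t c p) else 0))"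
proof -
  \<comment> \<open>(-1)^((|a|+|b|)|c|) (-1)^(|a||c|) = (-1)^(|b||c|): the Koszul sign and the sign
    of reordering merge.\<close>
  have e: "sign2 ((block a + block b) * block c) * eps a c = (eps c b :: 'f)"
    by (cases a; cases b; cases c) (simp_all add: eps_def sign2_def)
  have 1: "ra_scale (sign2 ((block a + block b) * block c)) (S c p a t) =
      (ra_scale (eps c b) (S a t c p) :: ('f, 'm, 'n) ralg)"
    unfolding S_swap[of c p a t] ra.scale_scale e ..
  have 2: "ra_scale (sign2 ((block a + block b) * block c)) (ra_scale k (S c p a t)) =
      (ra_scale k (ra_scale (eps c b) (S a t c p)) :: ('f, 'm, 'n) ralg)" for k
    unfolding 1[symmetric] ra.scale_scale by (simp only: mult.commute)
  show ?thesis
    unfolding prod_S act_elementary[OF assms(1,3)] act_elementary[OF assms(2,4)] elementary_factor_def[symmetric]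
      ra_scale_if ra.scale_right_distrib 2 ra.scale_zero_right ..
qed

lemma exists_other_index: "\<exists>a :: 'm + 'n. a \<noteq> b"
  by (cases b) auto

text \<open>Maximal indices let the contractions isolate a single term of \<open>x\<close>. What
  results is every \<open>S a' t' a t\<close> with \<open>a\<close> different from one fixed
  \<open>b'\<close>; the pairs with both indices equal to \<open>b'\<close> need one further
  product.\<close>

lemma ideal_eq_total:
  fixes I :: "('f::field_char_0, 'm::finite, 'n::finite) ralg set"
  assumes I: "ra.subspace I" "I \<subseteq> total Rstar"
    and prod: "\<And>u v l. u \<in> total Rstar \<Longrightarrow> v \<in> I \<Longrightarrow> prod_n u l v \<in> I"
    and x: "x \<in> I" "x \<noteq> 0"
  shows "total Rstar \<subseteq> I"
proof -
  have cancel: "y \<in> I" if "ra_scale c y \<in> I" "c \<noteq> 0" for c y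
    using ra.subspace_scale[OF I(1) that(1), of "inverse c"] that(2) by simp
  have tot: "S a m b n \<in> total Rstar" for a m b n
    unfolding total_Rstar by (rule ra.span_base) blast
  define A where "A = {\<kappa>. coef x \<kappa> \<noteq> 0}"
  have xt: "x \<in> total Rstar" using x I by blast
  have fin: "finite A" unfolding A_def by (rule finite_coef)
  have sym: "(b, n, a, m) \<in> A \<longleftrightarrow> (a, m, b, n) \<in> A" for a m b n
    using support_swap[OF xt] by (auto simp: A_def)
  have exp: "ra_scale 2 x = (\<Sum>(a, m, b, n)\<in>A. ra_scale (coef x (a, m, b, n)) (S a m b n))"
    unfolding A_def by (rule S_expansion[OF xt])
  have "A \<noteq> {}"
  proof
    assume "A = {}"
    then have "ra_scale 2 x = 0" using exp by simp
    then show False using x by simp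
  qed
  obtain P where P: "\<And>c p d q. (c, p, d, q) \<in> A \<Longrightarrow> p \<le> P \<and> q \<le> P"
  proof
    fix c p d q assume "(c, p, d, q) \<in> A"
    then have "(\<lambda>(c, p, d, q). p + q) (c, p, d, q) \<le> Max ((\<lambda>(c, p, d, q). p + q) ` A)"
      using fin by (intro Max_ge) (blast intro: finite_imageI)+
    then show "p \<le> Max ((\<lambda>(c, p, d, q). p + q) ` A) \<and> q \<le> Max ((\<lambda>(c, p, d, q). p + q) ` A)"
      by simp
  qed
  \<comment> \<open>\<open>r\<close> must be maximal at \<open>b\<close> over the whole support,
    whereas \<open>r'\<close> need only be maximal among the partners of \<open>(b, r)\<close>,
    because only these survive the first map.\<close>
  obtain b r0 d0 q0 where "(b, r0, d0, q0) \<in> A" using \<open>A \<noteq> {}\<close> by (metis ex_in_conv prod_cases4)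
  then have 1: "\<exists>d q. (b, r0, d, q) \<in> A" by blast
  have "\<forall>p. (\<exists>d q. (b, p, d, q) \<in> A) \<longrightarrow> p \<le> P" using P by blast
  from Nat.ex_has_greatest_nat[where P = "\<lambda>p. \<exists>d q. (b, p, d, q) \<in> A", OF 1 this]
  obtain r where "\<exists>d q. (b, r, d, q) \<in> A" and r: "\<And>p d q. (b, p, d, q) \<in> A \<Longrightarrow> p \<le> r" by blast
  then obtain b' q1 where 2: "(b, r, b', q1) \<in> A" by blast
  have "\<forall>q. (b, r, b', q) \<in> A \<longrightarrow> q \<le> P" using P by blast
  from Nat.ex_has_greatest_nat[where P = "\<lambda>q. (b, r, b', q) \<in> A", OF 2 this]
  obtain r' where r'A: "(b, r, b', r') \<in> A" and r': "\<forall>q. (b, r, b', q) \<in> A \<longrightarrow> q \<le> r'"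
    by (elim exE conjE)
  \<comment> \<open>The first map contracts \<open>x\<close> against the top index \<open>r\<close> in \<open>b\<close>; the second one leaves the new factor
    \<open>\<phi>\<^sub>a(t)\<close> alone because \<open>a \<noteq> b'\<close>.\<close>
  have S1: "S a' t' a t \<in> I" if a: "a \<noteq> b'" for a t a' t'
  proof -
    define n where "n = t + P + 2"
    have "ra_scale 2 (prod_n (S a t b n) (n + r + dl b) x) =
        (\<Sum>(c, p, d, q)\<in>A. ra_scale (coef x (c, p, d, q)) (prod_n (S a t b n) (n + r + dl b) (S c p d q)))"
      unfolding ra_Y_linear(4)[symmetric] exp unfolding ra_Y_linear case_prod_unfold ..
    also have "\<dots> = (\<Sum>(c, p, d, q)\<in>A. ra_scale (elementary_factor b n r)
        ((if c = b \<and> p = r then ra_scale (coef x (c, p, d, q)) (S a t d q) else 0) +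
         (if d = b \<and> q = r then ra_scale (coef x (d, q, c, p)) (S a t c p) else 0)))"
    proof (rule sum.cong[OF refl], clarify)
      fix c p d q assume A: "(c, p, d, q) \<in> A"
      have "p \<le> P" "q \<le> P" using P[OF A] by auto
      moreover have "c = b \<longrightarrow> p \<le> r" "d = b \<longrightarrow> q \<le> r" using r A sym by blast+
      ultimately show "ra_scale (coef x (c, p, d, q)) (prod_n (S a t b n) (n + r + dl b) (S c p d q)) =
        ra_scale (elementary_factor b n r)
        ((if c = b \<and> p = r then ra_scale (coef x (c, p, d, q)) (S a t d q) else 0) +
         (if d = b \<and> q = r then ra_scale (coef x (d, q, c, p)) (S a t c p) else 0))"
        using coef_swap[OF xt, of d q c p]
        by (subst prod_S_elementary) (auto simp: n_def ra.scale_right_distrib mult.commute mult.left_commute)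
    qed
    also have "\<dots> = ra_scale (elementary_factor b n r)
        ((\<Sum>(c, p, d, q)\<in>A. if c = b \<and> p = r then ra_scale (coef x (c, p, d, q)) (S a t d q) else 0) +
         (\<Sum>(c, p, d, q)\<in>A. if d = b \<and> q = r then ra_scale (coef x (d, q, c, p)) (S a t c p) else 0))"
      unfolding case_prod_unfold ra.scale_sum_right[symmetric] sum.distrib ..
    \<comment> \<open>The support is symmetric, so contraction in either slot gives the same sum;
      the factor 2 of \<open>S_expansion\<close> reappears and cancels.\<close>
    also have "(\<Sum>(c, p, d, q)\<in>A. if d = b \<and> q = r then ra_scale (coef x (d, q, c, p)) (S a t c p) else 0) =
        (\<Sum>(c, p, d, q)\<in>A. if c = b \<and> p = r then ra_scale (coef x (c, p, d, q)) (S a t d q) else 0)"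
      by (rule sum.reindex_bij_witness[where i = "\<lambda>(a, m, b, n). (b, n, a, m)" and j = "\<lambda>(a, m, b, n). (b, n, a, m)"])
        (auto simp: sym)
    finally have e1: "ra_scale 2 (prod_n (S a t b n) (n + r + dl b) x) = ra_scale (elementary_factor b n r) (ra_scale 2
       (\<Sum>(c, p, d, q)\<in>A. if c = b \<and> p = r then ra_scale (coef x (c, p, d, q)) (S a t d q) else 0))"
      (is "_ = ra_scale _ (ra_scale _ ?y)")
      unfolding one_add_one[symmetric] ra.scale_left_distrib ra.scale_one .
    have "ra_scale 2 (prod_n (S a t b n) (n + r + dl b) x) \<in> I"
      by (rule ra.subspace_scale[OF I(1) prod[OF tot x(1)]])
    then have y2: "ra_scale (elementary_factor b n r) (ra_scale 2 ?y) \<in> I" by (simp only: e1)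
    have y: "?y \<in> I" by (rule cancel[OF cancel[OF y2 elementary_factor_nonzero]]) simp
    \<comment> \<open>\<open>n'\<close> has to exceed \<open>t' + q + 1\<close> for the surviving
      old indices \<open>q \<le> P\<close> and also \<open>t' + t + 1\<close> for the index
      \<open>t\<close> that has just been introduced.\<close>
    define n' where "n' = t' + t + P + 2"
    have "prod_n (S a' t' b' n') (n' + r' + dl b') ?y =
      (\<Sum>(c, p, d, q)\<in>A. if c = b \<and> p = r then ra_scale (coef x (c, p, d, q)) (prod_n (S a' t' b' n') (n' + r' + dl b') (S a t d q)) else 0)"
      unfolding ra_Y_linear case_prod_unfold by (rule sum.cong) (auto simp: ra_Y_linear)
    also have "\<dots> = (\<Sum>\<kappa>\<in>A. if \<kappa> = (b, r, b', r') then ra_scale (coef x (b, r, b', r')) (ra_scale (elementary_factor b' n' r') (ra_scale (eps a b') (S a' t' a t))) else 0)"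
    proof (rule sum.cong[OF refl], clarify)
      fix c p d q assume A: "(c, p, d, q) \<in> A"
      show "(if c = b \<and> p = r then ra_scale (coef x (c, p, d, q)) (prod_n (S a' t' b' n') (n' + r' + dl b') (S a t d q)) else 0) =
        (if (c, p, d, q) = (b, r, b', r') then ra_scale (coef x (b, r, b', r')) (ra_scale (elementary_factor b' n' r') (ra_scale (eps a b') (S a' t' a t))) else 0)"
      proof (cases "c = b \<and> p = r")
        case True
        then have "d = b' \<longrightarrow> q \<le> r'" "q \<le> P" using A r' P[OF A] by auto
        with True a show ?thesis
          by (subst prod_S_elementary) (auto simp: n'_def)
      qed auto
    qed
    also have "\<dots> = ra_scale (coef x (b, r, b', r')) (ra_scale (elementary_factor b' n' r') (ra_scale (eps a b') (S a' t' a t)))"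
      using fin r'A by simp
    finally have e2: "prod_n (S a' t' b' n') (n' + r' + dl b') ?y = \<dots>" .
    have nz: "coef x (b, r, b', r') \<noteq> 0" "(eps a b' :: 'f) \<noteq> 0" using r'A by (auto simp: A_def eps_def)
    show ?thesis
      by (rule cancel[OF cancel[OF cancel[OF prod[OF tot y, of a' t' b' n' "n' + r' + dl b'", unfolded e2]]]])
        (simp_all add: nz elementary_factor_nonzero)
  qed
  have S2: "S a t a' t' \<in> I" if "a \<noteq> b'" for a t a' t'
    using ra.subspace_scale[OF I(1) S1[OF that, of a' t' t], of "eps a' a"]
    unfolding S_swap[of a' t' a t, symmetric] by (simp add: S_swap[of a t a' t'] eps_commute)
  \<comment> \<open>An auxiliary index \<open>a\<close> different from \<open>b'\<close> is
    contracted away, leaving \<open>b'\<close> in both slots.\<close>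
  have S3: "S b' s b' s' \<in> I" for s s'
  proof -
    obtain a where a: "a \<noteq> b'" using exists_other_index by blast
    define n where "n = s + s' + 2"
    have "prod_n (S b' s a n) (n + 0 + dl a) (S a 0 b' s') \<in> I"
      by (rule prod[OF tot S2[OF a]])
    also have "prod_n (S b' s a n) (n + 0 + dl a) (S a 0 b' s' :: ('f, 'm, 'n) ralg) = ra_scale (elementary_factor a n 0) (S b' s b' s')"
      using a by (subst prod_S_elementary) (auto simp: n_def)
    finally show ?thesis by (rule cancel) (rule elementary_factor_nonzero)
  qed
  have "S a m c n \<in> I" for a m c n
    using S1[of c a m n] S2[of a m c n] S3[of m n] by blast
  then show ?thesis
    unfolding total_Rstar using I(1) by (intro ra.span_minimal) auto
qed

lemma Rstar_simple:
  "simple_conformal_superalgebra ra_scale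
    (Rstar :: ('f::field_char_0, 'm::finite, 'n::finite) ralg_graded) ra_D ra_Y"
  unfolding simple_conformal_superalgebra_def
proof (intro conjI allI impI Rstar_conformal_superalgebra)
  fix I :: "('f, 'm, 'n) ralg set"
  assume "conformal_ideal ra_scale Rstar ra_D ra_Y I"
  then have I: "ra.subspace I" "I \<subseteq> total Rstar"
    and prod: "\<And>u v e. u \<in> total Rstar \<Longrightarrow> v \<in> I \<Longrightarrow> ra_Y u v e \<in> I"
    unfolding conformal_ideal_def by blast+
  show "I = {0} \<or> I = total Rstar"
  proof (cases "I \<subseteq> {0}")
    case True
    then show ?thesis using ra.subspace_0[OF I(1)] by blast
  next
    case False
    then obtain x where "x \<in> I" "x \<noteq> 0" by blast
    then have "total Rstar \<subseteq> I" using ideal_eq_total[OF I prod] by blast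
    then show ?thesis using I(2) by blast
  qed
qed

section \<open>Generators\<close>

lemma subspace_cancel:
  assumes "ra.subspace V" "ra_scale c y \<in> V" "c \<noteq> 0"
  shows "y \<in> V"
  using ra.subspace_scale[OF assms(1,2), of "inverse c"] assms(3) by simp

text \<open>The graded family \<open>M\<close> is kept abstract because it will consist of the
  elements whose products preserve the span of the words, for which closure under products is known
  parity by parity.\<close>

lemma S_in_generated:
  fixes M :: "('f::field_char_0, 'm::finite, 'n::finite) ralg_graded"
  assumes sub: "\<And>i. ra.subspace (M i)"
    and prod: "\<And>i j u v l. u \<in> M i \<Longrightarrow> v \<in> M j \<Longrightarrow> prod_n u l v \<in> M (i + j)"
    and odd: "\<And>p q. S (Inl p) 0 (Inr q) 0 \<in> M 1"
    and gen: "CARD('m) + CARD('n) > 2 \<or> (\<forall>q. S (Inr q) 1 (Inr q) 0 \<in> M 0)"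
  shows "S a m b n \<in> M (block a + block b)"
proof -
  note even = prod[of _ 1 _ 1, simplified] and even0 = prod[of _ 0 _ 0, simplified]
    and keep_odd = prod[of _ 0 _ 1, simplified]
  note add_diff_M = ra.subspace_add[OF sub] ra.subspace_diff[OF sub]
  note products = act_def lam_def ct_def dl_def eps_def sign2_def
  \<comment> \<open>\<open>undefined\<close> stands for an arbitrary index of the other block; it is
    shared by both factors and contracted.\<close>
  have Inl_Inl: "S (Inl p') 0 (Inl p) 0 \<in> M 0" if "p \<noteq> p'" for p p' :: 'm
    using even[OF odd[of p undefined] odd[of p' undefined], of 0] that unfolding prod_S by (simp add: products)
  have Inr_Inr: "S (Inr q) 1 (Inr q') 0 \<in> M 0" if "q \<noteq> q'" for q q' :: 'n
    using even[OF odd[of undefined q] odd[of undefined q'], of 0] that unfolding prod_S by (simp add: products)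
  \<comment> \<open>Both pairs of equal indices are contracted. The boson contraction has a double
    pole, so a derivative survives in the zeroth product; \<open>S (Inr q) 0 (Inr q) 0\<close>
    itself vanishes because \<open>eps\<close> is -1 there.\<close>
  have diag: "S (Inr q) 1 (Inr q) 0 + S (Inl p) 0 (Inl p) 0 \<in> M 0" for p :: 'm and q :: 'n
    using even[OF odd[of p q] odd[of p q], of 0] unfolding prod_S by (simp add: products)
  \<comment> \<open>\<open>diag\<close> yields the differences of the diagonal elements of one block, and these two facts their
    sums; a second index in one of the blocks thus separates the summands of \<open>diag\<close>.\<close>
  have Inl_diag_sum: "S (Inl p) 0 (Inl p) 0 + S (Inl p') 0 (Inl p') 0 \<in> M 0" if "p \<noteq> p'" for p p' :: 'm
    using even0[OF Inl_Inl[OF that[symmetric]] Inl_Inl[OF that], of 1] that unfolding prod_S by (simp add: products)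
  have Inr_diag_sum: "S (Inr q) 1 (Inr q) 0 + S (Inr q') 1 (Inr q') 0 \<in> M 0" if "q \<noteq> q'" for q q' :: 'n
    using even0[OF Inr_Inr[OF that] Inr_Inr[OF that[symmetric]], of 1] that unfolding prod_S by (simp add: products)
  have half: "x \<in> M 0" if "x + y \<in> M 0" "x - y \<in> M 0" for x y
    using add_diff_M(1)[OF that] ra.scale_left_distrib[of 1 1 x]
    by (intro subspace_cancel[OF sub[of 0], of 2 x]) simp_all
  have "(\<forall>p. S (Inl p) 0 (Inl p) 0 \<in> M 0) \<or> (\<forall>q. S (Inr q) 1 (Inr q) 0 \<in> M 0)"
  proof (cases "\<forall>q. S (Inr q) 1 (Inr q) 0 \<in> M 0")
    case False
    then have "CARD('m) + CARD('n) > 2" using gen by blast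
    then have "CARD('m) \<ge> 2 \<or> CARD('n) \<ge> 2" by linarith
    then show ?thesis
    proof
      assume c: "CARD('m) \<ge> 2"
      have "S (Inl p) 0 (Inl p) 0 \<in> M 0" for p
      proof -
        have "UNIV \<noteq> {p}"
        proof
          assume "UNIV = {p}"
          from arg_cong[OF this, of card] c show False by simp
        qed
        then obtain p' where "p \<noteq> p'" by fast
        then show ?thesis
          using half[OF Inl_diag_sum] add_diff_M(2)[OF diag[of undefined p] diag[of undefined p']] by simp
      qed
      then show ?thesis by blast
    next
      assume c: "CARD('n) \<ge> 2"
      have "S (Inr q) 1 (Inr q) 0 \<in> M 0" for q
      proof -
        have "UNIV \<noteq> {q}"
        proof
          assume "UNIV = {q}"
          from arg_cong[OF this, of card] c show False by simp
        qed
        then obtain q' where "q \<noteq> q'" by fast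
        then show ?thesis
          using half[OF Inr_diag_sum] add_diff_M(2)[OF diag[of q undefined] diag[of q' undefined]] by simp
      qed
      then show ?thesis by blast
    qed
  qed blast
  then have diag_l: "S (Inl p) 0 (Inl p) 0 \<in> M 0" and diag_r: "S (Inr q) 1 (Inr q) 0 \<in> M 0" for p q
    using add_diff_M(2)[OF diag[of q p]] by (metis add_diff_cancel_left' add_diff_cancel_right')+
  \<comment> \<open>Up to a factor, \<open>S (Inl p) 0 (Inl p) 0\<close> is the conformal vector of
    one boson: its zeroth product acts on the index \<open>(Inl p, m)\<close> as twice the
    derivation. The fermionic counterpart is used for \<open>odd_lr\<close>.\<close>
  have odd_l: "S (Inl p) m (Inr q) 0 \<in> M 1" for p q m
  proof (induction m)
    case (Suc m)
    have e: "prod_n (S (Inl p) 0 (Inl p) 0) 0 (S (Inl p) m (Inr q) 0) =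
        (ra_scale (2 * of_nat (Suc m)) (S (Inl p) (Suc m) (Inr q) 0) :: ('f, 'm, 'n) ralg)"
      unfolding prod_S by (simp add: products flip: ra.scale_left_distrib)
    show ?case
      by (rule subspace_cancel[OF sub keep_odd[OF diag_l[of p] Suc.IH, of 0, unfolded e]]) (simp del: of_nat_Suc)
  qed (rule odd)
  have odd_lr: "S (Inl p) m (Inr q) n \<in> M 1" for p q m n
  proof (induction n)
    case (Suc n)
    have e: "prod_n (S (Inr q) 1 (Inr q) 0) 0 (S (Inl p) m (Inr q) n) =
        (ra_scale (2 * of_nat (Suc n)) (S (Inl p) m (Inr q) (Suc n)) :: ('f, 'm, 'n) ralg)"
      unfolding prod_S by (simp add: products flip: ra.scale_left_distrib)
    show ?case
      by (rule subspace_cancel[OF sub keep_odd[OF diag_r[of q] Suc.IH, of 0, unfolded e]]) (simp del: of_nat_Suc)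
  qed (rule odd_l)
  have odd_rl: "S (Inr q) n (Inl p) m \<in> M 1" for p q m n
    unfolding S_swap[of "Inr q" n "Inl p" m] by (rule ra.subspace_scale[OF sub odd_lr])
  have S_odd: "S a m b n \<in> M 1" if "block a \<noteq> block b" for a b m n
    using that odd_lr odd_rl by (cases a; cases b) simp_all
  show ?thesis
  proof (cases "block a = block b")
    case False
    moreover from this have "block a + block b = 1" by (cases a; cases b) simp_all
    ultimately show ?thesis using S_odd by simp
  next
    case True
    \<comment> \<open>With \<open>c\<close> in the opposite block both factors are odd, and
      \<open>c \<noteq> b\<close> keeps the index \<open>(b, n)\<close> untouched.\<close>
    obtain c :: "'m + 'n" where c: "block c \<noteq> block a" by (metis block_simps zero_neq_one)
    have bc: "c \<noteq> b" using c True by auto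
    define k where "k = m + n + 2"
    have "prod_n (S a m c k) (k + 0 + dl c) (S c 0 b n) \<in> M 0"
      using c True by (intro even S_odd) auto
    also have "prod_n (S a m c k) (k + 0 + dl c) (S c 0 b n) = (ra_scale (elementary_factor c k 0) (S a m b n) :: ('f, 'm, 'n) ralg)"
      using bc by (subst prod_S_elementary) (auto simp: k_def)
    finally have "S a m b n \<in> M 0" by (rule subspace_cancel[OF sub _ elementary_factor_nonzero])
    moreover have "block a + block b = 0" using True by (cases a; cases b) simp_all
    ultimately show ?thesis by simp
  qed
qed

section \<open>Words in the generators\<close>

lemma prod_n_total:
  assumes "u \<in> total Rstar" "v \<in> total Rstar"
  shows "prod_n u l v \<in> total Rstar"
  unfolding total_Rstar
proof (rule bilinear_in_span[OF _ _ _ assms[unfolded total_Rstar]])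
  fix u v :: "('a, 'b, 'c) ralg" assume "u \<in> {S a m b n | a m b n. True}" "v \<in> {S a m b n | a m b n. True}"
  then obtain i j where "u \<in> Rstar i" "v \<in> Rstar j" using S_in_Rstar by blast
  then show "prod_n u l v \<in> ra.span {S a m b n | a m b n. True}"
    unfolding total_Rstar[symmetric] using prod_n_Rstar Rstar_subset_total by blast
qed (simp_all add: lin_simps)

text \<open>The elements of the span \<open>T\<close> of the words whose products all map
  \<open>T\<close> into itself include \<open>G\<close>; the Jacobi identity makes them closed under
  products, so \<open>S_in_generated\<close> applies to them.\<close>

lemma generated_byI:
  fixes G :: "('f::field_char_0, 'm::finite, 'n::finite) ralg set"
  assumes G: "G \<subseteq> Rstar 0 \<union> Rstar 1"
    and odd: "\<And>p q. S (Inl p) 0 (Inr q) 0 \<in> G"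
    and gen: "CARD('m) + CARD('n) > 2 \<or> (\<forall>q. S (Inr q) 0 (Inr q) 1 \<in> G)"
  shows "generated_by ra_scale Rstar ra_Y G"
proof -
  define F where "F = {foldr (\<lambda>(u, m) w. nth_product ra_Y u m w) us v | us v. fst ` set us \<subseteq> G \<and> v \<in> G}"
  define T where "T = ra.span F"
  \<comment> \<open>Intersecting with \<open>Rstar i\<close> keeps elements homogeneous, as the
    Jacobi identity requires of u and v.\<close>
  define M where "M i = {u \<in> Rstar i \<inter> T. \<forall>m. \<forall>w\<in>T. prod_n u m w \<in> T}" for i
  have Gt: "G \<subseteq> total Rstar" using G Rstar_subset_total by blast
  have "foldr (\<lambda>(u, m) w. nth_product ra_Y u m w) us v \<in> total Rstar" if "fst ` set us \<subseteq> G" "v \<in> G" for us v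
    using that Gt by (induction us) (auto simp: nth_product_def intro!: prod_n_total)
  then have T_total: "T \<subseteq> total Rstar"
    unfolding T_def F_def by (intro ra.span_minimal total_Rstar_subspace) blast
  have T: "ra.subspace T" unfolding T_def by (rule ra.subspace_span)
  have GF: "u \<in> F" if "u \<in> G" for u
    unfolding F_def mem_Collect_eq by (rule exI[of _ "[]"], rule exI[of _ u]) (simp add: that)
  have prodF: "prod_n u m w \<in> F" if u: "u \<in> G" and "w \<in> F" for u m w
  proof -
    obtain us v where "w = foldr (\<lambda>(u, m) w. nth_product ra_Y u m w) us v" "fst ` set us \<subseteq> G" "v \<in> G"
      using \<open>w \<in> F\<close> unfolding F_def by blast
    then show ?thesis unfolding F_def mem_Collect_eq
      by (intro exI[of _ "(u, m) # us"] exI[of _ v]) (simp add: nth_product_def[of ra_Y, symmetric] u)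
  qed
  have GM: "u \<in> M i" if "u \<in> G" "u \<in> Rstar i" for u i
  proof -
    have "prod_n u m w \<in> T" if "w \<in> T" for m w
      using that unfolding T_def
    proof (induction rule: ra.span_induct_alt)
      case (step c x y)
      show ?case
        unfolding ra_Y_linear by (rule ra.span_add[OF ra.span_scale[OF ra.span_base[OF prodF[OF \<open>u \<in> G\<close> step(1)]]] step.IH])
    qed (simp add: ra.span_zero)
    then show ?thesis using that GF by (simp add: M_def T_def ra.span_base)
  qed
  have sub: "ra.subspace (M i)" for i
    unfolding M_def
    by (rule ra.subspaceI)
      (auto simp: ra_Y_linear intro: ra.subspace_0[OF T] ra.subspace_0[OF Rstar_subspace] ra.subspace_add[OF T]
        ra.subspace_scale[OF T] ra.subspace_add[OF Rstar_subspace] ra.subspace_scale[OF Rstar_subspace])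
  \<comment> \<open>In the Jacobi identity all terms but the last, \<open>(u\<^sub>l v)\<^sub>L w\<close>, are already known to lie in \<open>T\<close>.\<close>
  have prod: "prod_n u l v \<in> M (i + j)" if u: "u \<in> M i" and v: "v \<in> M j" for u v l i j
  proof -
    \<comment> \<open>The terms with \<open>t < l\<close> have product index
      \<open>l + L - t\<close>, so the induction hypothesis must cover all \<open>L\<close>. The
      last term has coefficient 1.\<close>
    have "prod_n (prod_n u l v) L w \<in> T" if w: "w \<in> T" for L w
    proof (induction l arbitrary: L rule: less_induct)
      case (less l)
      let ?g = "\<lambda>t. ra_scale (of_nat (l choose t)) (prod_n (prod_n u t v) (l + L - t) w)"
      have uv: "u \<in> Rstar i" "v \<in> Rstar j" using u v by (auto simp: M_def)
      have "prod_n u l (prod_n v L w) - ra_scale (sign2 (i * j)) (prod_n v L (prod_n u l w)) \<in> T"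
        using u v w by (intro ra.subspace_diff[OF T] ra.subspace_scale[OF T]) (auto simp: M_def)
      then have "(\<Sum>t\<le>l. ?g t) \<in> T"
        unfolding Rstar_jacobi[OF uv subsetD[OF T_total w]] .
      moreover have "(\<Sum>t<l. ?g t) \<in> T"
        by (intro ra.subspace_sum[OF T] ra.subspace_scale[OF T] less.IH) simp
      ultimately have "(\<Sum>t\<le>l. ?g t) - (\<Sum>t<l. ?g t) \<in> T" by (rule ra.subspace_diff[OF T])
      then show ?case by (simp add: lessThan_Suc_atMost[symmetric])
    qed
    then show ?thesis using u v prod_n_Rstar[of u i v j l] by (auto simp: M_def)
  qed
  have "S (Inl p) 0 (Inr q) 0 \<in> M 1" for p q
    by (rule GM[OF odd]) (rule S_in_Rstar, simp)
  moreover have "S (Inr q) 1 (Inr q) 0 \<in> M 0" if "S (Inr q) 0 (Inr q) 1 \<in> G" for q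
    unfolding S_swap[of "Inr q" 1 "Inr q" 0]
    by (rule ra.subspace_scale[OF sub GM[OF that]]) (rule S_in_Rstar, simp)
  then have "CARD('m) + CARD('n) > 2 \<or> (\<forall>q. S (Inr q) 1 (Inr q) 0 \<in> M 0)"
    using gen by blast
  ultimately have "S a m b n \<in> T" for a b m n
    using S_in_generated[of M, OF sub prod] unfolding M_def by blast
  then have "total Rstar \<subseteq> T"
    unfolding total_Rstar by (intro ra.span_minimal T) blast
  then show ?thesis
    using T_total Gt unfolding generated_by_def T_def F_def by blast
qed

section \<open>The weight 3/2 space and the conclusion\<close>

lemma weight_space_subspace: "ra.subspace (weight_space Rstar w)"
  unfolding weight_space_def
proof (rule ra.subspaceI; unfold mem_Collect_eq)
  fix x y :: "('a, 'b, 'c) ralg" and c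
  assume x: "x \<in> total Rstar \<and> (\<forall>\<kappa>\<in>Poly_Mapping.keys x. weight \<kappa> = w)"
  show "ra_scale c x \<in> total Rstar \<and> (\<forall>\<kappa>\<in>Poly_Mapping.keys (ra_scale c x). weight \<kappa> = w)"
    using x mu.keys_ra_scale_subset[of c x] ra.subspace_scale[OF total_Rstar_subspace] by blast
  assume y: "y \<in> total Rstar \<and> (\<forall>\<kappa>\<in>Poly_Mapping.keys y. weight \<kappa> = w)"
  show "x + y \<in> total Rstar \<and> (\<forall>\<kappa>\<in>Poly_Mapping.keys (x + y). weight \<kappa> = w)"
    using x y Poly_Mapping.keys_add[of x y] ra.subspace_add[OF total_Rstar_subspace] by blast
qed (simp add: ra.subspace_0[OF total_Rstar_subspace])

lemma weight_space_three_halves: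
  "weight_space Rstar (3 / 2) =
    ra.span {S (Inl p) 0 (Inr q) 0 :: ('f::field_char_0, 'm::finite, 'n::finite) ralg | p q. True}"
    (is "?W = ra.span ?B")
proof
  show "?W \<subseteq> ra.span ?B"
  proof
    fix x :: "('f, 'm, 'n) ralg" assume "x \<in> ?W"
    then have x: "x \<in> total Rstar" and wt: "\<And>\<kappa>. \<kappa> \<in> Poly_Mapping.keys x \<Longrightarrow> weight \<kappa> = 3 / 2"
      by (auto simp: weight_space_def)
    have "S a m b n \<in> ra.span ?B" if "coef x (a, m, b, n) \<noteq> 0" for a m b n
    proof -
      have "(block a, block b, m, n) \<in> Poly_Mapping.keys x"
        using that by (auto simp: coef_def in_keys_iff)
      from wt[OF this] have "(2 * (of_nat (m + n) + of_bool (block a = 0) + of_bool (block b = 0)) +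
          of_bool (block a = 1) + of_bool (block b = 1) :: rat) = 3"
        by (simp add: weight_def field_simps)
      \<comment> \<open>Doubling the weight reduces the condition to an equation between natural
        numbers.\<close>
      then have "(of_nat (2 * (m + n + of_bool (block a = 0) + of_bool (block b = 0)) +
          of_bool (block a = 1) + of_bool (block b = 1)) :: rat) = of_nat 3"
        by simp
      then have *: "2 * (m + n + of_bool (block a = 0) + of_bool (block b = 0)) +
          of_bool (block a = 1) + of_bool (block b = 1) = 3"
        by (simp only: of_nat_eq_iff)
      have lr: "S (Inl p) 0 (Inr q) 0 \<in> ra.span ?B" for p q
        by (rule ra.span_base) blast
      then have "S (Inr q) 0 (Inl p) 0 \<in> ra.span ?B" for p q
        unfolding S_swap[of "Inr q" 0 "Inl p" 0] by (rule ra.span_scale)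
      \<comment> \<open>This parity argument excludes two indices of the second block; two of the
        first block already have weight at least 2.\<close>
      moreover have "2 * m + 2 * n \<noteq> Suc 0" by presburger
      ultimately show ?thesis using * lr
        by (cases a; cases b) simp_all
    qed
    then have "ra_scale 2 x \<in> ra.span ?B"
      unfolding S_expansion[OF x] by (auto intro!: ra.span_sum ra.span_scale)
    then show "x \<in> ra.span ?B"
      by (rule subspace_cancel[OF ra.subspace_span]) simp
  qed
  show "ra.span ?B \<subseteq> ?W"
  proof (rule ra.span_minimal[OF _ weight_space_subspace], clarify)
    fix p :: 'm and q :: 'n
    let ?E = "elt (mtx_unit (Inl p) (Inr q)) 0 1 0 0 :: ('f, 'm, 'n) ralg"
    let ?E' = "elt (mtx_unit (Inr q) (Inl p)) 1 0 0 0 :: ('f, 'm, 'n) ralg"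
    have eq: "S (Inl p) 0 (Inr q) 0 = ?E + ?E'" by (simp add: S_def E_def eps_def)
    have "Poly_Mapping.keys (?E + ?E') \<subseteq> {(0, 1, 0, 0), (1, 0, 0, 0)}"
      using Poly_Mapping.keys_add[of ?E ?E'] by (auto simp: elt_def split: if_splits)
    moreover have "weight (0, 1, 0, 0) = 3 / 2" "weight (1, 0, 0, 0) = 3 / 2"
      by (simp_all add: weight_def)
    ultimately have "\<forall>\<kappa>\<in>Poly_Mapping.keys (S (Inl p) 0 (Inr q) 0 :: ('f, 'm, 'n) ralg). weight \<kappa> = 3 / 2"
      unfolding eq by blast
    then show "S (Inl p) 0 (Inr q) 0 \<in> ?W"
      using S_in_Rstar Rstar_subset_total unfolding weight_space_def by blast
  qed
qed

theorem theorem4p2: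
  shows "simple_conformal_superalgebra ra_scale
      (Rstar :: ('f::field_char_0, 'm::finite, 'n::finite) ralg_graded) ra_D ra_Y \<and>
    weight_space (Rstar :: ('f, 'm, 'n) ralg_graded) (3 / 2) =
      module.span ra_scale
        {elt (mtx_unit (Inl p) (Inr q)) 0 1 0 0 + elt (mtx_unit (Inr q) (Inl p)) 1 0 0 0
          | p q. True} \<and>
    (CARD('m) + CARD('n) > 2 \<longrightarrow>
      generated_by ra_scale (Rstar :: ('f, 'm, 'n) ralg_graded) ra_Y (weight_space Rstar (3 / 2))) \<and>
    (CARD('m) + CARD('n) = 2 \<longrightarrow>
      (\<forall>(p :: 'm) (q :: 'n).
        generated_by ra_scale (Rstar :: ('f, 'm, 'n) ralg_graded) ra_Y
          {elt (mtx_unit (Inl p) (Inr q)) 0 1 0 0 + elt (mtx_unit (Inr q) (Inl p)) 1 0 0 0,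
           elt (mtx_unit (Inr q) (Inr q)) 1 1 0 1 - elt (mtx_unit (Inr q) (Inr q)) 1 1 1 0}))"
proof -
  have odd: "elt (mtx_unit (Inl p) (Inr q)) 0 1 0 0 + elt (mtx_unit (Inr q) (Inl p)) 1 0 0 0 =
      (S (Inl p) 0 (Inr q) 0 :: ('f, 'm, 'n) ralg)" for p q
    by (simp add: S_def E_def eps_def)
  have even: "elt (mtx_unit (Inr q) (Inr q)) 1 1 0 1 - elt (mtx_unit (Inr q) (Inr q)) 1 1 1 0 =
      (S (Inr q) 0 (Inr q) 1 :: ('f, 'm, 'n) ralg)" for q
    by (simp add: S_def E_def eps_def)
  have odd_Rstar: "S (Inl p) 0 (Inr q) 0 \<in> (Rstar 1 :: ('f, 'm, 'n) ralg set)" for p q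
    by (rule S_in_Rstar) simp
  have even_Rstar: "S (Inr q) 0 (Inr q) 1 \<in> (Rstar 0 :: ('f, 'm, 'n) ralg set)" for q
    by (rule S_in_Rstar) simp
  have "generated_by ra_scale Rstar ra_Y (weight_space (Rstar :: ('f, 'm, 'n) ralg_graded) (3 / 2))"
    if "CARD('m) + CARD('n) > 2"
  proof (rule generated_byI)
    have "weight_space (Rstar :: ('f, 'm, 'n) ralg_graded) (3 / 2) \<subseteq> Rstar 1"
      unfolding weight_space_three_halves by (rule ra.span_minimal[OF _ Rstar_subspace]) (use odd_Rstar in blast)
    then show "weight_space (Rstar :: ('f, 'm, 'n) ralg_graded) (3 / 2) \<subseteq> Rstar 0 \<union> Rstar 1" by blast
    show "S (Inl p) 0 (Inr q) 0 \<in> weight_space (Rstar :: ('f, 'm, 'n) ralg_graded) (3 / 2)" for p q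
      unfolding weight_space_three_halves by (rule ra.span_base) blast
  qed (use that in blast)
  moreover have "generated_by ra_scale Rstar ra_Y {S (Inl p) 0 (Inr q) 0 :: ('f, 'm, 'n) ralg, S (Inr q) 0 (Inr q) 1}"
    if c: "CARD('m) + CARD('n) = 2" for p q
  proof (rule generated_byI)
    \<comment> \<open>For k = 2 each block has exactly one index, so the given \<open>p\<close> and
      \<open>q\<close> are the only ones.\<close>
    have "CARD('m) > 0" "CARD('n) > 0" by simp_all
    with c have "CARD('m) = 1" "CARD('n) = 1" by linarith+
    then have all: "p' = p" "q' = q" for p' q'
      by (metis (full_types) UNIV_I card_1_singletonE singletonD)+
    show "S (Inl p') 0 (Inr q') 0 \<in> {S (Inl p) 0 (Inr q) 0 :: ('f, 'm, 'n) ralg, S (Inr q) 0 (Inr q) 1}" for p' q'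
      using all(1)[of p'] all(2)[of q'] by simp
    have "S (Inr q') 0 (Inr q') 1 \<in> {S (Inl p) 0 (Inr q) 0 :: ('f, 'm, 'n) ralg, S (Inr q) 0 (Inr q) 1}" for q'
      using all(2)[of q'] by simp
    then show "CARD('m) + CARD('n) > 2 \<or>
        (\<forall>q'. S (Inr q') 0 (Inr q') 1 \<in> {S (Inl p) 0 (Inr q) 0 :: ('f, 'm, 'n) ralg, S (Inr q) 0 (Inr q) 1})"
      by blast
  qed (use odd_Rstar even_Rstar in blast)
  ultimately show ?thesis
    unfolding odd even weight_space_three_halves[symmetric] using Rstar_simple by blast
qed

end
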